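(* Let $n\ge2$, let $D\subset\mathbb R^n$ be an embedding domain and let $D'=\varphi(D)\subset\mathbb R^n$ be the image of $D$ under a $Q$-quasiisometrical homeomorphism $\varphi:D\to D'$ for some $0<Q<\infty$. Let $1<p<\infty$, $1\le q\le p$, $q<n$, let $1\le s\le r<\frac{nq}{n-q}$, and let $w$ be a weight satisfying the $A_p$-condition with $$K(w)=\max\left\{\left\|w^{-\frac1p}\mid L_{\frac{pq}{p-q}}(D')\right\|,\ \left\|w^{\frac1s}\mid L_{\frac{rs}{r-s}}(D')\right\|\right\}<+\infty .$$ Then the embedding operator $i:W^1_p(D',w)\hookrightarrow L_s(D',w)$ is compact. If instead $r=\frac{nq}{n-q}$ (all other hypotheses unchanged), then the embedding operator $i$ is bounded.
   Context: A weight is a locally summable function $w:\mathbb R^n\to[0,\infty)$. It satisfies the $A_p$-condition ($1<p<\infty$) if $\sup_{B}\left(\frac1{|B|}\int_B w\right)\left(\frac1{|B|}\int_B w^{1/(1-p)}\right)^{p-1}<+\infty$ over all balls $B\subset\mathbb R^n$. $L_s(D',w)$ has norm $\left(\int_{D'}|f|^s w\,dx\right)^{1/s}$; $L_t(D')$ is the usual (unweighted) Lebesgue space, with $t=\infty$ (essential supremum norm) when the denominator in the index vanishes ($p=q$ or $r=s$). $W^1_p(D',w)$ is the space of locally summable, weakly differentiable $f:D'\to\mathbb R$ with finite norm $\left(\int_{D'}|f|^pw\,dx\right)^{1/p}+\left(\int_{D'}|\nabla f|^pw\,dx\right)^{1/p}$. $L^1_q(D)$ is the space of locally summable weakly differentiable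 functions with seminorm $\|f\mid L^1_q(D)\|=\left(\int_D|\nabla f|^q\,dx\right)^{1/q}$ finite. A bounded domain $D\subset\mathbb R^n$ is an embedding domain if for every $1\le q<n$ and every $r\le nq/(n-q)$ ($r\ge 1$) there is a constant $M$ (depending, for the given $D$, only on $q$ and $r$) with $\inf_{c\in\mathbb R}\|f-c\mid L_r(D)\|\le M\|f\mid L^1_q(D)\|$ for all $f\in L^1_q(D)$. A homeomorphism $\varphi:D\to D'$ between domains of $\mathbb R^n$ is $Q$-quasiisometrical if for all $x\in D$: $\frac1Q\le\liminf_{z\to x}\frac{|\varphi(x)-\varphi(z)|}{|x-z|}\le\limsup_{z\to x}\frac{|\varphi(x)-\varphi(z)|}{|x-z|}\le Q$. *)

theory Defs
  imports "HOL-Analysis.Analysis" "HOL-Probability.Essential_Supremum"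
begin

definition region :: "'a::euclidean_space set \<Rightarrow> bool" where
  "region D \<longleftrightarrow> open D \<and> connected D \<and> D \<noteq> {}"

text \<open>Extended real powers of elements of \<open>[0,\<infinity>]\<close>, with \<open>0\<close> to a negative power equal to
  \<open>\<infinity>\<close>. (In contrast, \<^term>\<open>(0::real) powr a = 0\<close> for every \<open>a\<close>, which would make
  negative powers of a vanishing weight harmless.)\<close>

definition epowr :: "ennreal \<Rightarrow> real \<Rightarrow> ennreal" where
  "epowr x a =
     (if a = 0 then 1
      else if a > 0 then (if x = \<infinity> then \<infinity> else ennreal (enn2real x powr a))
      else if x = \<infinity> then 0
      else if x = 0 then \<infinity>
      else ennreal (enn2real x powr a))"

text \<open>The unweighted norm of the modulus \<open>h\<close> in \<open>L\<^sub>t(S)\<close>, for \<open>0 < t \<le> \<infinity>\<close>.\<close>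

definition Lnorm :: "ennreal \<Rightarrow> 'a::euclidean_space set \<Rightarrow> ('a \<Rightarrow> ennreal) \<Rightarrow> ennreal" where
  "Lnorm t S h =
     (if t = \<infinity> then esssup (lebesgue_on S) h
      else epowr (\<integral>\<^sup>+x. epowr (h x) (enn2real t) \<partial>lebesgue_on S) (1 / enn2real t))"

definition wLnorm :: "real \<Rightarrow> 'a::euclidean_space set \<Rightarrow> ('a \<Rightarrow> real) \<Rightarrow> ('a \<Rightarrow> 'b::real_normed_vector) \<Rightarrow> ennreal"
  where
  "wLnorm s S w f =
     epowr (\<integral>\<^sup>+x. ennreal (norm (f x) powr s * w x) \<partial>lebesgue_on S) (1 / s)"

definition wLspace :: "real \<Rightarrow> 'a::euclidean_space set \<Rightarrow> ('a \<Rightarrow> real) \<Rightarrow> ('a \<Rightarrow> real) set" where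
  "wLspace s S w = {f. f \<in> borel_measurable (lebesgue_on S) \<and> wLnorm s S w f < \<infinity>}"

definition locally_summable_on ::
    "('a::euclidean_space \<Rightarrow> 'b::euclidean_space) \<Rightarrow> 'a set \<Rightarrow> bool" where
  "locally_summable_on f S \<longleftrightarrow> (\<forall>K. compact K \<and> K \<subseteq> S \<longrightarrow> f absolutely_integrable_on K)"

definition weight :: "('a::euclidean_space \<Rightarrow> real) \<Rightarrow> bool" where
  "weight w \<longleftrightarrow> (\<forall>x. 0 \<le> w x) \<and> locally_summable_on w UNIV"

definition emean :: "'a::euclidean_space set \<Rightarrow> ('a \<Rightarrow> ennreal) \<Rightarrow> ennreal" where
  "emean B h = (\<integral>\<^sup>+x. h x \<partial>lebesgue_on B) / emeasure lebesgue B"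

text \<open>The convention \<open>0 * \<infinity> = 0\<close> of \<^typ>\<open>ennreal\<close> only matters if \<open>w = 0\<close> almost everywhere;
  otherwise a larger ball makes the product infinite as soon as it is undefined for some ball.\<close>

definition Ap_condition :: "real \<Rightarrow> ('a::euclidean_space \<Rightarrow> real) \<Rightarrow> bool" where
  "Ap_condition p w \<longleftrightarrow>
     (SUP (a, \<rho>) \<in> UNIV \<times> {0<..}.
        emean (ball a \<rho>) (\<lambda>x. ennreal (w x)) *
        epowr (emean (ball a \<rho>) (\<lambda>x. epowr (ennreal (w x)) (1 / (1 - p)))) (p - 1)) < \<infinity>"

text \<open>In \<^typ>\<open>ennreal\<close> we have \<open>a / 0 = \<infinity>\<close> for \<open>a > 0\<close>, so that the exponents below
  are \<open>\<infinity>\<close> when \<open>p = q\<close> and \<open>r = s\<close>, respectively.\<close>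

definition Kconst ::
    "real \<Rightarrow> real \<Rightarrow> real \<Rightarrow> real \<Rightarrow> 'a::euclidean_space set \<Rightarrow> ('a \<Rightarrow> real) \<Rightarrow> ennreal" where
  "Kconst p q r s S w =
     max (Lnorm (ennreal (p * q) / ennreal (p - q)) S (\<lambda>x. epowr (ennreal (w x)) (- 1 / p)))
         (Lnorm (ennreal (r * s) / ennreal (r - s)) S (\<lambda>x. epowr (ennreal (w x)) (1 / s)))"

primrec Ck :: "nat \<Rightarrow> ('a::euclidean_space \<Rightarrow> real) \<Rightarrow> bool" where
  "Ck 0 f \<longleftrightarrow> continuous_on UNIV f"
| "Ck (Suc k) f \<longleftrightarrow>
     (\<forall>x. f differentiable (at x)) \<and> (\<forall>v. Ck k (\<lambda>x. frechet_derivative f (at x) v))"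

definition test_function_on :: "'a::euclidean_space set \<Rightarrow> ('a \<Rightarrow> real) \<Rightarrow> bool" where
  "test_function_on D \<eta> \<longleftrightarrow>
     (\<forall>k. Ck k \<eta>) \<and> compact (closure {x. \<eta> x \<noteq> 0}) \<and> closure {x. \<eta> x \<noteq> 0} \<subseteq> D"

definition has_weak_gradient_on ::
    "('a::euclidean_space \<Rightarrow> real) \<Rightarrow> ('a \<Rightarrow> 'a) \<Rightarrow> 'a set \<Rightarrow> bool" where
  "has_weak_gradient_on f g D \<longleftrightarrow>
     locally_summable_on f D \<and> locally_summable_on g D \<and>
     (\<forall>\<eta>. test_function_on D \<eta> \<longrightarrow>
        (\<forall>b\<in>Basis.
           (LINT x|lebesgue_on D. f x * frechet_derivative \<eta> (at x) b) =
           - (LINT x|lebesgue_on D. (g x \<bullet> b) * \<eta> x)))"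

definition weakly_differentiable_on :: "('a::euclidean_space \<Rightarrow> real) \<Rightarrow> 'a set \<Rightarrow> bool" where
  "weakly_differentiable_on f D \<longleftrightarrow> (\<exists>g. has_weak_gradient_on f g D)"

text \<open>The weak gradient is unique up to null subsets of \<open>D\<close>; this picks a representative.\<close>

definition weak_gradient :: "'a::euclidean_space set \<Rightarrow> ('a \<Rightarrow> real) \<Rightarrow> 'a \<Rightarrow> 'a" where
  "weak_gradient D f = (SOME g. has_weak_gradient_on f g D)"

definition W1norm :: "real \<Rightarrow> 'a::euclidean_space set \<Rightarrow> ('a \<Rightarrow> real) \<Rightarrow> ('a \<Rightarrow> real) \<Rightarrow> ennreal" where
  "W1norm p D w f = wLnorm p D w f + wLnorm p D w (weak_gradient D f)"

definition W1space :: "real \<Rightarrow> 'a::euclidean_space set \<Rightarrow> ('a \<Rightarrow> real) \<Rightarrow> ('a \<Rightarrow> real) set" where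
  "W1space p D w =
     {f. locally_summable_on f D \<and> weakly_differentiable_on f D \<and> W1norm p D w f < \<infinity>}"

definition L1seminorm :: "real \<Rightarrow> 'a::euclidean_space set \<Rightarrow> ('a \<Rightarrow> real) \<Rightarrow> ennreal" where
  "L1seminorm q D f = Lnorm (ennreal q) D (\<lambda>x. ennreal (norm (weak_gradient D f x)))"

definition L1space :: "real \<Rightarrow> 'a::euclidean_space set \<Rightarrow> ('a \<Rightarrow> real) set" where
  "L1space q D =
     {f. locally_summable_on f D \<and> weakly_differentiable_on f D \<and> L1seminorm q D f < \<infinity>}"

definition embedding_domain :: "'a::euclidean_space set \<Rightarrow> bool" where
  "embedding_domain D \<longleftrightarrow>
     region D \<and> bounded D \<and>
     (\<forall>q r. 1 \<le> q \<and> q < real DIM('a) \<and>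
            1 \<le> r \<and> r \<le> real DIM('a) * q / (real DIM('a) - q) \<longrightarrow>
        (\<exists>M::real. \<forall>f\<in>L1space q D.
           (INF c. Lnorm (ennreal r) D (\<lambda>x. ennreal \<bar>f x - c\<bar>)) \<le> ennreal M * L1seminorm q D f))"

definition quasiisometrical ::
    "real \<Rightarrow> 'a::euclidean_space set \<Rightarrow> 'a set \<Rightarrow> ('a \<Rightarrow> 'a) \<Rightarrow> bool" where
  "quasiisometrical Q D D' \<phi> \<longleftrightarrow>
     region D \<and> region D' \<and> (\<exists>\<psi>. homeomorphism D D' \<phi> \<psi>) \<and>
     (\<forall>x\<in>D.
        ereal (1 / Q) \<le> Liminf (at x within D) (\<lambda>z. ereal (norm (\<phi> x - \<phi> z) / norm (x - z))) \<and>
        Limsup (at x within D) (\<lambda>z. ereal (norm (\<phi> x - \<phi> z) / norm (x - z))) \<le> ereal Q)"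

text \<open>A space is given by its carrier, a set of functions, and its norm; functions that agree
  almost everywhere are not identified. The embedding operator is \<open>f \<mapsto> f\<close>, and its
  being well defined is the inclusion of the carriers. Compactness of the operator is
  expressed by sequences: the image of every bounded sequence has a convergent subsequence.\<close>

definition bounded_embedding ::
    "('a \<Rightarrow> real) set \<Rightarrow> (('a \<Rightarrow> real) \<Rightarrow> ennreal) \<Rightarrow>
     ('a \<Rightarrow> real) set \<Rightarrow> (('a \<Rightarrow> real) \<Rightarrow> ennreal) \<Rightarrow> bool" where
  "bounded_embedding X nX Y nY \<longleftrightarrow>
     X \<subseteq> Y \<and> (\<exists>C::real. \<forall>f\<in>X. nY f \<le> ennreal C * nX f)"

definition compact_embedding ::
    "('a \<Rightarrow> real) set \<Rightarrow> (('a \<Rightarrow> real) \<Rightarrow> ennreal) \<Rightarrow>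
     ('a \<Rightarrow> real) set \<Rightarrow> (('a \<Rightarrow> real) \<Rightarrow> ennreal) \<Rightarrow> bool" where
  "compact_embedding X nX Y nY \<longleftrightarrow>
     bounded_embedding X nX Y nY \<and>
     (\<forall>u. (\<forall>k::nat. u k \<in> X) \<and> (\<exists>B::real. \<forall>k. nX (u k) \<le> ennreal B) \<longrightarrow>
        (\<exists>g\<in>Y. \<exists>\<sigma>. strict_mono \<sigma> \<and> (\<lambda>k. nY (\<lambda>x. u (\<sigma> k) x - g x)) \<longlonglongrightarrow> 0))"

end

theory Submission
  imports Defs "HOL-Library.Diagonal_Subsequence"
begin

text \<open>
  Hoelder's inequality, in the form of Young's inequality for functions of unit norm, puts \<open>f\<close>
  and its gradient into \<open>L\<^sub>q(D')\<close>. Composing with \<open>\<phi>\<close> gives an element of \<open>L\<^sup>1\<^sub>q(D)\<close>; the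
  embedding property of \<open>D\<close>, transported back to \<open>D'\<close>, bounds \<open>f\<close> in \<open>L\<^sub>t(D')\<close> with
  \<open>t = nq/(n-q)\<close>, and the integrability of the weight turns this into a bound in
  \<open>L\<^sub>s(D',w)\<close>. For compactness, a Poincare inequality on small cubes makes bounded sequences
  precompact in \<open>L\<^sub>1\<close> on compact subsets of \<open>D'\<close>; the bound in \<open>L\<^sub>t\<close> controls the rest of
  \<open>D'\<close>, which has finite measure, and interpolation between \<open>L\<^sub>1\<close> and \<open>L\<^sub>t\<close> reaches every
  \<open>r < t\<close>.

  The chain rule for \<open>f \<circ> \<phi>\<close> does not go through Rademacher's theorem. Difference quotients show
  \<open>\<bar>\<integral> (f \<circ> \<phi>) \<partial>\<^sub>b \<eta>\<bar> \<le> L \<integral> \<bar>\<nabla>f \<circ> \<phi>\<bar> \<bar>\<eta>\<bar>\<close> for smooth \<open>f\<close>, hence by mollification for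
  all \<open>f\<close>, and a functional dominated in this way by an \<open>L\<^sub>1\<close> norm is represented by a function.
\<close>

section \<open>Smooth functions and mollifiers\<close>

text \<open>The case \<open>q = 1\<close> shapes the proof. There the gradients are bounded only in
  \<open>L\<^sub>1\<close>, where bounded sets are not weakly precompact, so the Poincare step uses
  nothing but the \<open>L\<^sub>1\<close> norm of the gradient. For the same reason the functional
  in the chain rule is compared with the finite measure of density
  \<open>\<bar>\<nabla>f \<circ> \<phi>\<bar>\<close>: a mere bound on its norm would only yield a
  vector measure. \<open>D'\<close> inherits no boundary regularity through \<open>\<phi>\<close>,
  hence compactness is obtained in the interior, and near the boundary the bound in
  \<open>L\<^sub>t\<close> acts as uniform integrability. Only the existence of constants is at
  stake. This permits the normalisation that replaces Hoelder by Young, the Lipschitz constant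
  \<open>2 * Q\<close> in place of \<open>Q\<close>, and a dimensional factor in the gradient bound.
  The strict inequality \<open>r < t\<close> enters once: it lets a small multiple of the power
  \<open>t\<close> absorb the power \<open>r\<close>. The limit of the sequence is an almost
  everywhere limit and is placed in the weighted space by Fatou's lemma.\<close>

lemma Ck_SucI:
  assumes "\<And>x. (f has_derivative f' x) (at x)" "\<And>v. Ck k (\<lambda>x. f' x v)"
  shows "Ck (Suc k) f"
  using assms frechet_derivative_at[OF assms(1)] by (auto simp: differentiable_def)

lemma Ck_SucD:
  assumes "Ck (Suc k) f"
  shows "(f has_derivative frechet_derivative f (at x)) (at x)" "Ck k (\<lambda>x. frechet_derivative f (at x) v)"
  using assms by (auto simp: frechet_derivative_works)

lemma Ck_decrease: "Ck (Suc k) f \<Longrightarrow> Ck k f"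
proof (induction k arbitrary: f)
  case 0
  then show ?case
    by (auto intro!: continuous_at_imp_continuous_on differentiable_imp_continuous_within)
next
  case (Suc k)
  then show ?case by simp
qed

lemma Ck_const: "Ck k (\<lambda>x. c)"
  by (induction k arbitrary: c) (auto intro: Ck_SucI[OF has_derivative_const] simp del: Ck.simps(2))

lemma Ck_add: "Ck k f \<Longrightarrow> Ck k g \<Longrightarrow> Ck k (\<lambda>x. f x + g x)"
proof (induction k arbitrary: f g)
  case (Suc k)
  show ?case
    by (rule Ck_SucI[OF has_derivative_add[OF Ck_SucD(1)[OF Suc.prems(1)] Ck_SucD(1)[OF Suc.prems(2)]]])
      (intro Suc.IH Ck_SucD(2)[OF Suc.prems(1)] Ck_SucD(2)[OF Suc.prems(2)])
qed (auto intro!: continuous_intros)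

lemma Ck_mult: "Ck k f \<Longrightarrow> Ck k g \<Longrightarrow> Ck k (\<lambda>x. f x * g x)"
proof (induction k arbitrary: f g)
  case (Suc k)
  show ?case
    by (rule Ck_SucI[OF has_derivative_mult[OF Ck_SucD(1)[OF Suc.prems(1)] Ck_SucD(1)[OF Suc.prems(2)]]])
      (intro Ck_add Suc.IH Ck_SucD(2)[OF Suc.prems(1)] Ck_SucD(2)[OF Suc.prems(2)]
        Ck_decrease[OF Suc.prems(1)] Ck_decrease[OF Suc.prems(2)])
qed (auto intro!: continuous_intros)

lemma Ck_inner: "Ck k (\<lambda>x. (x - a) \<bullet> v)"
proof (cases k)
  case 0
  then show ?thesis by (auto intro!: continuous_intros)
next
  case (Suc i)
  have "((\<lambda>x. (x - a) \<bullet> v) has_derivative (\<lambda>h. h \<bullet> v)) (at x)" for x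
    by (auto intro!: derivative_eq_intros)
  from Ck_SucI[OF this Ck_const] show ?thesis
    unfolding Suc .
qed

text \<open>The family is closed under differentiation up to linear combinations, so that smoothness
  of every member follows by one induction over the order.\<close>

definition flat :: "nat \<Rightarrow> real \<Rightarrow> real" where
  "flat j t = (if t > 0 then exp (- 1 / t) / t ^ j else 0)"

lemma flat_nonneg: "0 \<le> flat j t"
  by (simp add: flat_def)

lemma flat_pos: "0 < t \<Longrightarrow> 0 < flat j t"
  by (simp add: flat_def)

text \<open>The exponential series of \<open>1 / t\<close> dominates its single term of order
  \<open>j + 2\<close>; inverting gives the bound. The two surplus powers of \<open>t\<close> are
  what makes the difference quotient at 0 vanish.\<close>

lemma flat_le: "flat j t \<le> fact (j + 2) * t\<^sup>2"
proof (cases "t > 0")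
  case True
  have "(1/t) ^ (j+2) / fact (j+2) = (\<Sum>n\<in>{j+2}. (1/t) ^ n /\<^sub>R fact n)"
    by (simp add: divide_inverse mult.commute)
  also have "\<dots> \<le> (\<Sum>n. (1/t) ^ n /\<^sub>R fact n)"
    using True by (intro sum_le_suminf summable_exp_generic) auto
  finally have "(1/t) ^ (j+2) / fact (j+2) \<le> exp (1 / t)"
    by (simp add: exp_def)
  then have "1 / exp (1/t) \<le> fact (j+2) * t ^ (j+2)"
  proof -
    assume *: "(1/t) ^ (j+2) / fact (j+2) \<le> exp (1 / t)"
    have "1 / A \<le> E \<longleftrightarrow> 1 / E \<le> A" if "0 < A" "0 < E" for A E :: real
      using that by (simp add: field_simps)
    from this[of "fact (j+2) * t ^ (j+2)" "exp (1/t)"] * True show ?thesis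
      by (simp add: power_divide mult.commute del: fact_Suc add_2_eq_Suc')
  qed
  then have "exp (-1/t) \<le> fact (j+2) * t ^ (j+2)"
    by (simp add: exp_minus inverse_eq_divide del: fact_Suc add_2_eq_Suc')
  then have "exp (-1/t) / t ^ j \<le> fact (j+2) * t\<^sup>2 * t ^ j / t ^ j"
    using True by (intro divide_right_mono) (auto simp: power_add mult_ac power2_eq_square simp del: fact_Suc)
  then show ?thesis
    using True by (simp add: flat_def del: fact_Suc)
next
  case False
  then show ?thesis by (simp add: flat_def)
qed

lemma flat_has_derivative:
  "(flat j has_real_derivative (flat (j + 2) t - real j * flat (j + 1) t)) (at t)"
proof -
  consider "t > 0" | "t < 0" | "t = 0" by linarith
  then show ?thesis
  proof cases
    case 1
    have "((\<lambda>t. exp (- 1 / t)) has_real_derivative exp (- 1 / t) * (1 / t\<^sup>2)) (at t)"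
      using 1 by (auto intro!: derivative_eq_intros simp: power2_eq_square)
    moreover have "((\<lambda>t. t ^ j) has_real_derivative real j * t ^ (j - 1)) (at t)"
      by (auto intro!: derivative_eq_intros)
    ultimately have "((\<lambda>t. exp (- 1 / t) / t ^ j) has_real_derivative
      (exp (- 1 / t) * (1 / t\<^sup>2) * t ^ j - exp (- 1 / t) * (real j * t ^ (j - 1))) / (t ^ j * t ^ j)) (at t)"
      using 1 by (intro DERIV_divide) auto
    also have "(exp (- 1 / t) * (1 / t\<^sup>2) * t ^ j - exp (- 1 / t) * (real j * t ^ (j - 1))) / (t ^ j * t ^ j)
      = flat (j + 2) t - real j * flat (j + 1) t"
    proof -
      have "(e * (1 / t\<^sup>2) * t ^ j - e * (real j * t ^ (j - 1))) / (t ^ j * t ^ j)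
        = e / t ^ (j + 2) - real j * (e / t ^ (j + 1))" for e
        using 1 by (cases j) (simp_all add: field_simps power2_eq_square)
      then show ?thesis
        using 1 by (simp add: flat_def)
    qed
    finally have "((\<lambda>t. exp (- 1 / t) / t ^ j) has_real_derivative
      (flat (j + 2) t - real j * flat (j + 1) t)) (at t)" .
    then show ?thesis
      by (rule has_field_derivative_transform_within_open[where S="{0<..}"]) (use 1 in \<open>auto simp: flat_def\<close>)
  next
    case 2
    have "((\<lambda>t. 0) has_real_derivative (flat (j + 2) t - real j * flat (j + 1) t)) (at t)"
      using 2 by (auto simp: flat_def)
    then show ?thesis
      by (rule has_field_derivative_transform_within_open[where S="{..<0}"]) (use 2 in \<open>auto simp: flat_def\<close>)
  next
    case 3
    \<comment> \<open>At 0 every member of the family vanishes, so the claim reduces to this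
      quotient, which the quadratic bound \<open>flat_le\<close> squeezes.\<close>
    have "((\<lambda>h. flat j h / h) \<longlongrightarrow> 0) (at 0)"
    proof (rule Lim_null_comparison)
      show "\<forall>\<^sub>F h in at 0. norm (flat j h / h) \<le> fact (j+2) * \<bar>h\<bar>"
        using flat_le[of j] flat_nonneg[of j]
        by (intro always_eventually) (auto simp: divide_le_eq power2_eq_square abs_mult mult.assoc)
      show "((\<lambda>h::real. fact (j+2) * \<bar>h\<bar>) \<longlongrightarrow> 0) (at 0)"
        by (auto intro!: tendsto_eq_intros)
    qed
    moreover have "flat i 0 = 0" for i by (simp add: flat_def)
    ultimately show ?thesis
      using 3 by (simp add: DERIV_def)
  qed
qed

lemma Ck_flat: "Ck k (\<lambda>y. flat j (a - (y - x) \<bullet> (y - x)))"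
proof (induction k arbitrary: j)
  case 0
  have c: "continuous_on UNIV (flat j)"
    by (intro continuous_at_imp_continuous_on ballI DERIV_isCont[OF flat_has_derivative])
  have "continuous_on UNIV (\<lambda>y. flat j (a - (y - x) \<bullet> (y - x)))"
    by (rule continuous_on_compose2[OF c]) (auto intro!: continuous_intros)
  then show ?case by simp
next
  case (Suc k)
  \<comment> \<open>The outer derivative in the chain rule. The inner function is quadratic, so its
    derivative only contributes a smooth linear factor.\<close>
  define F where "F = (\<lambda>y. flat (j + 2) (a - (y - x) \<bullet> (y - x)) + (- real j) * flat (j + 1) (a - (y - x) \<bullet> (y - x)))"
  have "Ck k F"
    unfolding F_def by (intro Ck_add Ck_mult Suc.IH Ck_const)
  then have "Ck k (\<lambda>y. F y * ((-2) * ((y - x) \<bullet> v)))" for v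
    by (intro Ck_mult Ck_inner Ck_const)
  moreover have "((\<lambda>y. flat j (a - (y - x) \<bullet> (y - x))) has_derivative (\<lambda>v. F y * ((-2) * ((y - x) \<bullet> v)))) (at y)" for y
  proof -
    have "((\<lambda>y. a - (y - x) \<bullet> (y - x)) has_derivative (\<lambda>v. (-2) * ((y - x) \<bullet> v))) (at y)"
      by (auto intro!: derivative_eq_intros simp: inner_commute)
    from DERIV_compose_FDERIV[OF flat_has_derivative this]
    show ?thesis by (simp add: F_def mult.commute)
  qed
  ultimately show ?case
    by (intro Ck_SucI)
qed

section \<open>Translations and their continuity in \<open>L\<^sub>1\<close>\<close>

lemma lborel_distr_plus_right: "distr lborel borel (\<lambda>y. y + h) = (lborel :: 'a::euclidean_space measure)"
  using lborel_distr_plus[of h] by (simp add: add.commute cong: distr_cong)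

lemma lborel_integral_translate:
  fixes f :: "'a::euclidean_space \<Rightarrow> 'b::{banach, second_countable_topology}"
  assumes "f \<in> borel_measurable lborel"
  shows "(\<integral>x. f (x + h) \<partial>lborel) = (\<integral>x. f x \<partial>lborel)"
    and "integrable lborel (\<lambda>x. f (x + h)) \<longleftrightarrow> integrable lborel f"
  using integral_distr[of "\<lambda>y. y + h" lborel borel f]
    integrable_distr_eq[of "\<lambda>y. y + h" lborel borel f] assms
  by (simp_all add: lborel_distr_plus_right)

lemma lborel_integrable_translate:
  fixes f :: "'a::euclidean_space \<Rightarrow> 'b::{banach, second_countable_topology}"
  assumes "integrable lborel f"
  shows "integrable lborel (\<lambda>x. f (x + h))"
  using lborel_integral_translate(2)[OF borel_measurable_integrable[OF assms]] assms by auto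

text \<open>The boundary of \<open>U\<close> may have positive measure, and there the shifted
  indicators need not converge. Hence only the measure of the overlap of \<open>U\<close> with its
  translate is passed to the limit; since both sets have the same finite measure, the overlap
  determines the symmetric difference.\<close>

lemma translation_continuous_open:
  fixes U :: "'a::euclidean_space set"
  assumes U: "open U" "emeasure lborel U < \<infinity>" and h: "h \<longlonglongrightarrow> 0"
  shows "(\<lambda>n. \<integral>x. \<bar>indicator U (x + h n) - (indicator U x :: real)\<bar> \<partial>lborel) \<longlonglongrightarrow> 0"
proof -
  have [measurable]: "U \<in> sets borel" using U(1) by simp
  have i: "integrable lborel (indicator U :: 'a \<Rightarrow> real)"
    using U by (auto simp: integrable_indicator_iff)
  have i2: "integrable lborel (\<lambda>x. indicator U (x + h n) :: real)" for n
    using lborel_integral_translate(2)[of "indicator U :: 'a \<Rightarrow> real" "h n"] i by simp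
  have i3: "integrable lborel (\<lambda>x. indicator U x * indicator U (x + h n) :: real)" for n
    by (rule Bochner_Integration.integrable_bound[OF i]) (auto simp: indicator_def)
  \<comment> \<open>The integrand converges pointwise because \<open>U\<close> is open; points outside \<open>U\<close> contribute nothing.\<close>
  have "(\<lambda>n. \<integral>x. indicator U x * indicator U (x + h n) \<partial>lborel) \<longlonglongrightarrow> (\<integral>x. (indicator U x :: real) \<partial>lborel)"
  proof (rule integral_dominated_convergence[where w="indicator U"])
    show "AE x in lborel. (\<lambda>n. indicator U x * indicator U (x + h n)) \<longlonglongrightarrow> (indicator U x :: real)"
    proof (rule AE_I2)
      fix x
      have "(\<lambda>n. x + h n) \<longlonglongrightarrow> x" using tendsto_add[OF tendsto_const h, of x] by simp
      then have "x \<in> U \<Longrightarrow> \<forall>\<^sub>F n in sequentially. x + h n \<in> U"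
        using U(1) topological_tendstoD by blast
      then show "(\<lambda>n. indicator U x * indicator U (x + h n)) \<longlonglongrightarrow> (indicator U x :: real)"
        by (cases "x \<in> U") (auto intro!: tendsto_eventually elim: eventually_mono)
    qed
  qed (use i in \<open>auto simp: indicator_def\<close>)
  then have "(\<lambda>n. 2 * ((\<integral>x. (indicator U x :: real) \<partial>lborel) - (\<integral>x. indicator U x * indicator U (x + h n) \<partial>lborel))) \<longlonglongrightarrow> 0"
    by (auto intro!: tendsto_eq_intros)
  moreover have "(\<integral>x. \<bar>indicator U (x + h n) - (indicator U x :: real)\<bar> \<partial>lborel) =
      2 * ((\<integral>x. (indicator U x :: real) \<partial>lborel) - (\<integral>x. indicator U x * indicator U (x + h n) \<partial>lborel))" for n
  proof -
    have "(\<integral>x. \<bar>indicator U (x + h n) - (indicator U x :: real)\<bar> \<partial>lborel) =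
       (\<integral>x. (indicator U (x + h n) + indicator U x) - 2 * (indicator U x * indicator U (x + h n)) \<partial>lborel)"
      by (intro Bochner_Integration.integral_cong) (auto simp: indicator_def)
    also have "\<dots> = (\<integral>x. indicator U (x + h n) \<partial>lborel) + (\<integral>x. indicator U x \<partial>lborel)
        - 2 * (\<integral>x. indicator U x * indicator U (x + h n) \<partial>lborel)"
      using i i2 i3 by simp
    finally show ?thesis
      using lborel_integral_translate(1)[of "indicator U :: 'a \<Rightarrow> real" "h n"] by simp
  qed
  ultimately show ?thesis by simp
qed

text \<open>The triangle inequality through \<open>g\<close>. The error \<open>f - g\<close> occurs
  once in place and once translated, with equal norms, hence the factor 2.\<close>

lemma L1_translation_continuous_aux:
  fixes f g :: "'a::euclidean_space \<Rightarrow> 'b::{banach, second_countable_topology}"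
  assumes f: "integrable lborel f" and g: "integrable lborel g"
  shows "(\<integral>x. norm (f (x + h) - f x) \<partial>lborel) \<le>
     2 * (\<integral>x. norm (f x - g x) \<partial>lborel) + (\<integral>x. norm (g (x + h) - g x) \<partial>lborel)"
proof -
  have fh: "integrable lborel (\<lambda>x. f (x + h))" "integrable lborel (\<lambda>x. g (x + h))"
    by (rule lborel_integrable_translate[OF f] lborel_integrable_translate[OF g])+
  have "(\<integral>x. norm (f (x + h) - f x) \<partial>lborel) \<le>
    (\<integral>x. norm (f (x + h) - g (x + h)) + norm (f x - g x) + norm (g (x + h) - g x) \<partial>lborel)"
  proof (intro integral_mono)
    fix x
    have "norm (A + B + C) \<le> norm A + norm B + norm C" for A B C :: 'b
      by (rule order_trans[OF norm_triangle_ineq add_right_mono[OF norm_triangle_ineq]])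
    from this[of "f (x + h) - g (x + h)" "g x - f x" "g (x + h) - g x"]
    show "norm (f (x + h) - f x) \<le> norm (f (x + h) - g (x + h)) + norm (f x - g x) + norm (g (x + h) - g x)"
      by (simp add: norm_minus_commute)
  qed (use f g fh in auto)
  also have "\<dots> = (\<integral>x. norm (f (x + h) - g (x + h)) \<partial>lborel) + (\<integral>x. norm (f x - g x) \<partial>lborel) + (\<integral>x. norm (g (x + h) - g x) \<partial>lborel)"
    using f g fh by simp
  also have "(\<integral>x. norm (f (x + h) - g (x + h)) \<partial>lborel) = (\<integral>x. norm (f x - g x) \<partial>lborel)"
    using f g lborel_integral_translate(1)[of "\<lambda>x. norm (f x - g x)" h] by simp
  finally show ?thesis by simp
qed

text \<open>By \<open>approx\<close> the claim is stable under approximation in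
  \<open>L\<^sub>1\<close>. Outer regularity then extends it from open sets to sets of finite
  measure, and sums and dominated limits extend it to all integrable functions.\<close>

lemma L1_translation_continuous_seq:
  fixes f :: "'a::euclidean_space \<Rightarrow> 'b::{banach, second_countable_topology}"
  assumes f: "integrable lborel f" and h: "h \<longlonglongrightarrow> 0"
  shows "(\<lambda>n. \<integral>x. norm (f (x + h n) - f x) \<partial>lborel) \<longlonglongrightarrow> 0"
proof -
  have approx: "(\<lambda>n. \<integral>x. norm (f (x + h n) - f x) \<partial>lborel) \<longlonglongrightarrow> 0"
    if f: "integrable lborel f"
    and *: "\<And>e::real. 0 < e \<Longrightarrow> \<exists>g. integrable lborel g \<and> (\<integral>x. norm (f x - g x) \<partial>lborel) < e \<and>
      (\<lambda>n. \<integral>x. norm (g (x + h n) - g x) \<partial>lborel) \<longlonglongrightarrow> 0" for f :: "'a \<Rightarrow> 'b"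
  proof (rule LIMSEQ_I)
    fix e :: real assume "0 < e"
    then obtain g where g: "integrable lborel g" "(\<integral>x. norm (f x - g x) \<partial>lborel) < e / 4"
      and l: "(\<lambda>n. \<integral>x. norm (g (x + h n) - g x) \<partial>lborel) \<longlonglongrightarrow> 0"
      using *[of "e / 4"] by auto
    obtain N where N: "\<And>n. n \<ge> N \<Longrightarrow> norm (\<integral>x. norm (g (x + h n) - g x) \<partial>lborel) < e / 2"
      using LIMSEQ_D[OF l, of "e / 2"] \<open>0 < e\<close> by auto
    have "norm ((\<integral>x. norm (f (x + h n) - f x) \<partial>lborel) - 0) < e" if "n \<ge> N" for n
      using L1_translation_continuous_aux[OF f g(1), of "h n"] g(2) N[OF that] by simp
    then show "\<exists>N. \<forall>n\<ge>N. norm ((\<integral>x. norm (f (x + h n) - f x) \<partial>lborel) - 0) < e" by auto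
  qed
  show ?thesis using f
  proof (induction f rule: integrable_induct)
    case (base A c)
    then have A: "A \<in> sets borel" by simp
    show ?case
    proof (rule approx)
      show "integrable lborel (\<lambda>x. indicator A x *\<^sub>R c)"
        using base by auto
      fix e :: real assume e: "0 < e"
      define d where "d = e / (norm c + 1)"
      have d: "0 < d" using e by (simp add: d_def add_nonneg_pos)
      obtain U where U: "open U" "A \<subseteq> U" "emeasure lborel (U - A) < ennreal d"
        using outer_regular_lborel[OF A d] by auto
      have [measurable]: "U \<in> sets borel" "A \<in> sets borel" using U A by auto
      have "emeasure lborel (A \<union> (U - A)) \<le> emeasure lborel A + emeasure lborel (U - A)"
        by (rule emeasure_subadditive) auto
      moreover have "emeasure lborel (U - A) < \<infinity>"
        using U(3) by (rule less_trans) simp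
      moreover have "A \<union> (U - A) = U" using U(2) by auto
      ultimately have fU: "emeasure lborel U < \<infinity>"
        using base(2) by (metis ennreal_add_eq_top infinity_ennreal_def neq_top_trans less_top)
      show "\<exists>g. integrable lborel g \<and> (\<integral>x. norm (indicator A x *\<^sub>R c - g x) \<partial>lborel) < e \<and>
         (\<lambda>n. \<integral>x. norm (g (x + h n) - g x) \<partial>lborel) \<longlonglongrightarrow> 0"
      proof (intro exI[of _ "\<lambda>x. indicator U x *\<^sub>R c"] conjI)
        show "integrable lborel (\<lambda>x. indicator U x *\<^sub>R c)"
          using fU by (auto simp: )
        have "(\<integral>x. norm (indicator A x *\<^sub>R c - indicator U x *\<^sub>R c) \<partial>lborel) = (\<integral>x. indicator (U - A) x * norm c \<partial>lborel)"
          using U(2) by (intro Bochner_Integration.integral_cong) (auto simp: indicator_def)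
        also have "\<dots> = measure lborel (U - A) * norm c"
          by simp
        also have "\<dots> \<le> d * norm c"
          using U(3) d by (intro mult_right_mono) (auto simp: measure_def intro!: enn2real_leI)
        also have "\<dots> < e"
        proof -
          have "0 < 1 + norm c" by (simp add: add_pos_nonneg)
          then show ?thesis using e by (simp add: d_def field_simps)
        qed
        finally show "(\<integral>x. norm (indicator A x *\<^sub>R c - indicator U x *\<^sub>R c) \<partial>lborel) < e" .
        have "(\<lambda>n. (\<integral>x. \<bar>indicator U (x + h n) - (indicator U x :: real)\<bar> \<partial>lborel) * norm c) \<longlonglongrightarrow> 0"
          using translation_continuous_open[OF U(1) fU h] by (rule tendsto_mult_left_zero)
        moreover have "(\<integral>x. norm (indicator U (x + h n) *\<^sub>R c - indicator U x *\<^sub>R c) \<partial>lborel) =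
           (\<integral>x. \<bar>indicator U (x + h n) - (indicator U x :: real)\<bar> \<partial>lborel) * norm c" for n
          by (subst integral_mult_left_zero[symmetric], intro Bochner_Integration.integral_cong)
            (auto simp: scaleR_left_diff_distrib[symmetric] norm_scaleR)
        ultimately show "(\<lambda>n. \<integral>x. norm (indicator U (x + h n) *\<^sub>R c - indicator U x *\<^sub>R c) \<partial>lborel) \<longlonglongrightarrow> 0"
          by simp
      qed
    qed
  next
    case (add f g)
    have fh: "integrable lborel (\<lambda>x. f (x + h n))" "integrable lborel (\<lambda>x. g (x + h n))" for n
      by (rule lborel_integrable_translate[OF add.hyps(1)] lborel_integrable_translate[OF add.hyps(2)])+
    show ?case
    proof (rule tendsto_sandwich[OF _ _ tendsto_const])
      show "(\<lambda>n. (\<integral>x. norm (f (x + h n) - f x) \<partial>lborel) + (\<integral>x. norm (g (x + h n) - g x) \<partial>lborel)) \<longlonglongrightarrow> 0"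
        using tendsto_add[OF add.IH] by simp
      have "(\<integral>x. norm (f (x + h n) + g (x + h n) - (f x + g x)) \<partial>lborel) \<le>
         (\<integral>x. norm (f (x + h n) - f x) + norm (g (x + h n) - g x) \<partial>lborel)" for n
        using add.hyps fh by (intro integral_mono) (auto intro: norm_diff_triangle_ineq)
      also have "\<dots> n = (\<integral>x. norm (f (x + h n) - f x) \<partial>lborel) + (\<integral>x. norm (g (x + h n) - g x) \<partial>lborel)" for n
        using add.hyps fh by simp
      finally show "\<forall>\<^sub>F n in sequentially. (\<integral>x. norm (f (x + h n) + g (x + h n) - (f x + g x)) \<partial>lborel) \<le> (\<integral>x. norm (f (x + h n) - f x) \<partial>lborel) + (\<integral>x. norm (g (x + h n) - g x) \<partial>lborel)"
        by simp
    qed auto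
  next
    case (lim f s)
    show ?case
    proof (rule approx)
      fix e :: real assume e: "0 < e"
      have "(\<lambda>i. \<integral>x. norm (f x - s i x) \<partial>lborel) \<longlonglongrightarrow> integral\<^sup>L lborel (\<lambda>x::'a. 0)"
      \<comment> \<open>The induction rule supplies approximants of norm at most
        \<open>2 * norm (f x)\<close>; adding \<open>f\<close> itself gives the factor 3.\<close>
      proof (rule integral_dominated_convergence[where w="\<lambda>x. 3 * norm (f x)"])
        show "AE x in lborel. (\<lambda>i. norm (f x - s i x)) \<longlonglongrightarrow> 0"
          using lim by (intro AE_I2 tendsto_norm_zero) (auto intro!: tendsto_eq_intros)
        have "norm (f x - s i x) \<le> 3 * norm (f x)" for i x
        proof -
          have "norm (s i x) \<le> 2 * norm (f x)" using lim by auto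
          then show ?thesis using norm_triangle_ineq4[of "f x" "s i x"] by simp
        qed
        then show "AE x in lborel. norm (norm (f x - s i x)) \<le> 3 * norm (f x)" for i by simp
      qed (use lim in auto)
      from LIMSEQ_D[OF this e] obtain i where "(\<integral>x. norm (f x - s i x) \<partial>lborel) < e"
        by (auto simp: abs_less_iff)
      then show "\<exists>g. integrable lborel g \<and> (\<integral>x. norm (f x - g x) \<partial>lborel) < e \<and>
         (\<lambda>n. \<integral>x. norm (g (x + h n) - g x) \<partial>lborel) \<longlonglongrightarrow> 0"
        using lim by blast
    qed (fact lim)
  qed
qed

lemma L1_translation_continuous:
  fixes f :: "'a::euclidean_space \<Rightarrow> 'b::{banach, second_countable_topology}"
  assumes f: "integrable lborel f" and e: "0 < (e::real)"
  obtains d where "0 < d" "\<And>h. norm h < d \<Longrightarrow> (\<integral>x. norm (f (x + h) - f x) \<partial>lborel) < e"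
proof -
  have "((\<lambda>h. \<integral>x. norm (f (x + h) - f x) \<partial>lborel) \<longlongrightarrow> 0) (at 0)"
    unfolding tendsto_at_iff_sequentially comp_def
    using L1_translation_continuous_seq[OF f] by auto
  from LIM_D[OF this e] obtain d where "d > 0"
    "\<And>h. h \<noteq> 0 \<Longrightarrow> norm h < d \<Longrightarrow> norm ((\<integral>x. norm (f (x + h) - f x) \<partial>lborel) - 0) < e"
    by auto
  then have "(\<integral>x. norm (f (x + h) - f x) \<partial>lborel) < e" if "norm h < d" for h
    using that e by (cases "h = 0") auto
  with \<open>d > 0\<close> show ?thesis by (rule that)
qed

section \<open>Mollification\<close>

text \<open>The integral in the denominator is positive only for \<open>\<epsilon> \<noteq> 0\<close>; for \<open>\<epsilon> = 0\<close> the
  mollifier vanishes identically.\<close>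

definition mollifier :: "real \<Rightarrow> 'a::euclidean_space \<Rightarrow> real" where
  "mollifier \<epsilon> x = flat 0 (\<epsilon>\<^sup>2 - x \<bullet> x) / (\<integral>y. flat 0 (\<epsilon>\<^sup>2 - (y::'a) \<bullet> y) \<partial>lborel)"

lemma flat_eq_0_iff: "flat j t = 0 \<longleftrightarrow> t \<le> 0"
  by (auto simp: flat_def)

lemma Ck_imp_continuous: "Ck k f \<Longrightarrow> continuous_on UNIV f"
  by (induction k) (use Ck_decrease in auto)

lemma integrable_continuous_compact_support:
  fixes f :: "'a::euclidean_space \<Rightarrow> 'b::{banach, second_countable_topology}"
  assumes "continuous_on UNIV f" "compact S" "\<And>x. x \<notin> S \<Longrightarrow> f x = 0"
  shows "integrable lborel f"
proof -
  have "integrable lborel (\<lambda>x. indicator S x *\<^sub>R f x)"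
    using assms by (intro borel_integrable_compact continuous_on_subset[OF assms(1)]) auto
  moreover have "(\<lambda>x. indicator S x *\<^sub>R f x) = f"
    using assms(3) by (auto simp: indicator_def fun_eq_iff)
  ultimately show ?thesis by simp
qed

lemma flat_ball_zero:
  assumes "0 < \<epsilon>" "\<epsilon> \<le> norm (x :: 'a::euclidean_space)"
  shows "flat j (\<epsilon>\<^sup>2 - x \<bullet> x) = 0"
  using assms power_mono[of \<epsilon> "norm x" 2] by (simp add: flat_eq_0_iff power2_norm_eq_inner)

lemma flat_ball_pos:
  assumes "norm (x :: 'a::euclidean_space) < \<epsilon>"
  shows "0 < flat j (\<epsilon>\<^sup>2 - x \<bullet> x)"
  using assms power_strict_mono[of "norm x" \<epsilon> 2] by (intro flat_pos) (simp add: power2_norm_eq_inner)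

lemma continuous_flat_ball: "continuous_on UNIV (\<lambda>x::'a::euclidean_space. flat j (\<epsilon>\<^sup>2 - x \<bullet> x))"
  using Ck_imp_continuous[OF Ck_flat[of 0 j "\<epsilon>\<^sup>2" 0]] by simp

lemma integrable_flat_ball:
  "0 < \<epsilon> \<Longrightarrow> integrable lborel (\<lambda>x::'a::euclidean_space. flat j (\<epsilon>\<^sup>2 - x \<bullet> x))"
  by (rule integrable_continuous_compact_support[OF continuous_flat_ball compact_cball[of 0 \<epsilon>]])
    (auto simp: flat_ball_zero)

lemma integral_flat_ball_pos:
  assumes "0 < \<epsilon>"
  shows "0 < (\<integral>x. flat 0 (\<epsilon>\<^sup>2 - x \<bullet> x) \<partial>(lborel :: 'a::euclidean_space measure))"
proof -
  have "(\<integral>x. flat 0 (\<epsilon>\<^sup>2 - x \<bullet> x) \<partial>(lborel :: 'a measure)) \<noteq> 0"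
  proof
    assume "(\<integral>x. flat 0 (\<epsilon>\<^sup>2 - x \<bullet> x) \<partial>(lborel :: 'a measure)) = 0"
    then have "AE x in (lborel :: 'a measure). flat 0 (\<epsilon>\<^sup>2 - x \<bullet> x) = 0"
      using integral_nonneg_eq_0_iff_AE[OF integrable_flat_ball[OF assms]] by (auto simp: flat_nonneg)
    then have "AE x in (lborel :: 'a measure). x \<notin> ball 0 \<epsilon>"
    proof eventually_elim
      case (elim x)
      then show ?case using flat_ball_pos[of x \<epsilon> 0] by auto
    qed
    then have "emeasure lborel (ball (0::'a) \<epsilon>) = 0"
      by (simp add: AE_iff_measurable[OF _ refl] ball_def)
    then show False
      using assms content_ball_pos[of \<epsilon> "0::'a"] by (simp add: measure_def)
  qed
  moreover have "0 \<le> (\<integral>x. flat 0 (\<epsilon>\<^sup>2 - x \<bullet> x) \<partial>(lborel :: 'a measure))"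
    by (simp add: flat_nonneg)
  ultimately show ?thesis by linarith
qed

lemma mollifier_nonneg: "0 < \<epsilon> \<Longrightarrow> 0 \<le> mollifier \<epsilon> x"
  by (simp add: mollifier_def flat_nonneg)

lemma mollifier_zero: "0 < \<epsilon> \<Longrightarrow> \<epsilon> \<le> norm x \<Longrightarrow> mollifier \<epsilon> x = 0"
  by (simp add: mollifier_def flat_ball_zero)

lemma continuous_mollifier: "continuous_on UNIV (mollifier \<epsilon>)"
  unfolding mollifier_def divide_inverse
  by (intro continuous_on_mult_right continuous_flat_ball)

lemma measurable_mollifier [measurable]: "mollifier \<epsilon> \<in> borel_measurable borel"
  by (rule borel_measurable_continuous_onI[OF continuous_mollifier])

lemma integrable_mollifier: "0 < \<epsilon> \<Longrightarrow> integrable lborel (mollifier \<epsilon>)"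
  unfolding mollifier_def divide_inverse by (intro integrable_mult_left integrable_flat_ball)

lemma integral_mollifier: "0 < \<epsilon> \<Longrightarrow> (\<integral>x. mollifier \<epsilon> (x::'a::euclidean_space) \<partial>lborel) = 1"
  unfolding mollifier_def using integral_flat_ball_pos[of \<epsilon>, where 'a='a] by simp

lemma Ck_mollifier: "Ck k (\<lambda>y. mollifier \<epsilon> (y - x))"
  unfolding mollifier_def divide_inverse by (intro Ck_mult Ck_const Ck_flat)

lemma test_function_mollifier:
  assumes "0 < \<epsilon>" "cball x \<epsilon> \<subseteq> D"
  shows "test_function_on D (\<lambda>y. mollifier \<epsilon> (y - x))"
proof -
  have "{y. mollifier \<epsilon> (y - x) \<noteq> 0} \<subseteq> cball x \<epsilon>"
    using mollifier_zero[OF assms(1)] by (force simp: dist_norm norm_minus_commute not_le)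
  then have "closure {y. mollifier \<epsilon> (y - x) \<noteq> 0} \<subseteq> cball x \<epsilon>"
    by (simp add: closure_minimal)
  then show ?thesis
    unfolding test_function_on_def using assms(2) Ck_mollifier
    by (auto intro!: compact_closure[THEN iffD2] bounded_subset[OF bounded_cball, OF order_trans[OF closure_subset]])
qed

text \<open>As a function of \<open>y\<close> the kernel is literally the test function of
  \<open>test_function_mollifier\<close>. It is even, so this is the usual convolution.\<close>

definition mollify :: "real \<Rightarrow> ('a::euclidean_space \<Rightarrow> 'b::euclidean_space) \<Rightarrow> 'a \<Rightarrow> 'b" where
  "mollify \<epsilon> f x = (\<integral>y. mollifier \<epsilon> (y - x) *\<^sub>R f y \<partial>lborel)"

lemma compact_support_bounded:
  fixes k :: "'a::euclidean_space \<Rightarrow> real"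
  assumes "continuous_on UNIV k" "compact S" "\<And>x. x \<notin> S \<Longrightarrow> k x = 0"
  obtains B where "0 < B" "\<And>x. \<bar>k x\<bar> \<le> B"
proof -
  have "bounded (k ` S)"
    using assms by (intro compact_imp_bounded compact_continuous_image continuous_on_subset[OF assms(1)]) auto
  then obtain B where "B > 0" "\<And>x. x \<in> S \<Longrightarrow> \<bar>k x\<bar> \<le> B"
    by (auto simp: bounded_pos)
  then show ?thesis using assms(3) by (metis abs_zero less_imp_le that)
qed

text \<open>A general kernel, because both the mollifier and its directional derivatives are
  integrated against \<open>f\<close>.\<close>

lemma integrable_kernel_mult:
  fixes k :: "'a::euclidean_space \<Rightarrow> real" and f :: "'a \<Rightarrow> 'b::euclidean_space"
  assumes k: "continuous_on UNIV k" "compact S" "\<And>x. x \<notin> S \<Longrightarrow> k x = 0" and f: "integrable lborel f"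
  shows "integrable lborel (\<lambda>y. k (y - x) *\<^sub>R f y)"
proof -
  obtain B where B: "0 < B" "\<And>x. \<bar>k x\<bar> \<le> B" using compact_support_bounded[OF k] by metis
  have [measurable]: "k \<in> borel_measurable borel" by (rule borel_measurable_continuous_onI[OF k(1)])
  have [measurable]: "f \<in> borel_measurable borel" using f by simp
  show ?thesis
  proof (rule Bochner_Integration.integrable_bound)
    show "integrable lborel (\<lambda>y. B * norm (f y))" using f by simp
    show "AE y in lborel. norm (k (y - x) *\<^sub>R f y) \<le> norm (B * norm (f y))"
      using B by (auto intro!: mult_right_mono)
  qed measurable
qed

lemma mollifier_zero_cball: "0 < \<epsilon> \<Longrightarrow> x \<notin> cball 0 \<epsilon> \<Longrightarrow> mollifier \<epsilon> x = 0"
  by (rule mollifier_zero) auto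

lemma integrable_mollifier_mult:
  fixes f :: "'a::euclidean_space \<Rightarrow> 'b::euclidean_space"
  assumes "0 < \<epsilon>" "integrable lborel f"
  shows "integrable lborel (\<lambda>y. mollifier \<epsilon> (y - x) *\<^sub>R f y)"
  by (rule integrable_kernel_mult[OF continuous_mollifier compact_cball mollifier_zero_cball[OF assms(1)] assms(2)])

lemma mollify_shift:
  fixes f :: "'a::euclidean_space \<Rightarrow> 'b::euclidean_space"
  assumes "0 < \<epsilon>" "integrable lborel f"
  shows "mollify \<epsilon> f x = (\<integral>y. mollifier \<epsilon> y *\<^sub>R f (x + y) \<partial>lborel)"
    and "integrable lborel (\<lambda>y. mollifier \<epsilon> y *\<^sub>R f (x + y))"
proof -
  have [measurable]: "f \<in> borel_measurable borel" using assms by simp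
  have "(\<lambda>y. mollifier \<epsilon> (y - x) *\<^sub>R f y) \<in> borel_measurable lborel" by measurable
  from lborel_integral_translate(1,2)[OF this, of x]
  show "mollify \<epsilon> f x = (\<integral>y. mollifier \<epsilon> y *\<^sub>R f (x + y) \<partial>lborel)"
    "integrable lborel (\<lambda>y. mollifier \<epsilon> y *\<^sub>R f (x + y))"
    using integrable_mollifier_mult[OF assms]
    by (simp_all add: mollify_def add.commute)
qed

lemma mollify_measurable [measurable]:
  fixes f :: "'a::euclidean_space \<Rightarrow> 'b::euclidean_space"
  assumes "integrable lborel f"
  shows "mollify \<epsilon> f \<in> borel_measurable borel"
proof -
  have [measurable]: "f \<in> borel_measurable borel" using assms by simp
  have "(\<lambda>(x, y). mollifier \<epsilon> (y - x) *\<^sub>R f y) \<in> borel_measurable (borel \<Otimes>\<^sub>M lborel)"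
    by measurable
  then show ?thesis
    unfolding mollify_def by (intro lborel.borel_measurable_lebesgue_integral) simp
qed

text \<open>The error is an average of the translation differences \<open>f (x + y) - f x\<close>
  with weight \<open>mollifier \<epsilon> y\<close> of total mass 1 on
  \<open>norm y < \<epsilon>\<close>. By Tonelli its norm is at most the largest of their
  norms.\<close>

lemma mollify_L1:
  fixes f :: "'a::euclidean_space \<Rightarrow> 'b::euclidean_space"
  assumes f: "integrable lborel f" and e: "0 < (e::real)"
  obtains d where "0 < d" "\<And>\<epsilon>. 0 < \<epsilon> \<Longrightarrow> \<epsilon> < d \<Longrightarrow> (\<integral>\<^sup>+x. norm (mollify \<epsilon> f x - f x) \<partial>lborel) \<le> ennreal e"
proof -
  have [measurable]: "f \<in> borel_measurable borel" using f by simp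
  obtain d where d: "0 < d" and tr: "\<And>h. norm h < d \<Longrightarrow> (\<integral>x. norm (f (x + h) - f x) \<partial>lborel) < e"
    using L1_translation_continuous[OF f e] by metis
  have "(\<integral>\<^sup>+x. norm (mollify \<epsilon> f x - f x) \<partial>lborel) \<le> ennreal e" if \<epsilon>: "0 < \<epsilon>" "\<epsilon> < d" for \<epsilon>
  proof -
    have "norm (mollify \<epsilon> f x - f x) \<le> (\<integral>\<^sup>+y. ennreal (mollifier \<epsilon> y) * norm (f (x + y) - f x) \<partial>lborel)" for x
    proof -
      have c: "(\<integral>y. mollifier \<epsilon> y *\<^sub>R f x \<partial>lborel) = f x"
        using integrable_mollifier[OF \<epsilon>(1)] by (subst integral_scaleR_left) (auto simp: integral_mollifier[OF \<epsilon>(1)])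
      have i: "integrable lborel (\<lambda>y. mollifier \<epsilon> y *\<^sub>R f x)" "integrable lborel (\<lambda>y. mollifier \<epsilon> y *\<^sub>R f (x + y))"
        using integrable_mollifier[OF \<epsilon>(1)] mollify_shift(2)[OF \<epsilon>(1) f] by auto
      have "mollify \<epsilon> f x - f x = (\<integral>y. mollifier \<epsilon> y *\<^sub>R f (x + y) - mollifier \<epsilon> y *\<^sub>R f x \<partial>lborel)"
        unfolding Bochner_Integration.integral_diff[OF i(2,1)] c mollify_shift(1)[OF \<epsilon>(1) f] ..
      then have "norm (mollify \<epsilon> f x - f x) \<le> (\<integral>\<^sup>+y. norm (mollifier \<epsilon> y *\<^sub>R f (x + y) - mollifier \<epsilon> y *\<^sub>R f x) \<partial>lborel)"
        using i by (simp only:) (intro integral_norm_bound_ennreal Bochner_Integration.integrable_diff)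
      also have "\<dots> = (\<integral>\<^sup>+y. ennreal (mollifier \<epsilon> y) * norm (f (x + y) - f x) \<partial>lborel)"
        by (intro nn_integral_cong) (simp add: mollifier_nonneg[OF \<epsilon>(1)] scaleR_right_diff_distrib[symmetric] ennreal_mult abs_of_nonneg)
      finally show ?thesis .
    qed
    then have "(\<integral>\<^sup>+x. norm (mollify \<epsilon> f x - f x) \<partial>lborel) \<le>
       (\<integral>\<^sup>+x. \<integral>\<^sup>+y. ennreal (mollifier \<epsilon> y) * norm (f (x + y) - f x) \<partial>lborel \<partial>lborel)"
      by (intro nn_integral_mono)
    also have "\<dots> = (\<integral>\<^sup>+y. \<integral>\<^sup>+x. ennreal (mollifier \<epsilon> y) * norm (f (x + y) - f x) \<partial>lborel \<partial>lborel)"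
      by (rule lborel_pair.Fubini') measurable
    also have "\<dots> = (\<integral>\<^sup>+y. ennreal (mollifier \<epsilon> y) * (\<integral>\<^sup>+x. norm (f (x + y) - f x) \<partial>lborel) \<partial>lborel)"
      by (intro nn_integral_cong nn_integral_cmult) measurable
    also have "\<dots> \<le> (\<integral>\<^sup>+y. ennreal (mollifier \<epsilon> (y::'a)) * ennreal e \<partial>lborel)"
    proof (intro nn_integral_mono)
      fix y :: 'a
      show "ennreal (mollifier \<epsilon> y) * (\<integral>\<^sup>+x. norm (f (x + y) - f x) \<partial>lborel) \<le> ennreal (mollifier \<epsilon> y) * ennreal e"
      proof (cases "norm y < \<epsilon>")
        case True
        have "(\<integral>\<^sup>+x. norm (f (x + y) - f x) \<partial>lborel) = ennreal (\<integral>x. norm (f (x + y) - f x) \<partial>lborel)"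
          using lborel_integrable_translate[OF f] f by (intro nn_integral_eq_integral) auto
        also have "\<dots> \<le> ennreal e"
          using tr[of y] True \<epsilon> by (intro ennreal_leI) auto
        finally show ?thesis by (intro mult_left_mono) auto
      next
        case False
        then show ?thesis using mollifier_zero[OF \<epsilon>(1), of y] by simp
      qed
    qed
    also have "\<dots> = (\<integral>\<^sup>+y. ennreal (mollifier \<epsilon> (y::'a)) \<partial>lborel) * ennreal e"
      by (rule nn_integral_multc) measurable
    also have "(\<integral>\<^sup>+y. ennreal (mollifier \<epsilon> (y::'a)) \<partial>lborel) = 1"
      by (subst nn_integral_eq_integral)
        (simp_all add: integrable_mollifier[OF \<epsilon>(1)] integral_mollifier[OF \<epsilon>(1)] mollifier_nonneg[OF \<epsilon>(1)])
    finally show ?thesis by simp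
  qed
  with d show ?thesis by (rule that)
qed

lemma continuous_kernel_integral:
  fixes k :: "'a::euclidean_space \<Rightarrow> real" and f :: "'a \<Rightarrow> 'b::euclidean_space"
  assumes k: "continuous_on UNIV k" "compact S" "\<And>x. x \<notin> S \<Longrightarrow> k x = 0" and f: "integrable lborel f"
  shows "continuous_on UNIV (\<lambda>x. \<integral>y. k (y - x) *\<^sub>R f y \<partial>lborel)"
proof -
  obtain B where B: "0 < B" "\<And>x. \<bar>k x\<bar> \<le> B" using compact_support_bounded[OF k] by metis
  have [measurable]: "k \<in> borel_measurable borel" by (rule borel_measurable_continuous_onI[OF k(1)])
  have [measurable]: "f \<in> borel_measurable borel" using f by simp
  show ?thesis
    unfolding continuous_on_sequentially comp_def
  proof (intro allI ballI impI, elim conjE)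
    fix X and a :: 'a assume X: "X \<longlonglongrightarrow> a"
    show "(\<lambda>n. \<integral>y. k (y - X n) *\<^sub>R f y \<partial>lborel) \<longlonglongrightarrow> (\<integral>y. k (y - a) *\<^sub>R f y \<partial>lborel)"
    proof (rule integral_dominated_convergence[where w="\<lambda>y. B * norm (f y)"])
      have "(\<lambda>n. k (y - X n)) \<longlonglongrightarrow> k (y - a)" for y
        by (rule continuous_on_tendsto_compose[OF k(1)]) (auto intro!: tendsto_intros X)
      then show "AE y in lborel. (\<lambda>n. k (y - X n) *\<^sub>R f y) \<longlonglongrightarrow> k (y - a) *\<^sub>R f y"
        by (auto intro!: tendsto_intros)
    qed (use f B in \<open>auto intro!: mult_right_mono\<close>)
  qed
qed

section \<open>Smooth approximation and uniqueness of weak gradients\<close>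

lemma frechet_derivative_continuous_Ck:
  assumes "Ck (Suc k) f"
  shows "continuous_on UNIV (\<lambda>x. frechet_derivative f (at x) h)"
  using Ck_imp_continuous[OF Ck_SucD(2)[OF assms]] .

lemma Ck_mollifier': "Ck k (mollifier \<epsilon>)"
  using Ck_mollifier[of k \<epsilon> 0] by simp

lemma frechet_derivative_mollifier_zero:
  assumes "0 < \<epsilon>" "x \<notin> cball 0 \<epsilon>"
  shows "frechet_derivative (mollifier \<epsilon>) (at x) h = 0"
proof -
  have "((\<lambda>x. 0) has_derivative (\<lambda>h. 0)) (at x)" by simp
  then have "(mollifier \<epsilon> has_derivative (\<lambda>h. 0)) (at x)"
    by (rule has_derivative_transform_within_open[where s="- cball 0 \<epsilon>"])
      (use assms in \<open>auto simp: mollifier_zero\<close>)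
  from frechet_derivative_at[OF this] show ?thesis by (metis)
qed

text \<open>Uniform in \<open>x\<close> and linear in \<open>h\<close>: this makes the mollifier
  globally Lipschitz and gives its difference quotients a constant majorant.\<close>

lemma frechet_derivative_mollifier_bound:
  assumes "0 < \<epsilon>"
  obtains B where "0 < B" "\<And>x h. \<bar>frechet_derivative (mollifier \<epsilon>) (at (x::'a::euclidean_space)) h\<bar> \<le> B * norm h"
proof -
  let ?k = "\<lambda>x::'a. frechet_derivative (mollifier \<epsilon>) (at x)"
  have "\<exists>B>0. \<forall>x. \<bar>?k x b\<bar> \<le> B" for b
    using compact_support_bounded[OF frechet_derivative_continuous_Ck[OF Ck_mollifier'] compact_cball
        frechet_derivative_mollifier_zero[OF assms]] by metis
  then obtain B where B: "\<And>b. 0 < B b" "\<And>b x. \<bar>?k x b\<bar> \<le> B b" by metis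
  have "\<bar>?k x h\<bar> \<le> (\<Sum>b\<in>Basis. B b) * norm h" for x h
  proof -
    interpret linear "?k x"
      using Ck_SucD(1)[OF Ck_mollifier'] has_derivative_bounded_linear bounded_linear.linear by blast
    have "?k x h = ?k x (\<Sum>b\<in>Basis. (h \<bullet> b) *\<^sub>R b)"
      by (simp add: euclidean_representation)
    also have "\<dots> = (\<Sum>b\<in>Basis. (h \<bullet> b) * ?k x b)"
      by (simp add: sum scaleR)
    also have "\<bar>\<dots>\<bar> \<le> (\<Sum>b\<in>Basis. norm h * B b)"
      by (intro order_trans[OF sum_abs] sum_mono) (auto simp: abs_mult intro!: mult_mono B Basis_le_norm)
    finally show ?thesis by (simp add: sum_distrib_left sum_distrib_right mult.commute)
  qed
  moreover have "0 < (\<Sum>b\<in>(Basis::'a set). B b)" by (intro sum_pos B) auto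
  ultimately show ?thesis using that by blast
qed

text \<open>Differentiation under the integral sign. The point \<open>x\<close> enters the kernel
  through \<open>y - x\<close>, hence the minus sign.\<close>

lemma mollify_has_derivative:
  fixes f :: "'a::euclidean_space \<Rightarrow> real"
  assumes e: "0 < \<epsilon>" and f: "integrable lborel f"
  shows "(mollify \<epsilon> f has_derivative
    (\<lambda>h. - (\<integral>y. frechet_derivative (mollifier \<epsilon>) (at (y - x)) h * f y \<partial>lborel))) (at x)"
proof -
  let ?k = "\<lambda>x::'a. frechet_derivative (mollifier \<epsilon>) (at x)"
  have k: "(mollifier \<epsilon> has_derivative ?k x) (at x)" for x
    by (rule Ck_SucD(1)[OF Ck_mollifier'])
  have lin: "linear (?k x)" for x
    using has_derivative_bounded_linear[OF k] by (rule bounded_linear.linear)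
  obtain B where B: "0 < B" "\<And>x h. \<bar>?k x h\<bar> \<le> B * norm h"
    using frechet_derivative_mollifier_bound[OF e] by blast
  have lip: "\<bar>mollifier \<epsilon> x - mollifier \<epsilon> y\<bar> \<le> B * norm (x - y)" for x y :: 'a
  proof -
    have "norm (mollifier \<epsilon> x - mollifier \<epsilon> y) \<le> B * norm (x - y)"
    proof (rule differentiable_bound[of UNIV _ ?k])
      show "onorm (?k x) \<le> B" for x by (rule onorm_le) (use B in auto)
    qed (use k in auto)
    then show ?thesis by simp
  qed
  have [measurable]: "f \<in> borel_measurable borel" using f by simp
  have mk [measurable]: "(\<lambda>x. ?k x h) \<in> borel_measurable borel" for h
    by (rule borel_measurable_continuous_onI[OF frechet_derivative_continuous_Ck[OF Ck_mollifier']])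
  have ik: "integrable lborel (\<lambda>y. ?k (y - x) h * f y)" for x h
    using integrable_kernel_mult[OF frechet_derivative_continuous_Ck[OF Ck_mollifier'] compact_cball[of 0 \<epsilon>]
        frechet_derivative_mollifier_zero[OF e] f] by simp
  have im: "integrable lborel (\<lambda>y. mollifier \<epsilon> (y - x) * f y)" for x
    using integrable_mollifier_mult[OF e f] by simp
  let ?D = "\<lambda>h. - (\<integral>y. ?k (y - x) h * f y \<partial>lborel)"
  have bl: "bounded_linear ?D"
  proof (rule bounded_linear_intro)
    show "?D (h + h') = ?D h + ?D h'" for h h'
      by (simp add: linear_add[OF lin] distrib_right ik)
    show "?D (r *\<^sub>R h) = r *\<^sub>R ?D h" for r h
      by (simp add: linear_cmul[OF lin] mult.assoc)
    show "norm (?D h) \<le> norm h * (B * (\<integral>y. \<bar>f y\<bar> \<partial>lborel))" for h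
    proof -
      have "norm (?D h) \<le> (\<integral>y. \<bar>?k (y - x) h * f y\<bar> \<partial>lborel)"
        using integral_norm_bound[of lborel "\<lambda>y. ?k (y - x) h * f y"] by simp
      also have "\<dots> \<le> (\<integral>y. (B * norm h) * \<bar>f y\<bar> \<partial>lborel)"
        using integrable_abs[OF ik] f B by (intro integral_mono) (auto simp: abs_mult intro!: mult_right_mono)
      finally show ?thesis by (simp add: mult_ac)
    qed
  qed
  have "((\<lambda>h. norm (mollify \<epsilon> f (x + h) - mollify \<epsilon> f x - ?D h) / norm h) \<longlongrightarrow> 0) (at 0)"
    unfolding tendsto_at_iff_sequentially
  proof (intro allI impI)
    fix H :: "nat \<Rightarrow> 'a" assume H: "\<forall>i. H i \<in> UNIV - {0}" "H \<longlonglongrightarrow> 0"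
    \<comment> \<open>The first-order remainder of the kernel, scaled by \<open>norm (H n)\<close>.
      The argument moves by \<open>- H n\<close>, so the linear term is added. The Lipschitz bound
      and the derivative bound contribute \<open>B\<close> each to the majorant.\<close>
    let ?q = "\<lambda>n y. (mollifier \<epsilon> (y - (x + H n)) - mollifier \<epsilon> (y - x) + ?k (y - x) (H n)) / norm (H n)"
    have "(\<lambda>n. \<integral>y. ?q n y * f y \<partial>lborel) \<longlonglongrightarrow> integral\<^sup>L lborel (\<lambda>y::'a. 0)"
    proof (rule integral_dominated_convergence[where w="\<lambda>y. (2 * B) * \<bar>f y\<bar>"])
      show "AE y in lborel. norm (?q n y * f y) \<le> (2 * B) * \<bar>f y\<bar>" for n
      proof (rule AE_I2)
        fix y
        have "\<bar>mollifier \<epsilon> (y - (x + H n)) - mollifier \<epsilon> (y - x) + ?k (y - x) (H n)\<bar> \<le> 2 * B * norm (H n)"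
          using lip[of "y - (x + H n)" "y - x"] B(2)[of "y - x" "H n"] by simp
        then have "\<bar>?q n y\<bar> \<le> 2 * B"
          using H(1) by (simp add: divide_le_eq)
        then show "norm (?q n y * f y) \<le> (2 * B) * \<bar>f y\<bar>"
            unfolding real_norm_def abs_mult[of "?q n y"] by (rule mult_right_mono) simp
      qed
      show "AE y in lborel. (\<lambda>n. ?q n y * f y) \<longlonglongrightarrow> 0"
      proof (rule AE_I2)
        fix y
        have "((\<lambda>h. norm (mollifier \<epsilon> (y - x + h) - mollifier \<epsilon> (y - x) - ?k (y - x) h) / norm h) \<longlongrightarrow> 0) (at 0)"
          using k[of "y - x"] by (simp add: has_derivative_at)
        moreover have "(\<lambda>n. - H n) \<longlonglongrightarrow> 0" "\<forall>i. - H i \<in> UNIV - {0}"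
          using tendsto_minus[OF H(2)] H(1) by auto
        ultimately have "(\<lambda>n. norm (mollifier \<epsilon> (y - x - H n) - mollifier \<epsilon> (y - x) - ?k (y - x) (- H n)) / norm (- H n)) \<longlonglongrightarrow> 0"
          unfolding tendsto_at_iff_sequentially comp_def
          by (elim allE[where x="\<lambda>n. - H n"]) simp
        then have "(\<lambda>n. norm (?q n y)) \<longlonglongrightarrow> 0"
          by (simp add: linear_neg[OF lin] diff_diff_eq)
        then show "(\<lambda>n. ?q n y * f y) \<longlonglongrightarrow> 0"
          by (rule tendsto_mult_left_zero[OF tendsto_norm_zero_cancel])
      qed
    qed (use f in auto)
    moreover have "(\<integral>y. ?q n y * f y \<partial>lborel) = (mollify \<epsilon> f (x + H n) - mollify \<epsilon> f x - ?D (H n)) / norm (H n)" for n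
    proof -
      have "(\<integral>y. ?q n y * f y \<partial>lborel) =
        (\<integral>y. (mollifier \<epsilon> (y - (x + H n)) * f y - mollifier \<epsilon> (y - x) * f y + ?k (y - x) (H n) * f y) / norm (H n) \<partial>lborel)"
        by (intro Bochner_Integration.integral_cong) (auto simp: field_simps)
      also have "\<dots> = (\<integral>y. mollifier \<epsilon> (y - (x + H n)) * f y - mollifier \<epsilon> (y - x) * f y + ?k (y - x) (H n) * f y \<partial>lborel) / norm (H n)"
        by simp
      also have "(\<integral>y. mollifier \<epsilon> (y - (x + H n)) * f y - mollifier \<epsilon> (y - x) * f y + ?k (y - x) (H n) * f y \<partial>lborel)
         = mollify \<epsilon> f (x + H n) - mollify \<epsilon> f x - ?D (H n)"
        by (simp add: mollify_def im ik)
      finally show ?thesis .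
    qed
    ultimately have "(\<lambda>n. (mollify \<epsilon> f (x + H n) - mollify \<epsilon> f x - ?D (H n)) / norm (H n)) \<longlonglongrightarrow> 0"
      by (simp only: Bochner_Integration.integral_zero)
    then have "(\<lambda>n. norm ((mollify \<epsilon> f (x + H n) - mollify \<epsilon> f x - ?D (H n)) / norm (H n))) \<longlonglongrightarrow> 0"
      by (rule tendsto_norm_zero)
    then show "((\<lambda>h. norm (mollify \<epsilon> f (x + h) - mollify \<epsilon> f x - ?D h) / norm h) \<circ> H) \<longlonglongrightarrow> 0"
      by (simp add: comp_def)
  qed
  with bl show ?thesis by (simp add: has_derivative_at)
qed


section \<open>Borel representatives, smooth approximation and uniqueness\<close>

text \<open>Weak gradients are defined with Lebesgue measurable functions, whereas translation and
  Tonelli are applied over \<open>lborel\<close>. A Borel representative is taken coordinatewise,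
  and cutting off at \<open>K\<close> makes it integrable on the whole space.\<close>

lemma ex_borel_rep:
  fixes f :: "'a::euclidean_space \<Rightarrow> 'b::euclidean_space"
  assumes "f absolutely_integrable_on K"
  obtains f' where "integrable lborel f'" "AE x in lborel. f' x = indicator K x *\<^sub>R f x"
proof -
  have i: "integrable lebesgue (\<lambda>x. indicator K x *\<^sub>R f x)" (is "integrable _ ?h")
    using assms by (simp add: set_integrable_def)
  have "\<exists>g\<in>borel_measurable lborel. AE x in lborel. ?h x \<bullet> b = g x" for b
    using i by (intro completion_ex_borel_measurable_real borel_measurable_inner) auto
  then obtain g where g [measurable]: "\<And>b. g b \<in> borel_measurable lborel" and e: "\<And>b. AE x in lborel. ?h x \<bullet> b = g b x"
    by metis
  define f' where "f' = (\<lambda>x. \<Sum>b\<in>Basis. g b x *\<^sub>R b)"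
  have m [measurable]: "f' \<in> borel_measurable lborel" unfolding f'_def by measurable
  have "AE x in lborel. \<forall>b\<in>Basis. ?h x \<bullet> b = g b x"
    using e by (intro AE_finite_allI) auto
  then have ae: "AE x in lborel. f' x = ?h x"
  proof eventually_elim
    case (elim x)
    have "f' x = (\<Sum>b\<in>Basis. (?h x \<bullet> b) *\<^sub>R b)"
      unfolding f'_def by (intro sum.cong) (use elim in auto)
    also have "\<dots> = ?h x" by (rule euclidean_representation)
    finally show ?case .
  qed
  have "integrable lebesgue f'"
    by (rule integrable_cong_AE_imp[OF i]) (use m ae in \<open>auto intro!: measurable_completion AE_completion simp del: measurable_lborel1\<close>)
  then have "integrable lborel f'"
    using m by (simp add: integrable_completion)
  then show ?thesis using ae that by blast
qed

lemma integral_lebesgue_on_borel_rep: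
  fixes f :: "'a::euclidean_space \<Rightarrow> real"
  assumes f: "f absolutely_integrable_on K"
    and f': "integrable lborel f'" "AE x in lborel. f' x = indicator K x *\<^sub>R f x"
    and g: "g \<in> borel_measurable borel" "\<And>x. x \<notin> K \<Longrightarrow> g x = 0"
    and D: "K \<subseteq> D" "open D"
  shows "(LINT x|lebesgue_on D. f x * g x) = (\<integral>x. f' x * g x \<partial>lborel)"
proof -
  have [measurable]: "f' \<in> borel_measurable borel" using f' by simp
  note g(1)[measurable]
  have "(LINT x|lebesgue_on D. f x * g x) = (LINT x|lebesgue. indicator D x *\<^sub>R (f x * g x))"
    using D(2) by (intro integral_restrict_space) auto
  also have "\<dots> = (LINT x|lebesgue. (indicator K x *\<^sub>R f x) * g x)"
    using g(2) D by (intro Bochner_Integration.integral_cong) (auto simp: indicator_def)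
  also have "\<dots> = (LINT x|lebesgue. f' x * g x)"
  proof (rule integral_cong_AE)
    have gl: "g \<in> borel_measurable lebesgue"
      by (intro measurable_completion) measurable
    have "(\<lambda>x. indicator K x *\<^sub>R f x) \<in> borel_measurable lebesgue"
      using f by (simp add: set_integrable_def)
    then show "(\<lambda>x. (indicator K x *\<^sub>R f x) * g x) \<in> borel_measurable lebesgue"
      using gl by (intro borel_measurable_times)
    show "(\<lambda>x. f' x * g x) \<in> borel_measurable lebesgue"
      by (intro measurable_completion) measurable
    show "AE x in lebesgue. (indicator K x *\<^sub>R f x) * g x = f' x * g x"
      using AE_completion[OF f'(2)] by eventually_elim simp
  qed
  also have "\<dots> = (\<integral>x. f' x * g x \<partial>lborel)"
    by (intro integral_completion) measurable
  finally show ?thesis .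
qed

lemma mollify_inner:
  fixes G :: "'a::euclidean_space \<Rightarrow> 'a"
  assumes "0 < \<epsilon>" "integrable lborel G"
  shows "mollify \<epsilon> G x \<bullet> b = (\<integral>y. (G y \<bullet> b) * mollifier \<epsilon> (y - x) \<partial>lborel)"
  unfolding mollify_def
  using integral_inner_left[OF integrable_mollifier_mult[OF assms], of x b] by (simp add: mult.commute)

text \<open>The weak gradient identity tested with the mollifier centred at \<open>x\<close>, whose
  support lies in \<open>K\<close>, where the representatives agree with \<open>u\<close> and
  \<open>G\<close>. The left side is the derivative of the mollified function given by
  \<open>mollify_has_derivative\<close>.\<close>

lemma mollify_weak_gradient:
  fixes u :: "'a::euclidean_space \<Rightarrow> real"
  assumes wg: "has_weak_gradient_on u G D" and D: "open D" "K \<subseteq> D" "compact K"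
    and u': "integrable lborel u'" "AE x in lborel. u' x = indicator K x *\<^sub>R u x"
    and G': "integrable lborel G'" "AE x in lborel. G' x = indicator K x *\<^sub>R G x"
    and e: "0 < \<epsilon>" "cball x \<epsilon> \<subseteq> K" and b: "b \<in> Basis"
  shows "- (\<integral>y. frechet_derivative (mollifier \<epsilon>) (at (y - x)) b * u' y \<partial>lborel) = mollify \<epsilon> G' x \<bullet> b"
proof -
  let ?\<eta> = "\<lambda>y. mollifier \<epsilon> (y - x)"
  have test: "test_function_on D ?\<eta>"
    using e D by (intro test_function_mollifier) auto
  have d: "frechet_derivative ?\<eta> (at y) b = frechet_derivative (mollifier \<epsilon>) (at (y - x)) b" for y
  proof -
    have "((\<lambda>y. y - x) has_derivative (\<lambda>h. h)) (at y)"
      by (auto intro!: derivative_eq_intros)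
    from has_derivative_compose[OF this Ck_SucD(1)[OF Ck_mollifier']]
    show ?thesis using frechet_derivative_at by metis
  qed
  have z: "y \<notin> K \<Longrightarrow> y - x \<notin> cball 0 \<epsilon>" for y
    using e(2) by (auto simp: dist_norm norm_minus_commute subset_iff)
  have au: "u absolutely_integrable_on K" and aG: "G absolutely_integrable_on K"
    using wg D by (auto simp: has_weak_gradient_on_def locally_summable_on_def)
  have [measurable]: "(\<lambda>x. frechet_derivative (mollifier \<epsilon>) (at (x::'a)) b) \<in> borel_measurable borel"
    by (rule borel_measurable_continuous_onI[OF frechet_derivative_continuous_Ck[OF Ck_mollifier']])
  have "(\<integral>y. u' y * frechet_derivative (mollifier \<epsilon>) (at (y - x)) b \<partial>lborel) =
      (LINT y|lebesgue_on D. u y * frechet_derivative ?\<eta> (at y) b)"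
    unfolding d
    by (intro integral_lebesgue_on_borel_rep[symmetric, OF au u'] frechet_derivative_mollifier_zero e z D) (use D in auto)
  also have "\<dots> = - (LINT y|lebesgue_on D. (G y \<bullet> b) * ?\<eta> y)"
    using wg test b unfolding has_weak_gradient_on_def by blast
  also have "(LINT y|lebesgue_on D. (G y \<bullet> b) * ?\<eta> y) = (\<integral>y. (G' y \<bullet> b) * ?\<eta> y \<partial>lborel)"
  proof (intro integral_lebesgue_on_borel_rep D)
    show "(\<lambda>x. G x \<bullet> b) absolutely_integrable_on K"
      using absolutely_integrable_linear[OF aG bounded_linear_inner_left, of b] by (simp add: comp_def)
    show "integrable lborel (\<lambda>x. G' x \<bullet> b)" using G' by simp
    show "AE x in lborel. G' x \<bullet> b = indicator K x *\<^sub>R (G x \<bullet> b)"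
      using G'(2) by eventually_elim simp
    show "y \<notin> K \<Longrightarrow> ?\<eta> y = 0" for y
      by (intro mollifier_zero_cball e z)
  qed (use D in auto)
  also have "\<dots> = mollify \<epsilon> G' x \<bullet> b"
    using mollify_inner[OF e(1) G'(1)] by simp
  finally show ?thesis by (simp add: mult.commute)
qed

lemma nn_integral_lebesgue_on_borel_rep:
  fixes f :: "'a::euclidean_space \<Rightarrow> 'b::euclidean_space"
  assumes "AE x in lborel. f' x = indicator K x *\<^sub>R f x" "L \<subseteq> K" "L \<in> sets lebesgue"
  shows "(\<integral>\<^sup>+x. ennreal (norm (g x - f x)) \<partial>lebesgue_on L) \<le> (\<integral>\<^sup>+x. ennreal (norm (g x - f' x)) \<partial>lborel)"
proof -
  have "(\<integral>\<^sup>+x. ennreal (norm (g x - f x)) \<partial>lebesgue_on L) = (\<integral>\<^sup>+x. ennreal (norm (g x - f x)) * indicator L x \<partial>lebesgue)"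
    using assms(3) by (intro nn_integral_restrict_space) auto
  also have "\<dots> \<le> (\<integral>\<^sup>+x. ennreal (norm (g x - f' x)) \<partial>lebesgue)"
  proof (rule nn_integral_mono_AE)
    show "AE x in lebesgue. ennreal (norm (g x - f x)) * indicator L x \<le> ennreal (norm (g x - f' x))"
      using AE_completion[OF assms(1)] by eventually_elim (use assms(2) in \<open>auto simp: indicator_def\<close>)
  qed
  finally show ?thesis by (simp add: nn_integral_completion)
qed

text \<open>The closed neighbourhood is the sum of \<open>K\<close> and a closed ball, which
  exhibits it as compact.\<close>

lemma compact_neighbourhood:
  fixes K :: "'a::euclidean_space set"
  assumes D: "open D" "compact K" "K \<subseteq> D"
  obtains \<delta> K' where "0 < \<delta>" "compact K'" "K' \<subseteq> D" "K' = (\<Union>x\<in>K. cball x \<delta>)" "K \<subseteq> K'"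
proof -
  obtain \<delta> where \<delta>: "0 < \<delta>" "(\<Union>x\<in>K. cball x \<delta>) \<subseteq> D"
    using compact_subset_open_imp_cball_epsilon_subset[OF D(2,1,3)] by metis
  define K' where "K' = {x + y | x y. x \<in> K \<and> y \<in> cball 0 \<delta>}"
  have K'eq: "K' = (\<Union>x\<in>K. cball x \<delta>)"
  proof (intro set_eqI iffI)
    fix z assume "z \<in> (\<Union>x\<in>K. cball x \<delta>)"
    then obtain x where "x \<in> K" "norm (z - x) \<le> \<delta>" by (auto simp: dist_norm norm_minus_commute)
    then have "z = x + (z - x)" "x \<in> K" "z - x \<in> cball 0 \<delta>" by auto
    then show "z \<in> K'" unfolding K'_def by blast
  next
    fix z assume "z \<in> K'"
    then obtain x y where "x \<in> K" "norm y \<le> \<delta>" "z = x + y" by (auto simp: K'_def)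
    then show "z \<in> (\<Union>x\<in>K. cball x \<delta>)" by (auto intro!: bexI[of _ x] simp: dist_norm)
  qed
  have K'c: "compact K'" unfolding K'_def by (rule compact_sums[OF D(2) compact_cball])
  have K'D: "K' \<subseteq> D" using \<delta> K'eq by simp
  have KK': "K \<subseteq> K'" using \<delta> by (auto simp: K'eq)
  show ?thesis by (rule that[OF \<delta>(1) K'c K'D K'eq KK'])
qed

text \<open>Differentiability is claimed on an open set \<open>U\<close> around \<open>K\<close>
  because later arguments leave \<open>K\<close> along short segments. Half of the margin
  \<open>\<delta>\<close> is spent on \<open>U\<close>, the other half on the mollification
  radius.\<close>

lemma weak_gradient_C1_approx:
  fixes u :: "'a::euclidean_space \<Rightarrow> real"
  assumes wg: "has_weak_gradient_on u G D" and D: "open D" "compact K" "K \<subseteq> D" and e: "0 < (e::real)"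
  obtains v V U where "open U" "K \<subseteq> U" "U \<subseteq> D" "continuous_on UNIV V" "continuous_on UNIV v"
    "\<And>x. x \<in> U \<Longrightarrow> (v has_derivative (\<lambda>h. V x \<bullet> h)) (at x)"
    "(\<integral>\<^sup>+x. ennreal \<bar>v x - u x\<bar> \<partial>lebesgue_on K) \<le> ennreal e"
    "(\<integral>\<^sup>+x. ennreal (norm (V x - G x)) \<partial>lebesgue_on K) \<le> ennreal e"
proof -
  obtain \<delta> K' where \<delta>: "0 < \<delta>" and K'c: "compact K'" and K'D: "K' \<subseteq> D"
    and K'eq: "K' = (\<Union>x\<in>K. cball x \<delta>)" and KK': "K \<subseteq> K'"
    using compact_neighbourhood[OF D] by metis
  have au: "u absolutely_integrable_on K'" and aG: "G absolutely_integrable_on K'"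
    using wg K'c K'D by (auto simp: has_weak_gradient_on_def locally_summable_on_def)
  obtain u' where u': "integrable lborel u'" "AE x in lborel. u' x = indicator K' x *\<^sub>R u x"
    using ex_borel_rep[OF au] by blast
  obtain G' where G': "integrable lborel G'" "AE x in lborel. G' x = indicator K' x *\<^sub>R G x"
    using ex_borel_rep[OF aG] by blast
  obtain d1 where d1: "0 < d1" "\<And>\<epsilon>. 0 < \<epsilon> \<Longrightarrow> \<epsilon> < d1 \<Longrightarrow> (\<integral>\<^sup>+x. norm (mollify \<epsilon> u' x - u' x) \<partial>lborel) \<le> ennreal e"
    using mollify_L1[OF u'(1) e] by blast
  obtain d2 where d2: "0 < d2" "\<And>\<epsilon>. 0 < \<epsilon> \<Longrightarrow> \<epsilon> < d2 \<Longrightarrow> (\<integral>\<^sup>+x. norm (mollify \<epsilon> G' x - G' x) \<partial>lborel) \<le> ennreal e"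
    using mollify_L1[OF G'(1) e] by blast
  define \<epsilon> where "\<epsilon> = min (min d1 d2) \<delta> / 2"
  have \<epsilon>: "0 < \<epsilon>" "\<epsilon> < d1" "\<epsilon> < d2" "\<epsilon> \<le> \<delta> / 2" using d1 d2 \<delta> by (auto simp: \<epsilon>_def)
  define U where "U = (\<Union>x\<in>K. ball x (\<delta> / 2))"
  have sub: "cball x \<epsilon> \<subseteq> K'" if "x \<in> U" for x
  proof
    fix z assume z: "z \<in> cball x \<epsilon>"
    obtain y where y: "y \<in> K" "dist y x < \<delta> / 2" using \<open>x \<in> U\<close> by (auto simp: U_def)
    have "dist y z \<le> dist y x + dist x z" by (rule dist_triangle)
    with y z \<epsilon> have "dist y z \<le> \<delta>" by auto
    then show "z \<in> K'" using y by (auto simp: K'eq)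
  qed
  show ?thesis
  proof (rule that[of U "mollify \<epsilon> G'" "mollify \<epsilon> u'"])
    show "open U" "K \<subseteq> U" using \<delta> by (auto simp: U_def)
    show "U \<subseteq> D" using sub K'D \<epsilon> by fastforce
    show "continuous_on UNIV (mollify \<epsilon> G')"
      unfolding mollify_def
      by (rule continuous_kernel_integral[OF continuous_mollifier compact_cball[of 0 \<epsilon>] mollifier_zero_cball[OF \<epsilon>(1)] G'(1)])
    show "continuous_on UNIV (mollify \<epsilon> u')"
      unfolding mollify_def
      by (rule continuous_kernel_integral[OF continuous_mollifier compact_cball[of 0 \<epsilon>] mollifier_zero_cball[OF \<epsilon>(1)] u'(1)])
    show "(mollify \<epsilon> u' has_derivative (\<lambda>h. mollify \<epsilon> G' x \<bullet> h)) (at x)" if "x \<in> U" for x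
    proof -
      let ?L = "\<lambda>h. - (\<integral>y. frechet_derivative (mollifier \<epsilon>) (at (y - x)) h * u' y \<partial>lborel)"
      have d: "(mollify \<epsilon> u' has_derivative ?L) (at x)"
        by (rule mollify_has_derivative[OF \<epsilon>(1) u'(1)])
      \<comment> \<open>Weak gradients only speak about basis directions; linearity of the
        derivative supplies the others.\<close>
      have "?L = (\<lambda>h. mollify \<epsilon> G' x \<bullet> h)"
      proof (rule linear_eq_stdbasis[OF bounded_linear.linear[OF has_derivative_bounded_linear[OF d]]])
        show "linear (\<lambda>h. mollify \<epsilon> G' x \<bullet> h)"
          by (simp add: bounded_linear.linear bounded_linear_inner_right)
        show "?L b = mollify \<epsilon> G' x \<bullet> b" if "b \<in> Basis" for b
          by (rule mollify_weak_gradient[OF wg D(1) K'D K'c u' G' \<epsilon>(1) sub[OF \<open>x \<in> U\<close>] that])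
      qed
      with d show ?thesis by simp
    qed
    have L: "K \<in> sets lebesgue" using D(2) by (simp add: compact_imp_closed)
    show "(\<integral>\<^sup>+x. ennreal \<bar>mollify \<epsilon> u' x - u x\<bar> \<partial>lebesgue_on K) \<le> ennreal e"
      using nn_integral_lebesgue_on_borel_rep[OF u'(2) KK' L, of "mollify \<epsilon> u'"] d1(2)[OF \<epsilon>(1,2)] by simp
    show "(\<integral>\<^sup>+x. ennreal (norm (mollify \<epsilon> G' x - G x)) \<partial>lebesgue_on K) \<le> ennreal e"
      using nn_integral_lebesgue_on_borel_rep[OF G'(2) KK' L, of "mollify \<epsilon> G'"] d2(2)[OF \<epsilon>(1,3)] by simp
  qed
qed

text \<open>On \<open>K\<close> the mollifications of both gradients coincide, being the derivative
  of the same mollified function. They approximate \<open>G\<close> and \<open>H\<close> in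
  \<open>L\<^sub>1\<close>.\<close>

lemma weak_gradient_AE_unique_compact:
  fixes u :: "'a::euclidean_space \<Rightarrow> real"
  assumes G: "has_weak_gradient_on u G D" and H: "has_weak_gradient_on u H D"
    and D: "open D" "compact K" "K \<subseteq> D"
  shows "AE x in lebesgue. x \<in> K \<longrightarrow> G x = H x"
proof -
  obtain \<delta> K' where \<delta>: "0 < \<delta>" and K'c: "compact K'" and K'D: "K' \<subseteq> D"
    and K'eq: "K' = (\<Union>x\<in>K. cball x \<delta>)" and KK': "K \<subseteq> K'"
    using compact_neighbourhood[OF D] by metis
  obtain u' where u': "integrable lborel u'" "AE x in lborel. u' x = indicator K' x *\<^sub>R u x"
    using ex_borel_rep[where f=u and K=K'] G K'c K'D by (auto simp: has_weak_gradient_on_def locally_summable_on_def)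
  obtain G' where G': "integrable lborel G'" "AE x in lborel. G' x = indicator K' x *\<^sub>R G x"
    using ex_borel_rep[where f=G and K=K'] G K'c K'D by (auto simp: has_weak_gradient_on_def locally_summable_on_def)
  obtain H' where H': "integrable lborel H'" "AE x in lborel. H' x = indicator K' x *\<^sub>R H x"
    using ex_borel_rep[where f=H and K=K'] H K'c K'D by (auto simp: has_weak_gradient_on_def locally_summable_on_def)
  have [measurable]: "G' \<in> borel_measurable borel" "H' \<in> borel_measurable borel" "K \<in> sets borel"
    using G' H' D(2) by (auto simp: compact_imp_closed)
  have small: "(\<integral>\<^sup>+x. ennreal (norm (G' x - H' x)) * indicator K x \<partial>lborel) \<le> 0 + ennreal e" if e: "0 < e" for e :: real
  proof -
    obtain d1 where d1: "0 < d1" "\<And>\<epsilon>. 0 < \<epsilon> \<Longrightarrow> \<epsilon> < d1 \<Longrightarrow> (\<integral>\<^sup>+x. norm (mollify \<epsilon> G' x - G' x) \<partial>lborel) \<le> ennreal (e / 2)"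
      using mollify_L1[OF G'(1), of "e / 2"] e by auto
    obtain d2 where d2: "0 < d2" "\<And>\<epsilon>. 0 < \<epsilon> \<Longrightarrow> \<epsilon> < d2 \<Longrightarrow> (\<integral>\<^sup>+x. norm (mollify \<epsilon> H' x - H' x) \<partial>lborel) \<le> ennreal (e / 2)"
      using mollify_L1[OF H'(1), of "e / 2"] e by auto
    define \<epsilon> where "\<epsilon> = min (min d1 d2) \<delta> / 2"
    have \<epsilon>: "0 < \<epsilon>" "\<epsilon> < d1" "\<epsilon> < d2" "\<epsilon> \<le> \<delta>" using d1 d2 \<delta> by (auto simp: \<epsilon>_def)
    have eq: "mollify \<epsilon> G' x = mollify \<epsilon> H' x" if "x \<in> K" for x
    proof (rule euclidean_eqI)
      fix b :: 'a assume b: "b \<in> Basis"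
      have sub: "cball x \<epsilon> \<subseteq> K'" using that \<epsilon> unfolding K'eq by (auto intro!: bexI[of _ x])
      show "mollify \<epsilon> G' x \<bullet> b = mollify \<epsilon> H' x \<bullet> b"
        using mollify_weak_gradient[OF G D(1) K'D K'c u' G' \<epsilon>(1) sub b]
          mollify_weak_gradient[OF H D(1) K'D K'c u' H' \<epsilon>(1) sub b] by simp
    qed
    have "(\<integral>\<^sup>+x. ennreal (norm (G' x - H' x)) * indicator K x \<partial>lborel) \<le>
      (\<integral>\<^sup>+x. ennreal (norm (mollify \<epsilon> G' x - G' x)) + ennreal (norm (mollify \<epsilon> H' x - H' x)) \<partial>lborel)"
    proof (rule nn_integral_mono)
      fix x
      show "ennreal (norm (G' x - H' x)) * indicator K x \<le> ennreal (norm (mollify \<epsilon> G' x - G' x)) + ennreal (norm (mollify \<epsilon> H' x - H' x))"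
      proof (cases "x \<in> K")
        case True
        have "norm (G' x - H' x) \<le> norm (mollify \<epsilon> G' x - G' x) + norm (mollify \<epsilon> H' x - H' x)"
          using norm_triangle_ineq4[of "mollify \<epsilon> H' x - H' x" "mollify \<epsilon> H' x - G' x"]
          unfolding eq[OF True] by simp
        then show ?thesis using True by (simp flip: ennreal_plus)
      qed simp
    qed
    also have "\<dots> = (\<integral>\<^sup>+x. ennreal (norm (mollify \<epsilon> G' x - G' x)) \<partial>lborel) + (\<integral>\<^sup>+x. ennreal (norm (mollify \<epsilon> H' x - H' x)) \<partial>lborel)"
      using mollify_measurable[OF G'(1)] mollify_measurable[OF H'(1)]
      by (intro nn_integral_add) auto
    also have "\<dots> \<le> ennreal (e / 2) + ennreal (e / 2)"
      by (intro add_mono d1 d2 \<epsilon>)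
    also have "\<dots> = 0 + ennreal e" using e by (simp flip: ennreal_plus)
    finally show ?thesis .
  qed
  have "(\<integral>\<^sup>+x. ennreal (norm (G' x - H' x)) * indicator K x \<partial>lborel) \<le> 0"
    by (rule ennreal_le_epsilon) (rule small)
  then have "(\<integral>\<^sup>+x. ennreal (norm (G' x - H' x)) * indicator K x \<partial>lborel) = 0"
    by (rule antisym) (rule zero_le)
  moreover have "(\<lambda>x. ennreal (norm (G' x - H' x)) * indicator K x) \<in> borel_measurable lborel"
    by measurable
  ultimately have "AE x in lborel. ennreal (norm (G' x - H' x)) * indicator K x = 0"
    by (simp only: nn_integral_0_iff_AE)
  then have "AE x in lborel. x \<in> K \<longrightarrow> G x = H x"
    using G'(2) H'(2)
  proof eventually_elim
    case (elim x)
    then show ?case using KK' by (auto simp: indicator_def)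
  qed
  then show ?thesis by (rule AE_completion)
qed

text \<open>Makes integrals of \<open>weak_gradient\<close> independent of the representative that
  it picks.\<close>

lemma weak_gradient_AE_unique:
  fixes u :: "'a::euclidean_space \<Rightarrow> real"
  assumes "has_weak_gradient_on u G D" "has_weak_gradient_on u H D" "open D"
  shows "AE x in lebesgue_on D. G x = H x"
proof -
  obtain C where C: "\<And>n. compact (C n)" "\<And>n. C n \<subseteq> D" "(\<Union>n::nat. C n) = D"
    using open_Union_compact_subsets[OF assms(3)] by metis
  have "AE x in lebesgue. \<forall>n. x \<in> C n \<longrightarrow> G x = H x"
    unfolding AE_all_countable using weak_gradient_AE_unique_compact[OF assms C(1,2)] by blast
  then have "AE x in lebesgue. x \<in> D \<longrightarrow> G x = H x"
    by eventually_elim (use C(3) in blast)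
  then show ?thesis
    using assms(3) by (simp add: AE_restrict_space_iff)
qed

section \<open>Functionals dominated by an integral\<close>

text \<open>Along a subsequence the consecutive distances are summable. Then the telescoping series
  has an integrable sum of absolute values and converges almost everywhere.\<close>

lemma L1_Cauchy_AE_subseq:
  fixes f :: "nat \<Rightarrow> 'a \<Rightarrow> real"
  assumes [measurable]: "\<And>n. f n \<in> borel_measurable M"
    and cauchy: "\<And>e::real. 0 < e \<Longrightarrow> \<exists>N. \<forall>m\<ge>N. \<forall>n\<ge>N. (\<integral>\<^sup>+x. ennreal \<bar>f m x - f n x\<bar> \<partial>M) \<le> ennreal e"
  obtains \<sigma> g where "strict_mono \<sigma>" "g \<in> borel_measurable M" "AE x in M. (\<lambda>k. f (\<sigma> k) x) \<longlonglongrightarrow> g x"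
proof -
  have "\<forall>k. \<exists>N. \<forall>m\<ge>N. \<forall>n\<ge>N. (\<integral>\<^sup>+x. ennreal \<bar>f m x - f n x\<bar> \<partial>M) \<le> ennreal ((1/2) ^ k)"
    using cauchy by simp
  then obtain N where N: "\<And>k m n. N k \<le> m \<Longrightarrow> N k \<le> n \<Longrightarrow> (\<integral>\<^sup>+x. ennreal \<bar>f m x - f n x\<bar> \<partial>M) \<le> ennreal ((1/2) ^ k)"
    by metis
  \<comment> \<open>The sum is monotone in \<open>k\<close> and at least \<open>N k\<close>; the
    added \<open>k\<close> makes it strictly increasing.\<close>
  define \<sigma> where "\<sigma> k = (\<Sum>i\<le>k. N i) + k" for k
  have mono: "strict_mono \<sigma>" by (auto simp: \<sigma>_def strict_mono_Suc_iff)
  have ge: "N k \<le> \<sigma> k" for k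
    using member_le_sum[of k "{..k}" N] by (simp add: \<sigma>_def)
  have step: "(\<integral>\<^sup>+x. ennreal \<bar>f (\<sigma> (Suc k)) x - f (\<sigma> k) x\<bar> \<partial>M) \<le> ennreal ((1/2) ^ k)" for k
    by (intro N order_trans[OF ge[of k]] ge) (simp add: mono strict_mono_less_eq)
  have "(\<integral>\<^sup>+x. (\<Sum>k. ennreal \<bar>f (\<sigma> (Suc k)) x - f (\<sigma> k) x\<bar>) \<partial>M) =
      (\<Sum>k. \<integral>\<^sup>+x. ennreal \<bar>f (\<sigma> (Suc k)) x - f (\<sigma> k) x\<bar> \<partial>M)"
    by (intro nn_integral_suminf) measurable
  also have "\<dots> \<le> (\<Sum>k. ennreal ((1/2) ^ k))"
    by (intro suminf_le step) auto
  also have "\<dots> = ennreal (\<Sum>k. (1/2) ^ k)"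
    by (intro suminf_ennreal2) auto
  finally have "(\<integral>\<^sup>+x. (\<Sum>k. ennreal \<bar>f (\<sigma> (Suc k)) x - f (\<sigma> k) x\<bar>) \<partial>M) \<noteq> \<infinity>"
    by (auto simp: top_unique)
  then have "AE x in M. (\<Sum>k. ennreal \<bar>f (\<sigma> (Suc k)) x - f (\<sigma> k) x\<bar>) \<noteq> \<infinity>"
    by (intro nn_integral_PInf_AE) measurable
  then have "AE x in M. (\<lambda>k. f (\<sigma> k) x) \<longlonglongrightarrow> lim (\<lambda>k. f (\<sigma> k) x)"
  proof eventually_elim
    case (elim x)
    then have "summable (\<lambda>k. \<bar>f (\<sigma> (Suc k)) x - f (\<sigma> k) x\<bar>)"
      by (intro summable_suminf_not_top) auto
    then have "summable (\<lambda>k. f (\<sigma> (Suc k)) x - f (\<sigma> k) x)"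
      by (rule summable_rabs_cancel)
    then have "convergent (\<lambda>n. \<Sum>k<n. f (\<sigma> (Suc k)) x - f (\<sigma> k) x)"
      by (simp add: summable_iff_convergent)
    then have "convergent (\<lambda>n. f (\<sigma> n) x - f (\<sigma> 0) x)"
      by (simp add: sum_lessThan_telescope[of "\<lambda>k. f (\<sigma> k) x"])
    then have "convergent (\<lambda>n. f (\<sigma> n) x)"
      using convergent_diff_const_right_iff by blast
    then show ?case by (simp add: convergent_LIMSEQ_iff)
  qed
  moreover have "(\<lambda>x. lim (\<lambda>k. f (\<sigma> k) x)) \<in> borel_measurable M"
    by measurable
  ultimately show ?thesis using that[OF mono] by blast
qed

text \<open>A \<open>C\<^sup>1\<close> truncation whose shape outside \<open>[-1,1]\<close> is chosen to satisfy \<open>trunc2_energy\<close>: it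
  never increases the energy minimised below.\<close>

definition trunc2 :: "real \<Rightarrow> real" where
  "trunc2 t = (if \<bar>t\<bar> \<le> 1 then t else sgn t * (2 - 1 / \<bar>t\<bar>))"

lemma trunc2_bound: "\<bar>trunc2 t\<bar> \<le> 2"
  by (auto simp: trunc2_def abs_mult abs_sgn_eq field_simps abs_le_iff)

text \<open>With \<open>p\<close> the truncated value, the right side factors as
  \<open>(t - p) * (t + p) / 2\<close>. For \<open>t > 1\<close> the shape
  \<open>p = 2 - 1 / t\<close> ensures \<open>t + p \<ge> 2\<close>.\<close>

lemma trunc2_energy: "\<bar>t - trunc2 t\<bar> \<le> (t\<^sup>2 - (trunc2 t)\<^sup>2) / 2"
proof -
  have *: "\<bar>t - p\<bar> \<le> (t\<^sup>2 - p\<^sup>2) / 2" if "1 < t" "p = 2 - 1 / t" for t p :: real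
  proof -
    have a: "t - p = (t - 1)\<^sup>2 / t" using that by (simp add: field_simps power2_eq_square)
    then have "0 \<le> t - p" using that by simp
    moreover have "1 / t < 1" using that by simp
    then have "2 \<le> t + p" using that by linarith
    ultimately have "(t - p) * 2 \<le> (t - p) * (t + p)" by (intro mult_left_mono)
    with \<open>0 \<le> t - p\<close> show ?thesis by (simp add: power2_eq_square algebra_simps)
  qed
  consider "\<bar>t\<bar> \<le> 1" | "1 < t" | "1 < - t" by linarith
  then show ?thesis
  proof cases
    case 3
    then have "trunc2 t = - (2 - 1 / (- t))" by (simp add: trunc2_def)
    then have "\<bar>- t - (- trunc2 t)\<bar> \<le> ((- t)\<^sup>2 - (- trunc2 t)\<^sup>2) / 2"
      using 3 by (intro *) auto
    then show ?thesis by (simp add: abs_minus_commute)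
  qed (use * in \<open>auto simp: trunc2_def\<close>)
qed

lemma quadratic_nonneg_linear_zero:
  fixes c d :: real
  assumes "\<And>t. 0 \<le> t * c + t\<^sup>2 * d" "0 \<le> d"
  shows "c = 0"
proof (rule ccontr)
  assume "c \<noteq> 0"
  \<comment> \<open>The minimiser of the parabola with \<open>d + 1\<close> in place of
    \<open>d\<close>, which also covers \<open>d = 0\<close>.\<close>
  define t where "t = - c / (2 * (d + 1))"
  have "t * c + t\<^sup>2 * d \<le> t * c + t\<^sup>2 * (d + 1)" by (simp add: algebra_simps)
  also have "\<dots> = - c\<^sup>2 / (4 * (d + 1))"
  proof -
    have "- c / (2 * D) * c + (- c / (2 * D))\<^sup>2 * D = - c\<^sup>2 / (4 * D)" if "0 < D" for D
      using that by (simp add: field_simps power2_eq_square)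
    from this[of "d + 1"] assms(2) show ?thesis by (simp add: t_def)
  qed
  also have "\<dots> < 0" using \<open>c \<noteq> 0\<close> assms(2) by simp
  finally show False using assms(1)[of t] by simp
qed

text \<open>The representing function is the \<open>L\<^sub>2\<close> limit of a minimising sequence of
  \<open>h \<mapsto> \<integral> h\<^sup>2 / 2 - T h\<close>, truncated to be bounded by 2; the representation is the Euler-Lagrange
  equation. The bound 2 instead of the optimal 1 saves a density argument.\<close>

lemma L1_bounded_functional_representation:
  fixes T :: "('a \<Rightarrow> real) \<Rightarrow> real"
  assumes "finite_measure N"
    and V: "\<And>h. h \<in> V \<Longrightarrow> h \<in> borel_measurable N" "\<And>h. h \<in> V \<Longrightarrow> \<exists>B. \<forall>x. \<bar>h x\<bar> \<le> B" "V \<noteq> {}"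
      "\<And>h k. h \<in> V \<Longrightarrow> k \<in> V \<Longrightarrow> (\<lambda>x. h x + k x) \<in> V"
      "\<And>h c. h \<in> V \<Longrightarrow> (\<lambda>x. c * h x) \<in> V" "\<And>h. h \<in> V \<Longrightarrow> (\<lambda>x. trunc2 (h x)) \<in> V"
    and T: "\<And>h k. h \<in> V \<Longrightarrow> k \<in> V \<Longrightarrow> T (\<lambda>x. h x + k x) = T h + T k"
      "\<And>h c. h \<in> V \<Longrightarrow> T (\<lambda>x. c * h x) = c * T h"
      "\<And>h. h \<in> V \<Longrightarrow> \<bar>T h\<bar> \<le> (\<integral>x. \<bar>h x\<bar> \<partial>N)"
  obtains \<theta> where "\<theta> \<in> borel_measurable N" "\<And>x. \<bar>\<theta> x\<bar> \<le> 2" "\<And>h. h \<in> V \<Longrightarrow> T h = (\<integral>x. \<theta> x * h x \<partial>N)"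
proof -
  interpret finite_measure N by fact
  note V(1)[measurable]
  have ib: "integrable N h" if "h \<in> borel_measurable N" "\<And>x. \<bar>h x\<bar> \<le> B" for h and B :: real
    using that by (intro integrable_const_bound[of _ B]) auto
  have i1: "integrable N h" if "h \<in> V" for h
    using V(1,2)[OF that] ib by metis
  have i2: "integrable N (\<lambda>x. h x * k x)" if h: "h \<in> V" and k: "k \<in> V" for h k
  proof -
    obtain B C where "\<And>x. \<bar>h x\<bar> \<le> B" "\<And>x. \<bar>k x\<bar> \<le> C" using V(2) h k by meson
    then have "\<bar>h x * k x\<bar> \<le> B * C" for x by (metis abs_mult abs_ge_zero mult_mono order_trans)
    then show ?thesis using h k by (intro ib[of _ "B * C"]) auto
  qed
  define J where "J h = (\<integral>x. h x * h x \<partial>N) / 2 - T h" for h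
  let ?m = "measure N (space N)"
  \<comment> \<open>Domination by the \<open>L\<^sub>1\<close> norm and
    \<open>\<bar>h\<bar> \<le> (h\<^sup>2 + 1) / 2\<close> leave only a constant times the total
    mass, which is finite.\<close>
  have J_lower: "- ?m / 2 \<le> J h" if "h \<in> V" for h
  proof -
    have "(\<integral>x. \<bar>h x\<bar> \<partial>N) \<le> (\<integral>x. (h x * h x + 1) / 2 \<partial>N)"
    proof (intro integral_mono)
      show "\<bar>h x\<bar> \<le> (h x * h x + 1) / 2" for x
        using zero_le_square[of "\<bar>h x\<bar> - 1"] by (simp add: algebra_simps)
    qed (use i1 i2 that in auto)
    also have "\<dots> = ((\<integral>x. h x * h x \<partial>N) + ?m) / 2"
      using i2 that by simp
    finally show ?thesis using T(3)[OF that] by (simp add: J_def field_simps)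
  qed
  then have bdd: "bdd_below (J ` V)" by (rule bdd_belowI2)
  define I where "I = (INF h\<in>V. J h)"
  have I_le: "I \<le> J h" if "h \<in> V" for h
    unfolding I_def using bdd that by (rule cINF_lower)
  have minus: "(\<lambda>x. h x - k x) \<in> V" "T (\<lambda>x. h x - k x) = T h - T k" if "h \<in> V" "k \<in> V" for h k
    using V(4)[OF that(1) V(5)[OF that(2), of "-1"]] T(1)[OF that(1) V(5)[OF that(2), of "-1"]] T(2)[OF that(2), of "-1"]
    by simp_all
  \<comment> \<open>The linear term changes by at most the \<open>L\<^sub>1\<close> norm of the
    truncation error, and \<open>trunc2_energy\<close> pays for this with the quadratic
    term.\<close>
  have J_trunc: "J (\<lambda>x. trunc2 (h x)) \<le> J h" if "h \<in> V" for h
  proof -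
    let ?t = "\<lambda>x. trunc2 (h x)"
    have t: "?t \<in> V" by (rule V(6)[OF that])
    have "T h - T ?t \<le> (\<integral>x. \<bar>h x - ?t x\<bar> \<partial>N)"
      using T(3)[OF minus(1)[OF that t]] minus(2)[OF that t] by simp
    also have "\<dots> \<le> (\<integral>x. (h x * h x - ?t x * ?t x) / 2 \<partial>N)"
    proof (intro integral_mono)
      show "\<bar>h x - ?t x\<bar> \<le> (h x * h x - ?t x * ?t x) / 2" for x
        using trunc2_energy[of "h x"] by (simp add: power2_eq_square)
    qed (use i1 i2 that t in auto)
    also have "\<dots> = ((\<integral>x. h x * h x \<partial>N) - (\<integral>x. ?t x * ?t x \<partial>N)) / 2"
      using i2 that t by simp
    finally show ?thesis by (simp add: J_def field_simps)
  qed
  have "\<exists>h\<in>V. (\<forall>x. \<bar>h x\<bar> \<le> 2) \<and> J h < I + 1 / (real n + 1)" for n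
  proof -
    have "I < I + 1 / (real n + 1)" by simp
    then obtain h where h: "h \<in> V" "J h < I + 1 / (real n + 1)"
      unfolding I_def using cINF_less_iff[OF V(3) bdd] by blast
    then show ?thesis
      using J_trunc[OF h(1)] V(6)[OF h(1)] trunc2_bound by (intro bexI[of _ "\<lambda>x. trunc2 (h x)"]) auto
  qed
  then obtain h where h: "\<And>n. h n \<in> V" "\<And>n x. \<bar>h n x\<bar> \<le> 2" "\<And>n. J (h n) < I + 1 / (real n + 1)"
    by metis
  have J_expand: "J (\<lambda>x. a x + t * b x) = J a + t * ((\<integral>x. a x * b x \<partial>N) - T b) + t\<^sup>2 * ((\<integral>x. b x * b x \<partial>N) / 2)"
    if a: "a \<in> V" and b: "b \<in> V" for a b t
  proof -
    have "(\<integral>x. (a x + t * b x) * (a x + t * b x) \<partial>N) = (\<integral>x. a x * a x + (2 * t) * (a x * b x) + t\<^sup>2 * (b x * b x) \<partial>N)"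
      by (intro Bochner_Integration.integral_cong) (auto simp: algebra_simps power2_eq_square)
    also have "\<dots> = (\<integral>x. a x * a x \<partial>N) + (2 * t) * (\<integral>x. a x * b x \<partial>N) + t\<^sup>2 * (\<integral>x. b x * b x \<partial>N)"
      using i2 a b by simp
    finally show ?thesis
      using T(1)[OF a V(5)[OF b, of t]] T(2)[OF b, of t] by (simp add: J_def algebra_simps)
  qed
  \<comment> \<open>The midpoint argument for a strictly convex functional: the value at the
    midpoint is at least \<open>I\<close>, and the exact expansion of \<open>J\<close> turns the
    excess energies into a bound on the distance in \<open>L\<^sub>2\<close>.\<close>
  have dist2: "(\<integral>x. (h m x - h n x) * (h m x - h n x) \<partial>N) \<le> 4 * (1 / (real m + 1) + 1 / (real n + 1))" for m n
  proof -
    let ?d = "\<lambda>x. h m x - h n x"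
    have d: "?d \<in> V" by (rule minus[OF h(1) h(1)])
    have "J (h m) = J (\<lambda>x. h n x + 1 * ?d x)" by simp
    also have "\<dots> = J (h n) + ((\<integral>x. h n x * ?d x \<partial>N) - T ?d) + (\<integral>x. ?d x * ?d x \<partial>N) / 2"
      by (subst J_expand[OF h(1) d]) simp
    finally have 1: "J (h m) = J (h n) + ((\<integral>x. h n x * ?d x \<partial>N) - T ?d) + (\<integral>x. ?d x * ?d x \<partial>N) / 2" .
    have "I \<le> J (\<lambda>x. h n x + (1/2) * ?d x)"
      by (intro I_le V(4) V(5) h d)
    also have "\<dots> = J (h n) + (1/2) * ((\<integral>x. h n x * ?d x \<partial>N) - T ?d) + (1/4) * ((\<integral>x. ?d x * ?d x \<partial>N) / 2)"
      by (subst J_expand[OF h(1) d]) (simp add: power2_eq_square)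
    finally have "(\<integral>x. ?d x * ?d x \<partial>N) \<le> 4 * (J (h m) + J (h n) - 2 * I)"
      using 1 by (simp add: field_simps)
    moreover have "x \<le> 4 * (a + b - 2 * i) \<Longrightarrow> a < i + p \<Longrightarrow> b < i + q \<Longrightarrow> x \<le> 4 * (p + q)" for x a b i p q :: real
      by (simp add: algebra_simps)
    ultimately show ?thesis using h(3)[of m] h(3)[of n] by blast
  qed
  have cauchy: "\<exists>K. \<forall>m\<ge>K. \<forall>n\<ge>K. (\<integral>\<^sup>+x. ennreal \<bar>h m x - h n x\<bar> \<partial>N) \<le> ennreal e" if e: "0 < e" for e :: real
  proof -
    \<comment> \<open>The parameter in
      \<open>\<bar>x\<bar> \<le> x\<^sup>2 / (2 * d) + d / 2\<close>, which passes from
      \<open>L\<^sub>2\<close> to \<open>L\<^sub>1\<close>. It makes the constant part at most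
      \<open>e / 2\<close>; \<open>K\<close> then does the same for the quadratic part.\<close>
    define d where "d = e / (1 + ?m)"
    have mp: "0 < 1 + ?m" by (simp add: add_pos_nonneg)
    have d: "0 < d" "d * ?m \<le> e" using e mp by (auto simp: d_def field_simps)
    obtain K :: nat where K: "8 / (d * e) < real K" using reals_Archimedean2 by blast
    have "(\<integral>\<^sup>+x. ennreal \<bar>h m x - h n x\<bar> \<partial>N) \<le> ennreal e" if mn: "K \<le> m" "K \<le> n" for m n
    proof -
      let ?d = "\<lambda>x. h m x - h n x"
      have dV: "?d \<in> V" by (rule minus[OF h(1) h(1)])
      have "(\<integral>x. \<bar>?d x\<bar> \<partial>N) \<le> (\<integral>x. (?d x * ?d x) / (2 * d) + d / 2 \<partial>N)"
      proof (intro integral_mono)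
        show "\<bar>?d x\<bar> \<le> (?d x * ?d x) / (2 * d) + d / 2" for x
        proof -
          have "0 \<le> (\<bar>?d x\<bar> - d)\<^sup>2" by simp
          then have "2 * d * \<bar>?d x\<bar> \<le> ?d x * ?d x + d * d" by (simp add: power2_eq_square algebra_simps)
          then show ?thesis using d by (simp add: field_simps)
        qed
      qed (use i1 i2 dV in \<open>auto intro: integrable_abs\<close>)
      also have "\<dots> = (\<integral>x. ?d x * ?d x \<partial>N) / (2 * d) + d * ?m / 2"
        using i2[OF dV dV] by simp
      also have "\<dots> \<le> e / 2 + e / 2"
      proof (rule add_mono)
        have "0 < 8 / (d * e)" using d e by simp
        then have k0: "0 < real K" using K by (rule less_trans)
        have "1 / (real m + 1) \<le> 1 / real K" "1 / (real n + 1) \<le> 1 / real K"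
          using mn k0 by (auto intro!: divide_left_mono)
        then have "(\<integral>x. ?d x * ?d x \<partial>N) \<le> 8 / real K"
          using dist2[of m n] by simp
        also have "\<dots> \<le> d * e" using K k0 d e by (simp add: field_simps)
        finally show "(\<integral>x. ?d x * ?d x \<partial>N) / (2 * d) \<le> e / 2" using d by (simp add: field_simps)
      qed (use d in simp)
      finally have "(\<integral>x. \<bar>?d x\<bar> \<partial>N) \<le> e" by simp
      moreover have "(\<integral>\<^sup>+x. ennreal \<bar>?d x\<bar> \<partial>N) = ennreal (\<integral>x. \<bar>?d x\<bar> \<partial>N)"
        using i1[OF dV] by (intro nn_integral_eq_integral integrable_abs) auto
      ultimately show ?thesis by (simp add: ennreal_leI)
    qed
    then show ?thesis by blast
  qed
  obtain \<sigma> g where \<sigma>: "strict_mono \<sigma>" and [measurable]: "g \<in> borel_measurable N" and lim: "AE x in N. (\<lambda>k. h (\<sigma> k) x) \<longlonglongrightarrow> g x"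
    using L1_Cauchy_AE_subseq[OF V(1)[OF h(1)] cauchy] by blast
  \<comment> \<open>The limit inherits the bound 2 only almost everywhere; clamping makes it hold at
    every point.\<close>
  define \<theta> where "\<theta> x = max (- 2) (min 2 (g x))" for x
  have \<theta>_meas [measurable]: "\<theta> \<in> borel_measurable N" unfolding \<theta>_def by measurable
  have \<theta>_bound: "\<bar>\<theta> x\<bar> \<le> 2" for x by (auto simp: \<theta>_def)
  have lim\<theta>: "AE x in N. (\<lambda>k. h (\<sigma> k) x) \<longlonglongrightarrow> \<theta> x"
    using lim
  proof eventually_elim
    case (elim x)
    have "g x \<le> 2" by (rule LIMSEQ_le_const2[OF elim]) (use h(2) in \<open>auto simp: abs_le_iff\<close>)
    moreover have "- 2 \<le> g x" by (rule LIMSEQ_le_const[OF elim]) (use h(2) in \<open>auto simp: abs_le_iff minus_le_iff\<close>)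
    ultimately show ?case using elim by (simp add: \<theta>_def)
  qed
  have "T \<eta> = (\<integral>x. \<theta> x * \<eta> x \<partial>N)" if \<eta>: "\<eta> \<in> V" for \<eta>
  proof -
    have lim_int: "(\<lambda>k. \<integral>x. h (\<sigma> k) x * \<eta> x \<partial>N) \<longlonglongrightarrow> (\<integral>x. \<theta> x * \<eta> x \<partial>N)"
    proof (rule integral_dominated_convergence[where w="\<lambda>x. 2 * \<bar>\<eta> x\<bar>"])
      show "AE x in N. (\<lambda>k. h (\<sigma> k) x * \<eta> x) \<longlonglongrightarrow> \<theta> x * \<eta> x"
        using lim\<theta> by eventually_elim (intro tendsto_intros)
      show "AE x in N. norm (h (\<sigma> k) x * \<eta> x) \<le> 2 * \<bar>\<eta> x\<bar>" for k
        by (auto simp: abs_mult intro!: mult_right_mono h)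
    qed (use i1 h \<eta> V(1) in auto)
    \<comment> \<open>First-order minimality holds for the sequence up to
      \<open>1 / (\<sigma> k + 1)\<close>. Only the mixed integral is passed to the limit, so
      neither \<open>T\<close> nor \<open>J\<close> is evaluated at \<open>\<theta>\<close>, which
      need not belong to \<open>V\<close>.\<close>
    have "0 \<le> t * ((\<integral>x. \<theta> x * \<eta> x \<partial>N) - T \<eta>) + t\<^sup>2 * ((\<integral>x. \<eta> x * \<eta> x \<partial>N) / 2)" for t
    proof (rule LIMSEQ_le_const)
      have "(\<lambda>k. 1 / (real (\<sigma> k) + 1)) \<longlonglongrightarrow> 0"
        using LIMSEQ_subseq_LIMSEQ[OF LIMSEQ_inverse_real_of_nat \<sigma>] by (simp add: comp_def inverse_eq_divide add.commute)
      from tendsto_add[OF this tendsto_add[OF tendsto_mult[OF tendsto_const[of t] tendsto_diff[OF lim_int tendsto_const[of "T \<eta>"]]]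
            tendsto_const[of "t\<^sup>2 * ((\<integral>x. \<eta> x * \<eta> x \<partial>N) / 2)"]]]
      show "(\<lambda>k. 1 / (real (\<sigma> k) + 1) + (t * ((\<integral>x. h (\<sigma> k) x * \<eta> x \<partial>N) - T \<eta>) + t\<^sup>2 * ((\<integral>x. \<eta> x * \<eta> x \<partial>N) / 2)))
         \<longlonglongrightarrow> t * ((\<integral>x. \<theta> x * \<eta> x \<partial>N) - T \<eta>) + t\<^sup>2 * ((\<integral>x. \<eta> x * \<eta> x \<partial>N) / 2)"
        by simp
      have "0 \<le> 1 / (real (\<sigma> k) + 1) + (t * ((\<integral>x. h (\<sigma> k) x * \<eta> x \<partial>N) - T \<eta>) + t\<^sup>2 * ((\<integral>x. \<eta> x * \<eta> x \<partial>N) / 2))" for k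
        using I_le[OF V(4)[OF h(1)[of "\<sigma> k"] V(5)[OF \<eta>, of t]]] J_expand[OF h(1) \<eta>, of "\<sigma> k" t] h(3)[of "\<sigma> k"]
        by simp
      then show "\<exists>K. \<forall>n\<ge>K. 0 \<le> 1 / (real (\<sigma> n) + 1) + (t * ((\<integral>x. h (\<sigma> n) x * \<eta> x \<partial>N) - T \<eta>) + t\<^sup>2 * ((\<integral>x. \<eta> x * \<eta> x \<partial>N) / 2))"
        by blast
    qed
    then have "(\<integral>x. \<theta> x * \<eta> x \<partial>N) - T \<eta> = 0"
      by (rule quadratic_nonneg_linear_zero) simp
    then show ?thesis by simp
  qed
  then show ?thesis using that[OF \<theta>_meas \<theta>_bound] by blast
qed

section \<open>Lipschitz images and quasiisometrical maps\<close>

text \<open>The local condition on a quasiisometrical map only integrates along segments inside the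
  domain, hence the restriction to convex subsets.\<close>

definition lipschitz_on_convex :: "real \<Rightarrow> 'a::euclidean_space set \<Rightarrow> ('a \<Rightarrow> 'b::euclidean_space) \<Rightarrow> bool" where
  "lipschitz_on_convex L D f \<longleftrightarrow>
     0 < L \<and> (\<forall>C\<subseteq>D. convex C \<longrightarrow> (\<forall>x\<in>C. \<forall>y\<in>C. norm (f x - f y) \<le> L * norm (x - y)))"

text \<open>Bisection along the segment from \<open>y\<close> to \<open>x\<close>: the estimate is
  additive over adjacent parameter intervals and holds on short intervals, since there both
  endpoints are compared with one point between them.\<close>

lemma lipschitz_on_convexI:
  fixes f :: "'a::euclidean_space \<Rightarrow> 'b::euclidean_space"
  assumes L: "0 < L"
    and loc: "\<And>x. x \<in> D \<Longrightarrow> \<exists>d>0. \<forall>z\<in>D. norm (z - x) < d \<longrightarrow> norm (f z - f x) \<le> L * norm (z - x)"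
  shows "lipschitz_on_convex L D f"
  unfolding lipschitz_on_convex_def
proof (intro conjI L allI impI ballI)
  fix C x y assume C: "C \<subseteq> D" "convex C" and x: "x \<in> C" and y: "y \<in> C"
  define \<gamma> where "\<gamma> t = y + t *\<^sub>R (x - y)" for t
  \<comment> \<open>The range restriction is part of \<open>P\<close> because the local step of the
    bisection principle quantifies over intervals that may leave \<open>[0,1]\<close>.\<close>
  define P where "P a b \<longleftrightarrow> (0 \<le> a \<and> b \<le> 1 \<longrightarrow> norm (f (\<gamma> b) - f (\<gamma> a)) \<le> L * norm (x - y) * (b - a))" for a b
  have \<gamma>: "\<gamma> t \<in> D" if "0 \<le> t" "t \<le> 1" for t
    using convexD_alt[OF C(2) y x that] C(1) by (auto simp: \<gamma>_def algebra_simps)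
  have \<gamma>d: "norm (\<gamma> s - \<gamma> t) = norm (x - y) * \<bar>s - t\<bar>" for s t
    by (simp add: \<gamma>_def scaleR_left_diff_distrib[symmetric] mult.commute)
  have "(0::real) \<le> 1" by simp
  then have "P 0 1"
  proof (induction rule: Bolzano)
    case (trans a b c)
    show ?case unfolding P_def
    proof (intro impI)
      assume "0 \<le> a \<and> c \<le> 1"
      then have "norm (f (\<gamma> b) - f (\<gamma> a)) \<le> L * norm (x - y) * (b - a)" "norm (f (\<gamma> c) - f (\<gamma> b)) \<le> L * norm (x - y) * (c - b)"
        using trans unfolding P_def by auto
      moreover have "norm (f (\<gamma> c) - f (\<gamma> a)) \<le> norm (f (\<gamma> c) - f (\<gamma> b)) + norm (f (\<gamma> b) - f (\<gamma> a))"
        by (metis dist_norm dist_triangle)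
      ultimately show "norm (f (\<gamma> c) - f (\<gamma> a)) \<le> L * norm (x - y) * (c - a)"
        by (simp add: algebra_simps)
    qed
  next
    case (local t)
    obtain d where d: "d > 0" "\<And>z. z \<in> D \<Longrightarrow> norm (z - \<gamma> t) < d \<Longrightarrow> norm (f z - f (\<gamma> t)) \<le> L * norm (z - \<gamma> t)"
      using loc[OF \<gamma>[OF local]] by auto
    have near: "norm (f (\<gamma> s) - f (\<gamma> t)) \<le> L * norm (x - y) * \<bar>s - t\<bar>"
      if "0 \<le> s" "s \<le> 1" "\<bar>s - t\<bar> < d / (norm (x - y) + 1)" for s
    proof -
      have "norm (x - y) * \<bar>s - t\<bar> \<le> (norm (x - y) + 1) * \<bar>s - t\<bar>" by (simp add: algebra_simps)
      also have "\<dots> < d" using that(3) by (simp add: pos_less_divide_eq add_nonneg_pos mult.commute)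
      finally show ?thesis using d(2)[OF \<gamma>[OF that(1,2)]] by (simp add: \<gamma>d mult.assoc)
    qed
    show ?case
    proof (intro exI[of _ "d / (norm (x - y) + 1)"] conjI allI impI)
      show "0 < d / (norm (x - y) + 1)" using d(1) by (simp add: add_nonneg_pos)
      fix a b assume ab: "a \<le> t \<and> t \<le> b \<and> b - a < d / (norm (x - y) + 1)"
      show "P a b" unfolding P_def
      proof (intro impI)
        assume "0 \<le> a \<and> b \<le> 1"
        then have "norm (f (\<gamma> a) - f (\<gamma> t)) \<le> L * norm (x - y) * (t - a)" "norm (f (\<gamma> b) - f (\<gamma> t)) \<le> L * norm (x - y) * (b - t)"
          using near[of a] near[of b] ab by auto
        moreover have "norm (f (\<gamma> b) - f (\<gamma> a)) \<le> norm (f (\<gamma> b) - f (\<gamma> t)) + norm (f (\<gamma> a) - f (\<gamma> t))"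
          by (metis dist_norm dist_triangle2)
        ultimately show "norm (f (\<gamma> b) - f (\<gamma> a)) \<le> L * norm (x - y) * (b - a)"
          by (simp add: algebra_simps)
      qed
    qed
  qed
  then show "norm (f x - f y) \<le> L * norm (x - y)"
    by (simp add: P_def \<gamma>_def)
qed

text \<open>A bound on a limes superior holds in a neighbourhood only with a larger constant, hence
  \<open>2 * Q\<close>. The lower bound for \<open>\<phi>\<close> becomes an upper bound for
  \<open>\<psi>\<close>, whose continuity transports the neighbourhood.\<close>

lemma quasiisometrical_lipschitz:
  fixes \<phi> :: "'a::euclidean_space \<Rightarrow> 'a"
  assumes q: "quasiisometrical Q D D' \<phi>" and Q: "0 < Q" and hom: "homeomorphism D D' \<phi> \<psi>"
  shows "lipschitz_on_convex (2 * Q) D \<phi>" "lipschitz_on_convex (2 * Q) D' \<psi>"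
proof -
  let ?r = "\<lambda>x z. ereal (norm (\<phi> x - \<phi> z) / norm (x - z))"
  have D: "open D" "open D'" using q by (auto simp: quasiisometrical_def region_def)
  show "lipschitz_on_convex (2 * Q) D \<phi>"
  proof (rule lipschitz_on_convexI)
    fix x assume x: "x \<in> D"
    have "Limsup (at x within D) (?r x) < ereal (2 * Q)"
      using q x Q by (auto simp: quasiisometrical_def intro: le_less_trans)
    then have "\<forall>\<^sub>F z in at x within D. ?r x z < ereal (2 * Q)"
      by (rule Limsup_lessD)
    then obtain d where d: "d > 0" "\<And>z. z \<in> D \<Longrightarrow> z \<noteq> x \<Longrightarrow> dist z x < d \<Longrightarrow> norm (\<phi> x - \<phi> z) / norm (x - z) < 2 * Q"
      by (auto simp: eventually_at)
    show "\<exists>d>0. \<forall>z\<in>D. norm (z - x) < d \<longrightarrow> norm (\<phi> z - \<phi> x) \<le> 2 * Q * norm (z - x)"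
    proof (intro exI[of _ d] conjI d(1) ballI impI)
      fix z assume "z \<in> D" "norm (z - x) < d"
      then show "norm (\<phi> z - \<phi> x) \<le> 2 * Q * norm (z - x)"
        using d(2)[of z] by (cases "z = x") (auto simp: dist_norm norm_minus_commute divide_less_eq)
    qed
  qed (use Q in simp)
  show "lipschitz_on_convex (2 * Q) D' \<psi>"
  proof (rule lipschitz_on_convexI)
    fix y assume y: "y \<in> D'"
    define x where "x = \<psi> y"
    have x: "x \<in> D" "\<phi> x = y" using hom y by (auto simp: x_def homeomorphism_def)
    have "ereal (1 / (2 * Q)) < ereal (1 / Q)" using Q by (simp add: field_simps)
    also have "\<dots> \<le> Liminf (at x within D) (?r x)" using q x by (auto simp: quasiisometrical_def)
    finally have "\<forall>\<^sub>F z in at x within D. ereal (1 / (2 * Q)) < ?r x z"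
      by (rule less_LiminfD)
    then obtain d where d: "d > 0" "\<And>z. z \<in> D \<Longrightarrow> z \<noteq> x \<Longrightarrow> dist z x < d \<Longrightarrow> 1 / (2 * Q) < norm (\<phi> x - \<phi> z) / norm (x - z)"
      by (auto simp: eventually_at)
    have "continuous_on D' \<psi>" using hom by (simp add: homeomorphism_def)
    then obtain d' where d': "d' > 0" "\<And>z. z \<in> D' \<Longrightarrow> dist z y < d' \<Longrightarrow> dist (\<psi> z) x < d"
      unfolding continuous_on_iff x_def using y d(1) by meson
    show "\<exists>d>0. \<forall>z\<in>D'. norm (z - y) < d \<longrightarrow> norm (\<psi> z - \<psi> y) \<le> 2 * Q * norm (z - y)"
    proof (intro exI[of _ d'] conjI d'(1) ballI impI)
      fix z assume z: "z \<in> D'" "norm (z - y) < d'"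
      have pz: "\<psi> z \<in> D" "\<phi> (\<psi> z) = z" using hom z by (auto simp: homeomorphism_def)
      show "norm (\<psi> z - \<psi> y) \<le> 2 * Q * norm (z - y)"
      proof (cases "z = y")
        case False
        then have ne: "\<psi> z \<noteq> x" using pz x by auto
        then have "1 / (2 * Q) < norm (y - z) / norm (x - \<psi> z)"
          using d(2)[OF pz(1)] d'(2) z pz x by (auto simp: dist_norm)
        then show ?thesis using Q ne by (simp add: x_def[symmetric] field_simps norm_minus_commute)
      qed simp
    qed
  qed (use Q in simp)
qed

lemma lipschitz_on_convex_continuous:
  assumes "lipschitz_on_convex L D f" "open D"
  shows "continuous_on D f"
proof -
  have "isCont f x" if x: "x \<in> D" for x
  proof -
    obtain r where r: "r > 0" "ball x r \<subseteq> D" using assms(2) x openE by blast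
    have "L-lipschitz_on (ball x r) f"
      using assms(1) r by (intro lipschitz_onI) (auto simp: lipschitz_on_convex_def dist_norm)
    from lipschitz_on_continuous_on[OF this] show ?thesis
      using r by (simp add: continuous_on_eq_continuous_at)
  qed
  then show ?thesis using continuous_at_imp_continuous_on by blast
qed

lemma lipschitz_on_convex_negligible:
  fixes f :: "'a::euclidean_space \<Rightarrow> 'a"
  assumes "lipschitz_on_convex L D f" "open D" "negligible S" "S \<subseteq> D"
  shows "negligible (f ` S)"
proof (rule negligible_locally_Lipschitz_image)
  fix x assume "x \<in> S"
  then obtain r where r: "r > 0" "ball x r \<subseteq> D" using assms(2,4) openE by blast
  show "\<exists>T B. open T \<and> x \<in> T \<and> (\<forall>y\<in>S \<inter> T. norm (f y - f x) \<le> B * norm (y - x))"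
    using assms(1) r unfolding lipschitz_on_convex_def
    by (intro exI[of _ "ball x r"] exI[of _ L]) auto
qed (use assms in auto)

section \<open>Distortion of measure and of integrals\<close>

lemma emeasure_lipschitz_image:
  fixes f :: "'a::euclidean_space \<Rightarrow> 'a"
  assumes L: "lipschitz_on_convex L D f" and D: "open D" and A: "A \<in> sets lebesgue" "A \<subseteq> D"
  shows "f ` A \<in> sets lebesgue"
    and "emeasure lebesgue (f ` A) \<le> ennreal (L ^ DIM('a)) * emeasure lebesgue A"
proof -
  have L0: "0 < L" using L by (simp add: lipschitz_on_convex_def)
  have sets: "f ` B \<in> sets lebesgue" if "B \<in> sets lebesgue" "B \<subseteq> D" for B
    by (rule sets_lebesgue_continuous_image[OF that(1) lipschitz_on_convex_continuous[OF L D]])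
      (use lipschitz_on_convex_negligible[OF L D] that in auto)
  show fA: "f ` A \<in> sets lebesgue" by (rule sets[OF A])
  let ?c = "ennreal (L ^ DIM('a))"
  have *: "emeasure lebesgue (f ` A) \<le> ?c * (emeasure lebesgue A + ennreal e)" if e: "0 < e" for e :: real
  proof -
    obtain T where T: "open T" "A \<subseteq> T" "(T - A) \<in> lmeasurable" "emeasure lebesgue (T - A) < ennreal e"
      using sets_lebesgue_outer_open[OF A(1) e] .
    define U where "U = T \<inter> D"
    have U: "open U" "A \<subseteq> U" "U \<subseteq> D" using T D A by (auto simp: U_def)
    have [simp]: "U \<in> sets lebesgue" using U by simp
    have mU: "emeasure lebesgue U \<le> emeasure lebesgue A + ennreal e"
    proof -
      have "emeasure lebesgue U \<le> emeasure lebesgue (A \<union> (T - A))"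
        using A(1) T(1,3) by (intro emeasure_mono sets.Un) (auto simp: U_def fmeasurableD)
      also have "\<dots> \<le> emeasure lebesgue A + emeasure lebesgue (T - A)"
        using A(1) T(3) by (intro emeasure_subadditive) (auto simp: fmeasurableD)
      also have "\<dots> \<le> emeasure lebesgue A + ennreal e"
        using T(4) by (intro add_left_mono less_imp_le)
      finally show ?thesis .
    qed
    define K where "K = {i :: 'a \<times> real. 0 < snd i \<and> ball (fst i) (snd i) \<subseteq> U}"
    have "\<exists>i. i \<in> K \<and> x \<in> ball (fst i) (snd i) \<and> snd i < d" if "x \<in> A" "0 < d" for x d
    proof -
      have "x \<in> U" using that(1) U(2) by (rule subsetD[rotated])
      then obtain r where r: "r > 0" "ball x r \<subseteq> U" by (rule openE[OF U(1)])
      have "ball x (min r (d / 2)) \<subseteq> ball x r" by (rule subset_ball) simp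
      then have "(x, min r (d / 2)) \<in> K" using r that(2) by (simp add: K_def)
      then show ?thesis
        by (rule exI[of _ "(x, min r (d / 2))", OF conjI]) (use r that(2) in simp)
    qed
    \<comment> \<open>Balls map into balls of \<open>L\<close> times the radius, and null sets to null sets, so a Vitali cover suffices.\<close>
    then obtain C where C: "countable C" "C \<subseteq> K" "pairwise (\<lambda>i j. disjnt (ball (fst i) (snd i)) (ball (fst j) (snd j))) C"
      "negligible (A - (\<Union>i\<in>C. ball (fst i) (snd i)))"
      by (rule Vitali_covering_theorem_balls)
    define B where "B n = (if n \<in> to_nat_on C ` C then ball (fst (from_nat_into C n)) (snd (from_nat_into C n)) else {})" for n
    have B_to_nat: "B (to_nat_on C i) = ball (fst i) (snd i)" if "i \<in> C" for i
      using that C(1) by (simp add: B_def)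
    have B_C: "\<exists>i\<in>C. B n = ball (fst i) (snd i) \<and> n = to_nat_on C i" if "B n \<noteq> {}" for n
    proof -
      have "n \<in> to_nat_on C ` C" using that by (rule contrapos_np) (simp add: B_def)
      then show ?thesis using B_to_nat by blast
    qed
    have UB: "(\<Union>i\<in>C. ball (fst i) (snd i)) = (\<Union>n. B n)"
    proof (intro equalityI subsetI)
      fix x assume "x \<in> (\<Union>n. B n)"
      then obtain n where "x \<in> B n" by blast
      then show "x \<in> (\<Union>i\<in>C. ball (fst i) (snd i))" using B_C[of n] by blast
    next
      fix x assume "x \<in> (\<Union>i\<in>C. ball (fst i) (snd i))"
      then obtain i where "i \<in> C" "x \<in> B (to_nat_on C i)" using B_to_nat by blast
      then show "x \<in> (\<Union>n. B n)" by blast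
    qed
    have disj: "disjoint_family B"
      unfolding disjoint_family_on_def
    proof (intro ballI impI)
      fix m n :: nat assume "m \<noteq> n"
      show "B m \<inter> B n = {}"
      proof (rule ccontr)
        assume ne: "B m \<inter> B n \<noteq> {}"
        then have "B m \<noteq> {}" "B n \<noteq> {}" by auto
        from B_C[OF this(1)] B_C[OF this(2)] obtain i j where ij: "i \<in> C" "j \<in> C"
          "B m = ball (fst i) (snd i)" "B n = ball (fst j) (snd j)" "m = to_nat_on C i" "n = to_nat_on C j" by metis
        with \<open>m \<noteq> n\<close> have "i \<noteq> j" by auto
        from pairwiseD[OF C(3) ij(1,2) this] ne show False
          unfolding ij(3,4) disjnt_def by contradiction
      qed
    qed
    have BU: "B n \<subseteq> U" for n
      using B_C[of n] C(2) by (cases "B n = {}") (auto simp: K_def)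
    have Bs: "B n \<in> sets lebesgue" for n by (simp add: B_def)
    have img: "emeasure lebesgue (f ` B n) \<le> ?c * emeasure lebesgue (B n)" for n
    proof (cases "B n = {}")
      case False
      then obtain i where i: "i \<in> C" "B n = ball (fst i) (snd i)" using B_C by blast
      then have r: "0 < snd i" "ball (fst i) (snd i) \<subseteq> D" using C(2) U(3) by (auto simp: K_def)
      have "f ` B n \<subseteq> ball (f (fst i)) (L * snd i)"
      proof clarify
        fix x assume "x \<in> B n"
        then have "norm (f (fst i) - f x) \<le> L * norm (fst i - x)" "norm (fst i - x) < snd i"
          using L r i by (auto simp: lipschitz_on_convex_def dist_norm)
        then show "f x \<in> ball (f (fst i)) (L * snd i)"
          using L0 by (auto simp: dist_norm intro: le_less_trans)
      qed
      then have "emeasure lebesgue (f ` B n) \<le> emeasure lebesgue (ball (f (fst i)) (L * snd i))"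
        by (intro emeasure_mono) auto
      also have "\<dots> = ?c * emeasure lebesgue (B n)"
        using L0 r(1) unfolding i(2)
        by (subst (1 2) emeasure_lebesgue_ball_conv_unit_ball) (auto simp: power_mult_distrib ennreal_mult mult.assoc)
      finally show ?thesis .
    qed simp
    have neg: "negligible (f ` (A - (\<Union>n. B n)))"
      using C(4) A(2) by (intro lipschitz_on_convex_negligible[OF L D]) (auto simp: UB)
    have sI: "range (\<lambda>n. f ` B n) \<subseteq> sets lebesgue"
      using sets[OF Bs] BU U(3) by blast
    have "emeasure lebesgue (f ` A) \<le> emeasure lebesgue ((\<Union>n. f ` B n) \<union> f ` (A - (\<Union>n. B n)))"
    proof (rule emeasure_mono)
      show "f ` A \<subseteq> (\<Union>n. f ` B n) \<union> f ` (A - (\<Union>n. B n))" by blast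
    qed (use sI neg in \<open>intro sets.Un sets.countable_UN negligible_imp_sets\<close>)
    also have "\<dots> = emeasure lebesgue (\<Union>n. f ` B n)"
      using sI neg by (intro emeasure_Un_null_set sets.countable_UN) (auto simp: negligible_iff_null_sets)
    also have "\<dots> \<le> (\<Sum>n. emeasure lebesgue (f ` B n))"
      by (rule emeasure_subadditive_countably[OF sI])
    also have "\<dots> \<le> (\<Sum>n. ?c * emeasure lebesgue (B n))"
      by (intro suminf_le img) auto
    also have "\<dots> = ?c * (\<Sum>n. emeasure lebesgue (B n))"
      by (rule ennreal_suminf_cmult)
    also have "\<dots> \<le> ?c * (emeasure lebesgue A + ennreal e)"
    proof (rule mult_left_mono)
      have "(\<Sum>n. emeasure lebesgue (B n)) = emeasure lebesgue (\<Union>n. B n)"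
        using Bs disj by (intro suminf_emeasure) auto
      also have "\<dots> \<le> emeasure lebesgue U"
        using BU by (intro emeasure_mono) auto
      finally show "(\<Sum>n. emeasure lebesgue (B n)) \<le> emeasure lebesgue A + ennreal e"
        using mU by (rule order_trans)
    qed simp
    finally show ?thesis .
  qed
  show "emeasure lebesgue (f ` A) \<le> ?c * emeasure lebesgue A"
  proof (rule ennreal_le_epsilon)
    fix e :: real assume e: "0 < e"
    have c0: "0 < L ^ DIM('a)" using L0 by simp
    have "emeasure lebesgue (f ` A) \<le> ?c * (emeasure lebesgue A + ennreal (e / L ^ DIM('a)))"
      using e c0 by (intro *) simp
    also have "\<dots> = ?c * emeasure lebesgue A + ennreal e"
      using e c0 L0 by (simp add: distrib_left ennreal_mult[symmetric])
    finally show "emeasure lebesgue (f ` A) \<le> ?c * emeasure lebesgue A + ennreal e" .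
  qed
qed

text \<open>A preimage under \<open>\<phi>\<close> is an image under \<open>\<psi>\<close>.
  Continuity of \<open>\<phi>\<close> would only treat Borel sets; Lebesgue sets are reached because
  \<open>\<psi>\<close> maps null sets to null sets.\<close>

lemma measurable_homeomorphism_lipschitz:
  fixes \<phi> :: "'a::euclidean_space \<Rightarrow> 'a"
  assumes hom: "homeomorphism D D' \<phi> \<psi>" and D: "open D" "open D'" and L: "lipschitz_on_convex L D' \<psi>"
  shows "\<phi> \<in> lebesgue_on D \<rightarrow>\<^sub>M lebesgue_on D'"
proof (rule measurableI)
  show "x \<in> space (lebesgue_on D) \<Longrightarrow> \<phi> x \<in> space (lebesgue_on D')" for x
    using hom by (auto simp: homeomorphism_def)
  fix B assume "B \<in> sets (lebesgue_on D')"
  then have B: "B \<in> sets lebesgue" "B \<subseteq> D'" using D by (auto simp: sets_restrict_space_iff)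
  have "\<phi> -` B \<inter> D = \<psi> ` B"
  proof (intro set_eqI iffI)
    fix x assume "x \<in> \<phi> -` B \<inter> D"
    then show "x \<in> \<psi> ` B" using hom by (auto simp: homeomorphism_def intro!: image_eqI[of _ \<psi> "\<phi> x"])
  next
    fix x assume "x \<in> \<psi> ` B"
    then show "x \<in> \<phi> -` B \<inter> D" using hom B(2) by (auto simp: homeomorphism_def subset_iff)
  qed
  then show "\<phi> -` B \<inter> space (lebesgue_on D) \<in> sets (lebesgue_on D)"
    using emeasure_lipschitz_image(1)[OF L D(2) B] D(1) by (auto simp: sets_restrict_space_iff)
qed

text \<open>A one-sided change of variables without a Jacobian: the measure on \<open>D'\<close> is
  dominated by a multiple of the image measure of \<open>\<phi>\<close>, and integrals are monotone
  in the measure.\<close>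

lemma nn_integral_lipschitz_image:
  fixes \<phi> :: "'a::euclidean_space \<Rightarrow> 'a" and F :: "'a \<Rightarrow> ennreal"
  assumes hom: "homeomorphism D D' \<phi> \<psi>" and D: "open D" "open D'"
    and L: "lipschitz_on_convex L D \<phi>" "lipschitz_on_convex L D' \<psi>"
    and F: "F \<in> borel_measurable (lebesgue_on D')"
  shows "(\<integral>\<^sup>+y. F y \<partial>lebesgue_on D') \<le> ennreal (L ^ DIM('a)) * (\<integral>\<^sup>+x. F (\<phi> x) \<partial>lebesgue_on D)"
proof -
  let ?c = "ennreal (L ^ DIM('a))"
  let ?N = "distr (lebesgue_on D) (lebesgue_on D') \<phi>"
  have m: "\<phi> \<in> lebesgue_on D \<rightarrow>\<^sub>M lebesgue_on D'"
    by (rule measurable_homeomorphism_lipschitz[OF hom D L(2)])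
  have "lebesgue_on D' \<le> scale_measure ?c ?N"
  proof (subst le_measure)
    show "\<forall>B\<in>sets (lebesgue_on D'). emeasure (lebesgue_on D') B \<le> emeasure (scale_measure ?c ?N) B"
    proof
      fix B assume B: "B \<in> sets (lebesgue_on D')"
      then have B': "B \<in> sets lebesgue" "B \<subseteq> D'" using D by (auto simp: sets_restrict_space_iff)
      have p: "\<phi> -` B \<inter> D \<in> sets lebesgue" "\<phi> -` B \<inter> D \<subseteq> D"
        using measurable_sets[OF m B] D by (auto simp: sets_restrict_space_iff)
      have "B = \<phi> ` (\<phi> -` B \<inter> D)"
        using hom B'(2) unfolding homeomorphism_def by auto
      then have "emeasure lebesgue B \<le> ?c * emeasure lebesgue (\<phi> -` B \<inter> D)"
        using emeasure_lipschitz_image(2)[OF L(1) D(1) p] by simp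
      then show "emeasure (lebesgue_on D') B \<le> emeasure (scale_measure ?c ?N) B"
        using B B' p D by (simp add: emeasure_distr[OF m B] emeasure_restrict_space)
    qed
  qed simp
  then have "(\<integral>\<^sup>+y. F y \<partial>lebesgue_on D') \<le> (\<integral>\<^sup>+y. F y \<partial>scale_measure ?c ?N)"
    by (intro nn_integral_mono_measure) auto
  also have "\<dots> = ?c * (\<integral>\<^sup>+y. F y \<partial>?N)"
    using F by (intro nn_integral_scale_measure) simp
  also have "(\<integral>\<^sup>+y. F y \<partial>?N) = (\<integral>\<^sup>+x. F (\<phi> x) \<partial>lebesgue_on D)"
    using F m by (intro nn_integral_distr) auto
  finally show ?thesis .
qed

section \<open>Weak gradients of compositions\<close>

lemma borel_measurable_lebesgue_on:
  "f \<in> borel_measurable borel \<Longrightarrow> f \<in> borel_measurable (lebesgue_on S)"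
  by (intro measurable_restrict_space1 measurable_completion) simp

text \<open>The functional representation requires a class closed under \<open>trunc2\<close>, which
  is only once continuously differentiable; infinitely smooth test functions would not do.\<close>

definition C1_compact :: "'a::euclidean_space set \<Rightarrow> ('a \<Rightarrow> real) set" where
  "C1_compact D = {\<eta>. Ck (Suc 0) \<eta> \<and> (\<exists>K. compact K \<and> K \<subseteq> D \<and> (\<forall>x. x \<notin> K \<longrightarrow> \<eta> x = 0))}"

lemma test_function_C1_compact: "test_function_on D \<eta> \<Longrightarrow> \<eta> \<in> C1_compact D"
  unfolding test_function_on_def C1_compact_def mem_Collect_eq
  using closure_subset[of "{x. \<eta> x \<noteq> 0}"] by blast

lemma C1_compactD:
  fixes \<eta> :: "'a::euclidean_space \<Rightarrow> real"
  assumes "\<eta> \<in> C1_compact D"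
  obtains K B where "compact K" "K \<subseteq> D" "\<And>x. x \<notin> K \<Longrightarrow> \<eta> x = 0"
    "\<And>x b. x \<notin> K \<Longrightarrow> frechet_derivative \<eta> (at x) b = 0"
    "0 < B" "\<And>x. \<bar>\<eta> x\<bar> \<le> B" "\<And>x b. b \<in> Basis \<Longrightarrow> \<bar>frechet_derivative \<eta> (at x) b\<bar> \<le> B"
proof -
  obtain K where K: "compact K" "K \<subseteq> D" "\<And>x. x \<notin> K \<Longrightarrow> \<eta> x = 0" and c: "Ck (Suc 0) \<eta>"
    using assms by (auto simp: C1_compact_def)
  have z: "frechet_derivative \<eta> (at x) b = 0" if "x \<notin> K" for x b
  proof -
    have "((\<lambda>x. 0) has_derivative (\<lambda>h. 0)) (at x)" by simp
    then have "(\<eta> has_derivative (\<lambda>h. 0)) (at x)"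
      by (rule has_derivative_transform_within_open[where s="- K"])
        (use K that in \<open>auto simp: compact_imp_closed\<close>)
    from frechet_derivative_at[OF this] show ?thesis by metis
  qed
  obtain B0 where B0: "0 < B0" "\<And>x. \<bar>\<eta> x\<bar> \<le> B0"
    using compact_support_bounded[OF Ck_imp_continuous[OF c] K(1,3)] by metis
  have "\<exists>B>0. \<forall>x. \<bar>frechet_derivative \<eta> (at x) b\<bar> \<le> B" for b
    using compact_support_bounded[OF frechet_derivative_continuous_Ck[OF c] K(1) z] by metis
  then obtain Bb where Bb: "\<And>b. 0 < Bb b" "\<And>b x. \<bar>frechet_derivative \<eta> (at x) b\<bar> \<le> Bb b" by metis
  define B where "B = B0 + (\<Sum>b\<in>Basis. Bb b)"
  have s: "0 \<le> (\<Sum>b\<in>Basis. Bb b)" using Bb(1) by (intro sum_nonneg less_imp_le)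
  have "\<bar>frechet_derivative \<eta> (at x) b\<bar> \<le> B" if "b \<in> Basis" for x b
    using Bb(2)[of x b] member_le_sum[OF that, of Bb] Bb(1) B0(1) by (auto simp: B_def less_imp_le)
  moreover have "0 < B" "\<bar>\<eta> x\<bar> \<le> B" for x using B0(1) B0(2)[of x] s by (auto simp: B_def)
  ultimately show ?thesis using that[OF K z] by blast
qed

lemma C1_compact_add:
  assumes "f \<in> C1_compact D" "g \<in> C1_compact D" shows "(\<lambda>x. f x + g x) \<in> C1_compact D"
proof -
  obtain K L where "compact K" "K \<subseteq> D" "\<And>x. x \<notin> K \<Longrightarrow> f x = 0" "compact L" "L \<subseteq> D" "\<And>x. x \<notin> L \<Longrightarrow> g x = 0"
    "Ck (Suc 0) f" "Ck (Suc 0) g"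
    using assms unfolding C1_compact_def by blast
  then show ?thesis
    unfolding C1_compact_def mem_Collect_eq
    by (intro conjI Ck_add exI[of _ "K \<union> L"] compact_Un) auto
qed

lemma C1_compact_cmult:
  assumes "f \<in> C1_compact D" shows "(\<lambda>x. c * f x) \<in> C1_compact D"
proof -
  obtain K where "compact K" "K \<subseteq> D" "\<And>x. x \<notin> K \<Longrightarrow> f x = 0" "Ck (Suc 0) f"
    using assms unfolding C1_compact_def by blast
  then show ?thesis
    unfolding C1_compact_def mem_Collect_eq
    by (intro conjI Ck_mult Ck_const exI[of _ K]) auto
qed

definition trunc2' :: "real \<Rightarrow> real" where
  "trunc2' t = (if \<bar>t\<bar> \<le> 1 then 1 else 1 / t\<^sup>2)"

lemma continuous_trunc2': "continuous_on UNIV trunc2'"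
proof -
  have "trunc2' t = 1 / (max 1 \<bar>t\<bar>)\<^sup>2" for t by (auto simp: trunc2'_def max_def)
  moreover have "continuous_on UNIV (\<lambda>t::real. 1 / (max 1 \<bar>t\<bar>)\<^sup>2)"
    by (intro continuous_intros) (auto simp: max_def)
  ultimately show ?thesis by presburger
qed

text \<open>The two branches meet at 1 with a quadratic deviation from the identity, so the
  derivative there is 1.\<close>

lemma trunc2_near_one: "1/2 < t \<Longrightarrow> \<bar>trunc2 t - t\<bar> \<le> (t - 1)\<^sup>2"
proof (cases "1 < t")
  case True
  then have "t - trunc2 t = (t - 1)\<^sup>2 / t" by (simp add: trunc2_def field_simps power2_eq_square)
  moreover have "(t - 1)\<^sup>2 / t \<le> (t - 1)\<^sup>2" "0 \<le> (t - 1)\<^sup>2 / t"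
    using True by (auto simp: divide_le_eq mult_le_cancel_left1)
  ultimately show ?thesis by linarith
qed (simp add: trunc2_def)

lemma trunc2_odd: "trunc2 (- t) = - trunc2 t"
  by (simp add: trunc2_def sgn_minus)

lemma has_derivative_trunc2_one: "(trunc2 has_real_derivative 1) (at 1)"
proof -
  have "((\<lambda>h. (trunc2 (1 + h) - trunc2 1) / h - 1) \<longlongrightarrow> 0) (at 0)"
  proof (rule Lim_null_comparison)
    show "((\<lambda>h::real. \<bar>h\<bar>) \<longlongrightarrow> 0) (at 0)" by (auto intro!: tendsto_eq_intros)
    have "\<bar>(trunc2 (1 + h) - trunc2 1) / h - 1\<bar> \<le> \<bar>h\<bar>" if "h \<noteq> 0" "\<bar>h\<bar> < 1/2" for h
    proof -
      have "\<bar>trunc2 (1 + h) - (1 + h)\<bar> \<le> h\<^sup>2" using trunc2_near_one[of "1 + h"] that by simp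
      moreover have "(trunc2 (1 + h) - trunc2 1) / h - 1 = (trunc2 (1 + h) - (1 + h)) / h"
        using that by (simp add: trunc2_def diff_divide_distrib add_divide_distrib)
      ultimately show ?thesis
        using that by (simp add: divide_le_eq power2_eq_square abs_mult_self_eq)
    qed
    then show "\<forall>\<^sub>F h in at 0. norm ((trunc2 (1 + h) - trunc2 1) / h - 1) \<le> \<bar>h\<bar>"
      unfolding eventually_at by (intro exI[of _ "1/2"]) (auto simp: dist_real_def)
  qed
  then show ?thesis
    unfolding DERIV_def using Lim_null by fastforce
qed

lemma has_derivative_trunc2: "(trunc2 has_real_derivative trunc2' t) (at t)"
proof -
  have pos: "(trunc2 has_real_derivative trunc2' t) (at t)" if "-1 < t" for t
  proof -
    consider "t < 1" | "t = 1" | "1 < t" by linarith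
    then show ?thesis
    proof cases
      case 1
      have "((\<lambda>t. t) has_real_derivative trunc2' t) (at t)" using 1 that by (simp add: trunc2'_def abs_le_iff)
      then show ?thesis
        by (rule has_field_derivative_transform_within_open[where S="{-1<..<1}"])
          (use 1 that in \<open>auto simp: trunc2_def\<close>)
    next
      case 2
      then show ?thesis using has_derivative_trunc2_one by (simp add: trunc2'_def)
    next
      case 3
      have "((\<lambda>t. 2 - 1 / t) has_real_derivative trunc2' t) (at t)"
        using 3 by (auto intro!: derivative_eq_intros simp: trunc2'_def power2_eq_square)
      then show ?thesis
        by (rule has_field_derivative_transform_within_open[where S="{1<..}"])
          (use 3 in \<open>auto simp: trunc2_def\<close>)
    qed
  qed
  show ?thesis
  proof (cases "-1 < t")
    case False
    then have "-1 < - t" by simp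
    from DERIV_minus[OF DERIV_chain2[OF pos[OF this] DERIV_minus[OF DERIV_ident]]]
    have "((\<lambda>x. - trunc2 (- x)) has_real_derivative trunc2' (- t)) (at t)" by simp
    moreover have "trunc2' (- t) = trunc2' t" by (simp add: trunc2'_def)
    ultimately show ?thesis by (simp add: trunc2_odd)
  qed (rule pos)
qed

lemma C1_compact_trunc2:
  fixes \<eta> :: "'a::euclidean_space \<Rightarrow> real"
  assumes "\<eta> \<in> C1_compact D" shows "(\<lambda>x. trunc2 (\<eta> x)) \<in> C1_compact D"
proof -
  obtain K where K: "compact K" "K \<subseteq> D" "\<And>x. x \<notin> K \<Longrightarrow> \<eta> x = 0" "Ck (Suc 0) \<eta>"
    using assms unfolding C1_compact_def by blast
  have "Ck (Suc 0) (\<lambda>x. trunc2 (\<eta> x))"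
  proof (rule Ck_SucI)
    show "((\<lambda>x. trunc2 (\<eta> x)) has_derivative (\<lambda>h. frechet_derivative \<eta> (at x) h * trunc2' (\<eta> x))) (at x)" for x
      by (rule DERIV_compose_FDERIV[OF has_derivative_trunc2 Ck_SucD(1)[OF K(4)]])
    have "continuous_on UNIV (\<lambda>x. trunc2' (\<eta> x))"
      by (rule continuous_on_compose2[OF continuous_trunc2' Ck_imp_continuous[OF K(4)]]) simp
    then show "Ck 0 (\<lambda>x. frechet_derivative \<eta> (at x) v * trunc2' (\<eta> x))" for v
      using frechet_derivative_continuous_Ck[OF K(4)] by (auto intro!: continuous_intros)
  qed
  with K show ?thesis unfolding C1_compact_def by (auto simp: trunc2_def intro!: exI[of _ K])
qed

lemma integrable_locally_summable_mult:
  fixes f :: "'a::euclidean_space \<Rightarrow> 'b::euclidean_space" and g :: "'a \<Rightarrow> real"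
  assumes f: "locally_summable_on f D" and D: "open D" "compact K" "K \<subseteq> D"
    and g: "g \<in> borel_measurable borel" "\<And>x. x \<notin> K \<Longrightarrow> g x = 0" "\<And>x. \<bar>g x\<bar> \<le> B"
  shows "integrable (lebesgue_on D) (\<lambda>x. g x *\<^sub>R f x)"
proof -
  have i: "integrable lebesgue (\<lambda>x. indicator K x *\<^sub>R f x)"
    using f D by (simp add: locally_summable_on_def set_integrable_def)
  have gl: "g \<in> borel_measurable lebesgue" by (intro measurable_completion) (simp add: g)
  have "integrable lebesgue (\<lambda>x. g x *\<^sub>R (indicator K x *\<^sub>R f x))"
  proof (rule Bochner_Integration.integrable_bound)
    show "integrable lebesgue (\<lambda>x. B * norm (indicator K x *\<^sub>R f x))"
      by (rule integrable_mult_right[OF integrable_norm[OF i]])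
    show "(\<lambda>x. g x *\<^sub>R (indicator K x *\<^sub>R f x)) \<in> borel_measurable lebesgue"
      by (rule borel_measurable_scaleR[OF gl borel_measurable_integrable[OF i]])
    have B0: "0 \<le> B" using g(3)[of undefined] by linarith
    show "AE x in lebesgue. norm (g x *\<^sub>R (indicator K x *\<^sub>R f x)) \<le> norm (B * norm (indicator K x *\<^sub>R f x))"
      using g(3) B0 by (intro AE_I2) (simp add: abs_mult mult.assoc mult_right_mono)
  qed
  also have "(\<lambda>x. g x *\<^sub>R (indicator K x *\<^sub>R f x)) = (\<lambda>x. indicator D x *\<^sub>R (g x *\<^sub>R f x))"
    using g(2) D(3) by (auto simp: fun_eq_iff indicator_def)
  finally show ?thesis using D(1) by (subst integrable_restrict_space) auto
qed

lemma Ck_measurable: "Ck k \<eta> \<Longrightarrow> \<eta> \<in> borel_measurable borel"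
  by (intro borel_measurable_continuous_onI Ck_imp_continuous)

lemma frechet_derivative_measurable:
  "Ck (Suc 0) \<eta> \<Longrightarrow> (\<lambda>x. frechet_derivative \<eta> (at x) b) \<in> borel_measurable borel"
  by (intro borel_measurable_continuous_onI frechet_derivative_continuous_Ck)

lemma integrable_C1_compact_derivative:
  assumes "locally_summable_on f D" "open D" "\<eta> \<in> C1_compact D" "b \<in> Basis"
  shows "integrable (lebesgue_on D) (\<lambda>x. frechet_derivative \<eta> (at x) b *\<^sub>R f x)"
    and "integrable (lebesgue_on D) (\<lambda>x. \<eta> x *\<^sub>R f x)"
proof -
  obtain K B where K: "compact K" "K \<subseteq> D" "\<And>x. x \<notin> K \<Longrightarrow> \<eta> x = 0"
    "\<And>x b. x \<notin> K \<Longrightarrow> frechet_derivative \<eta> (at x) b = 0"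
    "0 < B" "\<And>x. \<bar>\<eta> x\<bar> \<le> B" "\<And>x b. b \<in> Basis \<Longrightarrow> \<bar>frechet_derivative \<eta> (at x) b\<bar> \<le> B"
    using C1_compactD[OF assms(3)] by blast
  have c: "Ck (Suc 0) \<eta>" using assms(3) by (simp add: C1_compact_def)
  show "integrable (lebesgue_on D) (\<lambda>x. frechet_derivative \<eta> (at x) b *\<^sub>R f x)"
    by (rule integrable_locally_summable_mult[OF assms(1,2) K(1,2) frechet_derivative_measurable[OF c] K(4) K(7)[OF assms(4)]])
  show "integrable (lebesgue_on D) (\<lambda>x. \<eta> x *\<^sub>R f x)"
    by (rule integrable_locally_summable_mult[OF assms(1,2) K(1,2) Ck_measurable[OF c] K(3) K(6)])
qed

lemma integrable_imp_locally_summable: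
  fixes g :: "'a::euclidean_space \<Rightarrow> 'b::euclidean_space"
  assumes "integrable (lebesgue_on D) g" "open D"
  shows "locally_summable_on g D"
proof -
  have "set_integrable lebesgue D g"
    using assms by (subst (asm) integrable_restrict_space) (auto simp: set_integrable_def)
  then show ?thesis
    unfolding locally_summable_on_def
    by (auto intro!: set_integrable_subset[of lebesgue D] simp: compact_imp_closed)
qed

text \<open>The bound says that the functional is dominated by the \<open>L\<^sub>1\<close> norm of
  the finite measure with density \<open>m\<close>. Each coordinate is then represented by a density
  \<open>\<theta>\<close> bounded by 2 relative to that measure, and \<open>- \<theta> * m\<close>
  is the partial derivative. Summing over the basis gives the factor
  \<open>2 * DIM('a)\<close>.\<close>

lemma weak_gradient_from_bound:
  fixes f m :: "'a::euclidean_space \<Rightarrow> real"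
  assumes D: "open D" and f: "locally_summable_on f D"
    and m: "integrable (lebesgue_on D) m" "\<And>x. 0 \<le> m x"
    and bound: "\<And>\<eta> b. \<eta> \<in> C1_compact D \<Longrightarrow> b \<in> Basis \<Longrightarrow>
      \<bar>LINT x|lebesgue_on D. f x * frechet_derivative \<eta> (at x) b\<bar> \<le> (LINT x|lebesgue_on D. m x * \<bar>\<eta> x\<bar>)"
  obtains g where "has_weak_gradient_on f g D" "\<And>x. norm (g x) \<le> 2 * DIM('a) * m x"
proof -
  let ?M = "lebesgue_on D"
  define N where "N = density ?M (\<lambda>x. ennreal (m x))"
  have mm [measurable]: "m \<in> borel_measurable ?M" using m by simp
  have fin: "finite_measure N"
  proof
    have "emeasure N (space N) = (\<integral>\<^sup>+x. ennreal (m x) \<partial>?M)"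
      unfolding N_def by (subst emeasure_density) (auto intro!: nn_integral_cong)
    also have "\<dots> = ennreal (integral\<^sup>L ?M m)" using m by (intro nn_integral_eq_integral) auto
    finally show "emeasure N (space N) \<noteq> \<infinity>" by simp
  qed
  have intN: "(\<integral>x. h x \<partial>N) = (LINT x|?M. m x * h x)" if "h \<in> borel_measurable ?M" for h :: "'a \<Rightarrow> real"
    unfolding N_def using that m(2) by (subst integral_density) auto
  have sN: "sets N = sets ?M" by (simp add: N_def)
  have meas: "\<eta> \<in> borel_measurable ?M" if "\<eta> \<in> C1_compact D" for \<eta>
    using that by (intro borel_measurable_lebesgue_on Ck_measurable[of "Suc 0"]) (simp add: C1_compact_def)
  have "\<exists>\<theta>. \<theta> \<in> borel_measurable ?M \<and> (\<forall>x. \<bar>\<theta> x\<bar> \<le> 2) \<and>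
      (\<forall>\<eta>\<in>C1_compact D. (LINT x|?M. f x * frechet_derivative \<eta> (at x) b) = (LINT x|?M. m x * (\<theta> x * \<eta> x)))"
    if b: "b \<in> Basis" for b
  proof -
    let ?T = "\<lambda>\<eta>. LINT x|?M. f x * frechet_derivative \<eta> (at x) b"
    note int = integrable_C1_compact_derivative(1)[OF f D _ b, simplified]
    have d: "(\<eta> has_derivative frechet_derivative \<eta> (at x)) (at x)" if "\<eta> \<in> C1_compact D" for \<eta> x
      using that by (intro Ck_SucD(1)[of 0]) (simp add: C1_compact_def)
    have "(\<lambda>x. 0) \<in> C1_compact D" unfolding C1_compact_def using Ck_const[of "Suc 0" 0] by blast
    then have ne: "C1_compact D \<noteq> {}" by blast
    have add: "?T (\<lambda>x. h x + k x) = ?T h + ?T k" if "h \<in> C1_compact D" "k \<in> C1_compact D" for h k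
    proof -
      have "frechet_derivative (\<lambda>x. h x + k x) (at x) b = frechet_derivative h (at x) b + frechet_derivative k (at x) b" for x
        using frechet_derivative_at[OF has_derivative_add[OF d[OF that(1)] d[OF that(2)]]] by metis
      then show ?thesis using int[OF that(1)] int[OF that(2)] by (simp add: distrib_left mult.commute)
    qed
    have cm: "?T (\<lambda>x. c * h x) = c * ?T h" if "h \<in> C1_compact D" for h c
    proof -
      have "frechet_derivative (\<lambda>x. c * h x) (at x) b = c * frechet_derivative h (at x) b" for x
        using frechet_derivative_at[OF has_derivative_mult_right[OF d[OF that]]] by metis
      then show ?thesis by (simp add: mult.left_commute)
    qed
    have bd: "\<bar>?T h\<bar> \<le> (\<integral>x. \<bar>h x\<bar> \<partial>N)" if "h \<in> C1_compact D" for h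
      using bound[OF that b] meas[OF that] by (subst intN) auto
    have bdd: "\<exists>B. \<forall>x. \<bar>h x\<bar> \<le> B" if "h \<in> C1_compact D" for h
      using C1_compactD[OF that] by metis
    obtain \<theta> where \<theta>: "\<theta> \<in> borel_measurable N" "\<And>x. \<bar>\<theta> x\<bar> \<le> 2" "\<And>h. h \<in> C1_compact D \<Longrightarrow> ?T h = (\<integral>x. \<theta> x * h x \<partial>N)"
      by (rule L1_bounded_functional_representation[OF fin _ bdd ne C1_compact_add C1_compact_cmult C1_compact_trunc2 add cm bd])
        (auto simp: meas measurable_cong_sets[OF sN refl])
    then have [measurable]: "\<theta> \<in> borel_measurable ?M" by (simp add: measurable_cong_sets[OF sN refl])
    have "?T h = (LINT x|?M. m x * (\<theta> x * h x))" if h: "h \<in> C1_compact D" for h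
    proof -
      have [measurable]: "h \<in> borel_measurable ?M" by (rule meas[OF h])
      have "(\<integral>x. \<theta> x * h x \<partial>N) = (LINT x|?M. m x * (\<theta> x * h x))" by (rule intN) measurable
      then show ?thesis using \<theta>(3)[OF h] by simp
    qed
    with \<theta>(2) \<open>\<theta> \<in> borel_measurable ?M\<close> show ?thesis by (intro exI[of _ \<theta>]) blast
  qed
  then have "\<forall>b\<in>Basis. \<exists>\<theta>. \<theta> \<in> borel_measurable ?M \<and> (\<forall>x. \<bar>\<theta> x\<bar> \<le> 2) \<and>
      (\<forall>\<eta>\<in>C1_compact D. (LINT x|?M. f x * frechet_derivative \<eta> (at x) b) = (LINT x|?M. m x * (\<theta> x * \<eta> x)))"
    by blast
  from bchoice[OF this] obtain \<theta> where *: "\<forall>b\<in>Basis. \<theta> b \<in> borel_measurable ?M \<and> (\<forall>x. \<bar>\<theta> b x\<bar> \<le> 2) \<and>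
      (\<forall>\<eta>\<in>C1_compact D. (LINT x|?M. f x * frechet_derivative \<eta> (at x) b) = (LINT x|?M. m x * (\<theta> b x * \<eta> x)))"
    by blast
  have \<theta> [measurable]: "\<theta> b \<in> borel_measurable ?M"
    and \<theta>b: "\<And>x. \<bar>\<theta> b x\<bar> \<le> 2"
    and \<theta>T: "\<And>\<eta>. \<eta> \<in> C1_compact D \<Longrightarrow>
      (LINT x|?M. f x * frechet_derivative \<eta> (at x) b) = (LINT x|?M. m x * (\<theta> b x * \<eta> x))"
    if "b \<in> Basis" for b
    using * that by blast+
  define g where "g x = - (\<Sum>b\<in>Basis. (\<theta> b x * m x) *\<^sub>R b)" for x
  have gb: "g x \<bullet> b = - (\<theta> b x * m x)" if "b \<in> Basis" for x b
    using that by (simp add: g_def inner_sum_left_Basis)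
  have gm: "g \<in> borel_measurable ?M" unfolding g_def by measurable
  have gn: "norm (g x) \<le> 2 * DIM('a) * m x" for x
  proof -
    have "norm (g x) \<le> (\<Sum>b\<in>Basis. \<bar>g x \<bullet> b\<bar>)" by (rule norm_le_l1)
    also have "\<dots> \<le> (\<Sum>b\<in>(Basis::'a set). 2 * m x)"
      using \<theta>b m(2) by (intro sum_mono) (simp add: gb abs_mult mult_right_mono)
    finally show ?thesis by simp
  qed
  have "integrable ?M g"
  proof (rule Bochner_Integration.integrable_bound[OF _ gm])
    show "integrable ?M (\<lambda>x. 2 * DIM('a) * m x)" using m by simp
  qed (use gn m in \<open>auto intro: order_trans[OF _ abs_ge_self]\<close>)
  then have gl: "locally_summable_on g D" by (rule integrable_imp_locally_summable[OF _ D])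
  have "has_weak_gradient_on f g D"
    unfolding has_weak_gradient_on_def
  proof (intro conjI f gl allI impI ballI)
    fix \<eta> b assume t: "test_function_on D \<eta>" and b: "b \<in> (Basis :: 'a set)"
    have "- (LINT x|?M. (g x \<bullet> b) * \<eta> x) = (LINT x|?M. - ((g x \<bullet> b) * \<eta> x))" by simp
    also have "\<dots> = (LINT x|?M. m x * (\<theta> b x * \<eta> x))"
      by (intro Bochner_Integration.integral_cong) (auto simp: gb[OF b])
    finally show "(LINT x|?M. f x * frechet_derivative \<eta> (at x) b) = - (LINT x|?M. (g x \<bullet> b) * \<eta> x)"
      using \<theta>T[OF b test_function_C1_compact[OF t]] by simp
  qed
  then show ?thesis using gn by (rule that)
qed

section \<open>The chain rule through difference quotients\<close>

text \<open>Discrete integration by parts: translation invariance moves the difference quotient from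
  \<open>\<eta>\<close> to \<open>F\<close>, with the shift reversed.\<close>

lemma difference_quotient_shift:
  fixes \<eta> F :: "'a::euclidean_space \<Rightarrow> real"
  assumes F: "F \<in> borel_measurable borel" "integrable lborel (\<lambda>x. F x * \<eta> x)" "integrable lborel (\<lambda>x. F x * \<eta> (x + v))"
    and [measurable]: "\<eta> \<in> borel_measurable borel"
  shows "(\<integral>x. F x * ((\<eta> (x + v) - \<eta> x) / t) \<partial>lborel) = (\<integral>x. \<eta> x * ((F (x - v) - F x) / t) \<partial>lborel)"
proof -
  note F(1)[measurable]
  have m: "(\<lambda>x. F (x - v) * \<eta> x) \<in> borel_measurable lborel" by measurable
  have e: "(\<integral>x. F x * \<eta> (x + v) \<partial>lborel) = (\<integral>x. F (x - v) * \<eta> x \<partial>lborel)"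
    and i: "integrable lborel (\<lambda>x. F (x - v) * \<eta> x)"
    using lborel_integral_translate(1,2)[OF m, of v] F(3) by simp_all
  have "(\<integral>x. F x * ((\<eta> (x + v) - \<eta> x) / t) \<partial>lborel) = (\<integral>x. (F x * \<eta> (x + v) - F x * \<eta> x) / t \<partial>lborel)"
    by (intro Bochner_Integration.integral_cong) (auto simp: algebra_simps diff_divide_distrib)
  also have "\<dots> = ((\<integral>x. F x * \<eta> (x + v) \<partial>lborel) - (\<integral>x. F x * \<eta> x \<partial>lborel)) / t"
    using F by simp
  also have "\<dots> = (\<integral>x. (F (x - v) * \<eta> x - F x * \<eta> x) / t \<partial>lborel)"
    using F i e by simp
  also have "\<dots> = (\<integral>x. \<eta> x * ((F (x - v) - F x) / t) \<partial>lborel)"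
    by (intro Bochner_Integration.integral_cong) (auto simp: algebra_simps diff_divide_distrib)
  finally show ?thesis .
qed

lemma C1_compact_difference_quotient:
  fixes \<eta> :: "'a::euclidean_space \<Rightarrow> real"
  assumes \<eta>: "\<eta> \<in> C1_compact D" and b: "b \<in> Basis" and F: "integrable lborel F"
    and h: "h \<longlonglongrightarrow> 0" "\<And>n. h n \<noteq> (0::real)"
  shows "(\<lambda>n. \<integral>x. F x * ((\<eta> (x + h n *\<^sub>R b) - \<eta> x) / h n) \<partial>lborel) \<longlonglongrightarrow> (\<integral>x. F x * frechet_derivative \<eta> (at x) b \<partial>lborel)"
proof -
  obtain K B where B: "0 < B" "\<And>x b. b \<in> Basis \<Longrightarrow> \<bar>frechet_derivative \<eta> (at x) b\<bar> \<le> B"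
    using C1_compactD[OF \<eta>] by metis
  have c: "Ck (Suc 0) \<eta>" using \<eta> by (simp add: C1_compact_def)
  have lin: "linear (frechet_derivative \<eta> (at x))" for x
    using has_derivative_bounded_linear[OF Ck_SucD(1)[OF c]] by (rule bounded_linear.linear)
  have d: "((\<lambda>t. \<eta> (x + t *\<^sub>R b)) has_real_derivative frechet_derivative \<eta> (at (x + t *\<^sub>R b)) b) (at t)" for x t
  proof -
    have "((\<lambda>t. x + t *\<^sub>R b) has_derivative (\<lambda>s. s *\<^sub>R b)) (at t)"
      by (auto intro!: derivative_eq_intros)
    from has_derivative_compose[OF this Ck_SucD(1)[OF c]]
    have "((\<lambda>t. \<eta> (x + t *\<^sub>R b)) has_derivative (\<lambda>s. frechet_derivative \<eta> (at (x + t *\<^sub>R b)) (s *\<^sub>R b))) (at t)" .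
    moreover have "(\<lambda>s. frechet_derivative \<eta> (at (x + t *\<^sub>R b)) (s *\<^sub>R b)) = (*) (frechet_derivative \<eta> (at (x + t *\<^sub>R b)) b)"
      by (simp add: fun_eq_iff linear_cmul[OF lin] mult.commute)
    ultimately show ?thesis by (simp add: has_field_derivative_def)
  qed
  have lip: "\<bar>\<eta> (x + t *\<^sub>R b) - \<eta> x\<bar> \<le> B * \<bar>t\<bar>" for x t
  proof -
    have "norm (\<eta> (x + t *\<^sub>R b) - \<eta> (x + 0 *\<^sub>R b)) \<le> B * norm (t - 0)"
      by (rule field_differentiable_bound[of UNIV _ _ B]) (use d B b in auto)
    then show ?thesis by simp
  qed
  have [measurable]: "\<eta> \<in> borel_measurable borel" "F \<in> borel_measurable borel"
    "(\<lambda>x. frechet_derivative \<eta> (at x) b) \<in> borel_measurable borel"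
    using Ck_measurable[OF c] F frechet_derivative_measurable[OF c] by auto
  show ?thesis
  proof (rule integral_dominated_convergence[where w="\<lambda>x. B * \<bar>F x\<bar>"])
    show "AE x in lborel. (\<lambda>n. F x * ((\<eta> (x + h n *\<^sub>R b) - \<eta> x) / h n)) \<longlonglongrightarrow> F x * frechet_derivative \<eta> (at x) b"
    proof (rule AE_I2)
      fix x
      have "((\<lambda>t. (\<eta> (x + t *\<^sub>R b) - \<eta> x) / t) \<longlongrightarrow> frechet_derivative \<eta> (at x) b) (at 0)"
        using d[of x 0] by (simp add: DERIV_def)
      then have "(\<lambda>n. (\<eta> (x + h n *\<^sub>R b) - \<eta> x) / h n) \<longlonglongrightarrow> frechet_derivative \<eta> (at x) b"
        using h unfolding tendsto_at_iff_sequentially comp_def by (elim allE[where x=h]) simp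
      then show "(\<lambda>n. F x * ((\<eta> (x + h n *\<^sub>R b) - \<eta> x) / h n)) \<longlonglongrightarrow> F x * frechet_derivative \<eta> (at x) b"
        by (rule tendsto_mult_left)
    qed
    show "AE x in lborel. norm (F x * ((\<eta> (x + h n *\<^sub>R b) - \<eta> x) / h n)) \<le> B * \<bar>F x\<bar>" for n
    proof (rule AE_I2)
      fix x
      have "\<bar>(\<eta> (x + h n *\<^sub>R b) - \<eta> x) / h n\<bar> \<le> B"
        using lip[of x "h n"] h(2)[of n] by (simp add: divide_le_eq)
      then show "norm (F x * ((\<eta> (x + h n *\<^sub>R b) - \<eta> x) / h n)) \<le> B * \<bar>F x\<bar>"
        unfolding real_norm_def abs_mult[of "F x"] by (subst mult.commute) (rule mult_right_mono, auto)
    qed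
  qed (use F in auto)
qed

text \<open>Uniform continuity of the gradient near \<open>K\<close>. Increments of \<open>v\<close>
  are bounded by the gradient at the base point alone, so the gradient of \<open>v\<close> composed
  with \<open>\<phi>\<close> is reached without differentiating \<open>\<phi>\<close>.\<close>

lemma C1_lipschitz_near_compact:
  fixes V :: "'a::euclidean_space \<Rightarrow> 'a" and v :: "'a \<Rightarrow> real"
  assumes K: "compact K" "K \<subseteq> U" "open U" and V: "continuous_on UNIV V"
    and v: "\<And>x. x \<in> U \<Longrightarrow> (v has_derivative (\<lambda>h. V x \<bullet> h)) (at x)" and e: "0 < (e::real)"
  obtains \<rho> where "0 < \<rho>"
    "\<And>x y. x \<in> K \<Longrightarrow> norm (y - x) < \<rho> \<Longrightarrow> \<bar>v y - v x\<bar> \<le> (norm (V x) + e) * norm (y - x)"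
proof -
  obtain r P where r: "0 < r" and P: "compact P" "P \<subseteq> U" "P = (\<Union>x\<in>K. cball x r)" "K \<subseteq> P"
    using compact_neighbourhood[OF K(3,1,2)] by metis
  have "uniformly_continuous_on P V"
    by (intro compact_uniformly_continuous continuous_on_subset[OF V] P) auto
  then obtain s where s: "0 < s" "\<And>x y. x \<in> P \<Longrightarrow> y \<in> P \<Longrightarrow> dist y x < s \<Longrightarrow> dist (V y) (V x) < e"
    unfolding uniformly_continuous_on_def using e by metis
  have "\<bar>v y - v x\<bar> \<le> (norm (V x) + e) * norm (y - x)" if x: "x \<in> K" and y: "norm (y - x) < min r s" for x y
  proof -
    have sub: "ball x (min r s) \<subseteq> P" unfolding P(3) using x by auto
    have xP: "x \<in> P" using x P(4) by auto
    have "norm (v y - v x) \<le> (norm (V x) + e) * norm (y - x)"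
    proof (rule differentiable_bound[of "ball x (min r s)" v "\<lambda>z h. V z \<bullet> h"])
      fix z assume z: "z \<in> ball x (min r s)"
      then have zP: "z \<in> P" using sub by blast
      then show "(v has_derivative (\<lambda>h. V z \<bullet> h)) (at z within ball x (min r s))"
        using v P(2) by (auto intro: has_derivative_at_withinI)
      have "dist (V z) (V x) < e" using s(2)[OF xP zP] z by (simp add: dist_commute)
      then have "norm (V z) \<le> norm (V x) + e"
        using norm_triangle_sub[of "V z" "V x"] by (simp add: dist_norm)
      then show "onorm (\<lambda>h. V z \<bullet> h) \<le> norm (V x) + e"
        by (intro onorm_le order_trans[OF Cauchy_Schwarz_ineq2[folded real_norm_def] mult_right_mono]) auto
    qed (use y r s in \<open>auto simp: dist_norm norm_minus_commute\<close>)
    then show ?thesis by simp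
  qed
  moreover have "0 < min r s" using r s by simp
  ultimately show ?thesis using that by blast
qed

lemma C1_chain_bound:
  fixes \<phi> :: "'a::euclidean_space \<Rightarrow> 'a" and v :: "'a \<Rightarrow> real"
  assumes L: "lipschitz_on_convex L D \<phi>" and D: "open D" and \<eta>: "\<eta> \<in> C1_compact D"
    and K: "compact K" "K \<subseteq> D" "\<And>x. x \<notin> K \<Longrightarrow> \<eta> x = 0" "\<And>x b. x \<notin> K \<Longrightarrow> frechet_derivative \<eta> (at x) b = 0"
    and U: "open U" "\<phi> ` K \<subseteq> U" and V: "continuous_on UNIV V" "continuous_on UNIV v"
    and v: "\<And>x. x \<in> U \<Longrightarrow> (v has_derivative (\<lambda>h. V x \<bullet> h)) (at x)" and b: "b \<in> Basis"
  shows "\<bar>LINT x|lebesgue_on D. v (\<phi> x) * frechet_derivative \<eta> (at x) b\<bar> \<le>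
    L * (LINT x|lebesgue_on D. norm (V (\<phi> x)) * \<bar>\<eta> x\<bar>)"
proof -
  have L0: "0 < L" using L by (simp add: lipschitz_on_convex_def)
  have cont: "continuous_on D \<phi>" by (rule lipschitz_on_convex_continuous[OF L D])
  have c: "Ck (Suc 0) \<eta>" using \<eta> by (simp add: C1_compact_def)
  obtain \<delta> K' where \<delta>: "0 < \<delta>" and K'c: "compact K'" and K'D: "K' \<subseteq> D"
    and K'eq: "K' = (\<Union>x\<in>K. cball x \<delta>)" and KK': "K \<subseteq> K'"
    using compact_neighbourhood[OF D K(1,2)] by metis
  have cK: "continuous_on K' \<phi>" using cont K'D by (rule continuous_on_subset)
  \<comment> \<open>The cut-off makes \<open>F\<close> integrable over the whole space. It stays
    invisible because \<open>\<eta>\<close> lives on \<open>K\<close> and shifts of length at most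
    \<open>\<delta>\<close> remain in \<open>K'\<close>.\<close>
  define F where "F = (\<lambda>x. indicator K' x *\<^sub>R v (\<phi> x))"
  define H where "H = (\<lambda>x. indicator K' x *\<^sub>R norm (V (\<phi> x)))"
  have iF: "integrable lborel F"
    unfolding F_def
    by (intro borel_integrable_compact K'c continuous_on_compose2[OF V(2)] cK) auto
  have iH: "integrable lborel H"
    unfolding H_def
    by (intro borel_integrable_compact K'c continuous_on_norm continuous_on_compose2[OF V(1)] cK) auto
  have [measurable]: "F \<in> borel_measurable borel" "H \<in> borel_measurable borel" "\<eta> \<in> borel_measurable borel"
    using iF iH Ck_measurable[OF c] by auto
  obtain B where B: "0 < B" "\<And>x. \<bar>\<eta> x\<bar> \<le> B" using C1_compactD[OF \<eta>] by metis
  have i\<eta>: "integrable lborel \<eta>"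
    by (rule integrable_continuous_compact_support[OF Ck_imp_continuous[OF c] K(1,3)])
  have bdd: "integrable lborel (\<lambda>x. G x * k x)" if "integrable lborel G" "k \<in> borel_measurable borel" "\<And>x. \<bar>k x\<bar> \<le> B"
    for G k :: "'a \<Rightarrow> real"
  proof (rule Bochner_Integration.integrable_bound)
    show "integrable lborel (\<lambda>x. B * \<bar>G x\<bar>)" using that by simp
    show "AE x in lborel. norm (G x * k x) \<le> norm (B * \<bar>G x\<bar>)"
      using that(3) B(1) by (intro AE_I2) (simp add: abs_mult, subst mult.commute, simp add: mult_right_mono)
  qed (use that in auto)
  have limit: "\<bar>\<integral>x. F x * frechet_derivative \<eta> (at x) b \<partial>lborel\<bar> \<le> (\<integral>x. L * (H x * \<bar>\<eta> x\<bar>) \<partial>lborel) + L * e * (\<integral>x. \<bar>\<eta> x\<bar> \<partial>lborel)"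
    if e: "0 < e" for e :: real
  proof -
    obtain \<rho> where \<rho>: "0 < \<rho>"
      "\<And>x y. x \<in> \<phi> ` K \<Longrightarrow> norm (y - x) < \<rho> \<Longrightarrow> \<bar>v y - v x\<bar> \<le> (norm (V x) + e) * norm (y - x)"
      using C1_lipschitz_near_compact[OF compact_continuous_image[OF continuous_on_subset[OF cont K(2)] K(1)] U(2,1) V(1) v e]
      by blast
    \<comment> \<open>Steps up to \<open>\<delta>\<close> stay in a ball inside \<open>D\<close>,
      which is convex, so the Lipschitz bound applies. Steps below \<open>\<rho> / L\<close> keep
      the image point within the range of the gradient estimate; the factor 2 gives
      strictness.\<close>
    define h where "h n = min \<delta> (\<rho> / (2 * L)) / real (Suc n)" for n
    have h0: "0 < h n" "h n \<le> \<delta>" "L * h n < \<rho>" for n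
    proof -
      have m: "0 < min \<delta> (\<rho> / (2 * L))" using \<delta> \<rho> L0 by simp
      then show "0 < h n" by (simp add: h_def)
      have "a / real (Suc n) \<le> a" if "0 < a" for a
        using that by (simp add: divide_le_eq mult_le_cancel_left1)
      then have "h n \<le> min \<delta> (\<rho> / (2 * L))" using m unfolding h_def by blast
      then show "h n \<le> \<delta>" "L * h n < \<rho>" using L0 \<rho>(1) by (auto simp: field_simps)
    qed
    have hl: "h \<longlonglongrightarrow> 0"
      unfolding h_def by (rule LIMSEQ_Suc[OF lim_const_over_n])
    have "(\<lambda>n. \<bar>\<integral>x. F x * ((\<eta> (x + h n *\<^sub>R b) - \<eta> x) / h n) \<partial>lborel\<bar>) \<longlonglongrightarrow> \<bar>\<integral>x. F x * frechet_derivative \<eta> (at x) b \<partial>lborel\<bar>"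
      by (intro tendsto_rabs C1_compact_difference_quotient[OF \<eta> b iF hl]) (use h0 in \<open>simp add: less_imp_neq[symmetric]\<close>)
    then show ?thesis
    proof (rule LIMSEQ_le_const2)
      have "\<bar>\<integral>x. F x * ((\<eta> (x + h n *\<^sub>R b) - \<eta> x) / h n) \<partial>lborel\<bar> \<le>
          (\<integral>x. L * (H x * \<bar>\<eta> x\<bar>) \<partial>lborel) + L * e * (\<integral>x. \<bar>\<eta> x\<bar> \<partial>lborel)" for n
      proof -
        have i1: "integrable lborel (\<lambda>x. F x * \<eta> x)" "integrable lborel (\<lambda>x. F x * \<eta> (x + h n *\<^sub>R b))"
          using B iF by (auto intro!: bdd)
        have pw: "\<bar>\<eta> x * ((F (x - h n *\<^sub>R b) - F x) / h n)\<bar> \<le> L * (H x * \<bar>\<eta> x\<bar>) + L * e * \<bar>\<eta> x\<bar>" for x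
        proof (cases "x \<in> K")
          case True
          let ?y = "x - h n *\<^sub>R b"
          have nb: "norm (?y - x) = h n" using b h0[of n] by simp
          have cb: "x \<in> cball x \<delta>" "?y \<in> cball x \<delta>"
            using nb h0[of n] \<delta> by (auto simp: dist_norm)
          have cD: "cball x \<delta> \<subseteq> K'" using True unfolding K'eq by blast
          have "norm (\<phi> ?y - \<phi> x) \<le> L * norm (?y - x)"
            using L cb cD K'D unfolding lipschitz_on_convex_def by (meson convex_cball order_trans)
          then have l: "norm (\<phi> ?y - \<phi> x) \<le> L * h n" using nb by simp
          have "\<bar>v (\<phi> ?y) - v (\<phi> x)\<bar> \<le> (norm (V (\<phi> x)) + e) * norm (\<phi> ?y - \<phi> x)"
            using \<rho>(2)[of "\<phi> x" "\<phi> ?y"] True l h0(3)[of n] by auto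
          also have "\<dots> \<le> (norm (V (\<phi> x)) + e) * (L * h n)"
            using l e by (intro mult_left_mono) auto
          finally have "\<bar>v (\<phi> ?y) - v (\<phi> x)\<bar> / h n \<le> (norm (V (\<phi> x)) + e) * L"
            using h0(1)[of n] by (simp add: divide_le_eq mult.assoc)
          moreover have "F ?y = v (\<phi> ?y)" "F x = v (\<phi> x)" "H x = norm (V (\<phi> x))"
            using subsetD[OF cD cb(1)] subsetD[OF cD cb(2)] by (simp_all add: F_def H_def)
          ultimately have "\<bar>(F ?y - F x) / h n\<bar> \<le> (H x + e) * L"
            using h0(1)[of n] by simp
          then have "\<bar>\<eta> x\<bar> * \<bar>(F ?y - F x) / h n\<bar> \<le> \<bar>\<eta> x\<bar> * ((H x + e) * L)"
            by (intro mult_left_mono) auto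
          then show ?thesis unfolding abs_mult[of "\<eta> x"] by (simp add: algebra_simps)
        qed (use K(3) in simp)
        have i2: "integrable lborel (\<lambda>x. L * (H x * \<bar>\<eta> x\<bar>) + L * e * \<bar>\<eta> x\<bar>)"
          using B i\<eta> by (intro Bochner_Integration.integrable_add integrable_mult_right bdd iH) auto
        have "(\<integral>x. F x * ((\<eta> (x + h n *\<^sub>R b) - \<eta> x) / h n) \<partial>lborel) = (\<integral>x. \<eta> x * ((F (x - h n *\<^sub>R b) - F x) / h n) \<partial>lborel)"
          by (rule difference_quotient_shift) (use i1 in auto)
        also have "\<bar>\<dots>\<bar> \<le> (\<integral>x. L * (H x * \<bar>\<eta> x\<bar>) + L * e * \<bar>\<eta> x\<bar> \<partial>lborel)"
        proof (rule order_trans)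
          show "\<bar>\<integral>x. \<eta> x * ((F (x - h n *\<^sub>R b) - F x) / h n) \<partial>lborel\<bar> \<le> (\<integral>x. \<bar>\<eta> x * ((F (x - h n *\<^sub>R b) - F x) / h n)\<bar> \<partial>lborel)"
            using integral_norm_bound[of lborel "\<lambda>x. \<eta> x * ((F (x - h n *\<^sub>R b) - F x) / h n)"] by simp
          show "(\<integral>x. \<bar>\<eta> x * ((F (x - h n *\<^sub>R b) - F x) / h n)\<bar> \<partial>lborel) \<le> (\<integral>x. L * (H x * \<bar>\<eta> x\<bar>) + L * e * \<bar>\<eta> x\<bar> \<partial>lborel)"
          proof (rule integral_mono[OF _ i2 pw])
            show "integrable lborel (\<lambda>x. \<bar>\<eta> x * ((F (x - h n *\<^sub>R b) - F x) / h n)\<bar>)"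
              by (rule Bochner_Integration.integrable_bound[OF i2]) (use pw in \<open>auto intro: order_trans[OF _ abs_ge_self]\<close>)
          qed
        qed
        also have "\<dots> = (\<integral>x. L * (H x * \<bar>\<eta> x\<bar>) \<partial>lborel) + L * e * (\<integral>x. \<bar>\<eta> x\<bar> \<partial>lborel)"
          using B i\<eta> iH by (subst Bochner_Integration.integral_add) (auto intro!: bdd integrable_mult_right)
        finally show ?thesis .
      qed
      then show "\<exists>N. \<forall>n\<ge>N. \<bar>\<integral>x. F x * ((\<eta> (x + h n *\<^sub>R b) - \<eta> x) / h n) \<partial>lborel\<bar> \<le>
          (\<integral>x. L * (H x * \<bar>\<eta> x\<bar>) \<partial>lborel) + L * e * (\<integral>x. \<bar>\<eta> x\<bar> \<partial>lborel)" by blast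
    qed
  qed
  have main: "\<bar>\<integral>x. F x * frechet_derivative \<eta> (at x) b \<partial>lborel\<bar> \<le> (\<integral>x. L * (H x * \<bar>\<eta> x\<bar>) \<partial>lborel)"
  proof (rule field_le_epsilon)
    fix e :: real assume e: "0 < e"
    define I where "I = (\<integral>x. \<bar>\<eta> x\<bar> \<partial>lborel)"
    have I: "0 \<le> I" by (simp add: I_def)
    have "L * (e / (L * (I + 1))) * I = e * (I / (I + 1))" using L0 by simp
    also have "\<dots> \<le> e * 1" using e I by (intro mult_left_mono) (simp_all add: divide_le_eq)
    finally have "L * (e / (L * (I + 1))) * I \<le> e" by simp
    moreover have "0 < e / (L * (I + 1))" using e I L0 by simp
    from limit[OF this] have "\<bar>\<integral>x. F x * frechet_derivative \<eta> (at x) b \<partial>lborel\<bar> \<le>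
      (\<integral>x. L * (H x * \<bar>\<eta> x\<bar>) \<partial>lborel) + L * (e / (L * (I + 1))) * I"
      unfolding I_def .
    ultimately show "\<bar>\<integral>x. F x * frechet_derivative \<eta> (at x) b \<partial>lborel\<bar> \<le> (\<integral>x. L * (H x * \<bar>\<eta> x\<bar>) \<partial>lborel) + e"
      by linarith
  qed
  have zero: "x \<notin> K' \<Longrightarrow> frechet_derivative \<eta> (at x) b = 0" "x \<notin> K' \<Longrightarrow> \<bar>\<eta> x\<bar> = 0" for x
    using K(3,4) KK' by auto
  have "integrable lebesgue F" "integrable lebesgue H"
    using iF iH by (simp_all add: integrable_completion)
  then have ai: "(\<lambda>x. v (\<phi> x)) absolutely_integrable_on K'" "(\<lambda>x. norm (V (\<phi> x))) absolutely_integrable_on K'"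
    by (simp_all only: set_integrable_def F_def H_def)
  have "(LINT x|lebesgue_on D. v (\<phi> x) * frechet_derivative \<eta> (at x) b) = (\<integral>x. F x * frechet_derivative \<eta> (at x) b \<partial>lborel)"
    by (rule integral_lebesgue_on_borel_rep[OF ai(1) iF _ frechet_derivative_measurable[OF c] zero(1) K'D D]) (simp_all add: F_def)
  moreover have "(LINT x|lebesgue_on D. norm (V (\<phi> x)) * \<bar>\<eta> x\<bar>) = (\<integral>x. H x * \<bar>\<eta> x\<bar> \<partial>lborel)"
    by (rule integral_lebesgue_on_borel_rep[OF ai(2) iH _ _ zero(2) K'D D]) (simp_all add: H_def)
  ultimately show ?thesis using main by simp
qed

lemma locally_summable_measurable:
  fixes f :: "'a::euclidean_space \<Rightarrow> 'b::euclidean_space"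
  assumes f: "locally_summable_on f D" and D: "open D"
  shows "f \<in> borel_measurable (lebesgue_on D)"
proof -
  obtain C where C: "\<And>n::nat. compact (C n)" "\<And>n. C n \<subseteq> D"
    and ev: "\<And>K. compact K \<Longrightarrow> K \<subseteq> D \<Longrightarrow> \<exists>N. \<forall>n\<ge>N. K \<subseteq> C n"
    using open_Union_compact_subsets[OF D] by metis
  show ?thesis
  proof (rule borel_measurable_LIMSEQ_metric)
    fix n
    have "integrable lebesgue (\<lambda>x. indicator (C n) x *\<^sub>R f x)"
      using f C by (simp add: locally_summable_on_def set_integrable_def)
    then show "(\<lambda>x. indicator (C n) x *\<^sub>R f x) \<in> borel_measurable (lebesgue_on D)"
      by (intro measurable_restrict_space1) simp
  next
    fix x assume "x \<in> space (lebesgue_on D)"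
    then obtain N where "\<forall>n\<ge>N. {x} \<subseteq> C n" using ev[of "{x}"] by auto
    then have "\<forall>\<^sub>F n in sequentially. indicator (C n) x *\<^sub>R f x = f x"
      unfolding eventually_sequentially by (intro exI[of _ N]) auto
    then show "(\<lambda>n. indicator (C n) x *\<^sub>R f x) \<longlonglongrightarrow> f x"
      by (rule tendsto_eventually)
  qed
qed

lemma continuous_locally_summable:
  fixes f :: "'a::euclidean_space \<Rightarrow> 'b::euclidean_space"
  assumes "continuous_on UNIV f"
  shows "locally_summable_on f D"
  unfolding locally_summable_on_def
proof (intro allI impI, elim conjE)
  fix K :: "'a set" assume "compact K"
  then have "integrable lborel (\<lambda>x. indicator K x *\<^sub>R f x)"
    by (intro borel_integrable_compact continuous_on_subset[OF assms]) auto
  then show "f absolutely_integrable_on K"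
    unfolding set_integrable_def by (subst integrable_completion) auto
qed

lemma locally_summable_diff:
  assumes "locally_summable_on f D" "locally_summable_on g D"
  shows "locally_summable_on (\<lambda>x. f x - g x) D"
  using assms unfolding locally_summable_on_def by (auto intro: set_integral_diff)

section \<open>Composition with a locally bi-Lipschitz homeomorphism\<close>

context
  fixes D D' :: "'a::euclidean_space set" and \<phi> \<psi> :: "'a \<Rightarrow> 'a" and L :: real
  assumes hom: "homeomorphism D D' \<phi> \<psi>" and D: "open D" "open D'"
    and L: "lipschitz_on_convex L D \<phi>" "lipschitz_on_convex L D' \<psi>"
begin

lemma measurable_comp_bilipschitz:
  "f \<in> borel_measurable (lebesgue_on D') \<Longrightarrow> (\<lambda>x. f (\<phi> x)) \<in> borel_measurable (lebesgue_on D)"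
  by (rule measurable_compose[OF measurable_homeomorphism_lipschitz[OF hom D L(2)]])

lemma nn_integral_comp_le:
  fixes F :: "'a \<Rightarrow> ennreal"
  assumes F: "F \<in> borel_measurable (lebesgue_on D')"
  shows "(\<integral>\<^sup>+x. F (\<phi> x) \<partial>lebesgue_on D) \<le> ennreal (L ^ DIM('a)) * (\<integral>\<^sup>+y. F y \<partial>lebesgue_on D')"
proof -
  have "(\<integral>\<^sup>+x. F (\<phi> x) \<partial>lebesgue_on D) \<le> ennreal (L ^ DIM('a)) * (\<integral>\<^sup>+y. F (\<phi> (\<psi> y)) \<partial>lebesgue_on D')"
    using homeomorphism_sym[THEN iffD1, OF hom] D L measurable_comp_bilipschitz[OF F]
    by (intro nn_integral_lipschitz_image) auto
  also have "(\<integral>\<^sup>+y. F (\<phi> (\<psi> y)) \<partial>lebesgue_on D') = (\<integral>\<^sup>+y. F y \<partial>lebesgue_on D')"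
    using hom by (intro nn_integral_cong) (simp add: homeomorphism_def)
  finally show ?thesis .
qed

lemma image_compact:
  assumes "compact K" "K \<subseteq> D"
  shows "\<phi> ` K \<subseteq> D'" "compact (\<phi> ` K)"
proof -
  show "\<phi> ` K \<subseteq> D'" using image_mono[OF assms(2), of \<phi>] homeomorphism_image1[OF hom] by simp
  show "compact (\<phi> ` K)"
    by (rule compact_continuous_image[OF continuous_on_subset[OF homeomorphism_cont1[OF hom] assms(2)] assms(1)])
qed

lemma nn_integral_comp_compact_le:
  fixes F :: "'a \<Rightarrow> ennreal"
  assumes F: "F \<in> borel_measurable (lebesgue_on D')" and K: "compact K" "K \<subseteq> D"
  shows "(\<integral>\<^sup>+x. F (\<phi> x) * indicator K x \<partial>lebesgue_on D) \<le> ennreal (L ^ DIM('a)) * (\<integral>\<^sup>+y. F y \<partial>lebesgue_on (\<phi> ` K))"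
proof -
  have sub: "\<phi> ` K \<subseteq> D'" by (rule image_compact(1)[OF K(1,2)])
  have "compact (\<phi> ` K)"
    by (rule image_compact(2)[OF K(1,2)])
  then have [simp]: "\<phi> ` K \<in> sets lebesgue" by (simp add: compact_imp_closed)
  have mK: "\<phi> ` K \<in> sets (lebesgue_on D')"
    using sub D by (simp add: sets_restrict_space_iff)
  have inj: "inj_on \<phi> D"
    by (rule inj_on_inverseI[of _ \<psi>]) (rule homeomorphism_apply1[OF hom])
  have "(\<integral>\<^sup>+x. F (\<phi> x) * indicator K x \<partial>lebesgue_on D) = (\<integral>\<^sup>+x. F (\<phi> x) * indicator (\<phi> ` K) (\<phi> x) \<partial>lebesgue_on D)"
  proof (rule nn_integral_cong)
    fix x assume "x \<in> space (lebesgue_on D)"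
    then have "\<phi> x \<in> \<phi> ` K \<longleftrightarrow> x \<in> K"
      using inj_on_image_mem_iff[OF inj _ K(2)] by simp
    then show "F (\<phi> x) * indicator K x = F (\<phi> x) * indicator (\<phi> ` K) (\<phi> x)" by (simp add: indicator_def)
  qed
  also have "\<dots> \<le> ennreal (L ^ DIM('a)) * (\<integral>\<^sup>+y. F y * indicator (\<phi> ` K) y \<partial>lebesgue_on D')"
    by (rule nn_integral_comp_le[OF borel_measurable_times_ennreal[OF F borel_measurable_indicator[OF mK]]])
  also have "(\<integral>\<^sup>+y. F y * indicator (\<phi> ` K) y \<partial>lebesgue_on D') = (\<integral>\<^sup>+y. F y \<partial>lebesgue_on (\<phi> ` K))"
    using D sub by (simp add: nn_integral_restrict_space indicator_inter_arith[symmetric] mult.assoc Int_absorb1 Int_absorb2)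
  finally show ?thesis .
qed

lemma locally_summable_comp:
  fixes u :: "'a \<Rightarrow> 'b::euclidean_space"
  assumes u: "locally_summable_on u D'"
  shows "locally_summable_on (\<lambda>x. u (\<phi> x)) D"
  unfolding locally_summable_on_def
proof (intro allI impI, elim conjE)
  fix K assume K: "compact K" "K \<subseteq> D"
  have sub: "\<phi> ` K \<subseteq> D'" by (rule image_compact(1)[OF K(1,2)])
  have cK: "compact (\<phi> ` K)"
    by (rule image_compact(2)[OF K(1,2)])
  have "u absolutely_integrable_on (\<phi> ` K)" using u cK sub by (simp add: locally_summable_on_def)
  then have "integrable (lebesgue_on (\<phi> ` K)) u"
    unfolding set_integrable_def using cK by (subst integrable_restrict_space) (auto simp: compact_imp_closed)
  then have "(\<integral>\<^sup>+y. ennreal (norm (u y)) \<partial>lebesgue_on (\<phi> ` K)) < \<infinity>"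
    by (simp add: integrable_iff_bounded)
  have um: "u \<in> borel_measurable (lebesgue_on D')" by (rule locally_summable_measurable[OF u D(2)])
  have "(\<integral>\<^sup>+x. ennreal (norm (u (\<phi> x))) * indicator K x \<partial>lebesgue_on D) \<le>
      ennreal (L ^ DIM('a)) * (\<integral>\<^sup>+y. ennreal (norm (u y)) \<partial>lebesgue_on (\<phi> ` K))"
    by (rule nn_integral_comp_compact_le[OF _ K]) (use um in measurable)
  also have "\<dots> < \<infinity>"
    using \<open>(\<integral>\<^sup>+y. ennreal (norm (u y)) \<partial>lebesgue_on (\<phi> ` K)) < \<infinity>\<close> by (simp add: ennreal_mult_less_top)
  finally have fin: "(\<integral>\<^sup>+x. ennreal (norm (u (\<phi> x))) * indicator K x \<partial>lebesgue_on D) < \<infinity>" .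
  have [measurable]: "K \<in> sets (lebesgue_on D)"
    using K D by (simp add: sets_restrict_space_iff compact_imp_closed)
  have [measurable]: "(\<lambda>x. u (\<phi> x)) \<in> borel_measurable (lebesgue_on D)"
    by (rule measurable_comp_bilipschitz[OF um])
  have "integrable (lebesgue_on D) (\<lambda>x. indicator K x *\<^sub>R u (\<phi> x))"
    unfolding integrable_iff_bounded
  proof
    have "(\<integral>\<^sup>+x. ennreal (norm (indicator K x *\<^sub>R u (\<phi> x))) \<partial>lebesgue_on D) = (\<integral>\<^sup>+x. ennreal (norm (u (\<phi> x))) * indicator K x \<partial>lebesgue_on D)"
      by (intro nn_integral_cong) (auto simp: indicator_def)
    then show "(\<integral>\<^sup>+x. ennreal (norm (indicator K x *\<^sub>R u (\<phi> x))) \<partial>lebesgue_on D) < \<infinity>" using fin by simp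
  qed measurable
  then have "integrable lebesgue (\<lambda>x. indicator D x *\<^sub>R (indicator K x *\<^sub>R u (\<phi> x)))"
    using D by (subst (asm) integrable_restrict_space) auto
  also have "(\<lambda>x. indicator D x *\<^sub>R (indicator K x *\<^sub>R u (\<phi> x))) = (\<lambda>x. indicator K x *\<^sub>R u (\<phi> x))"
    using K by (auto simp: fun_eq_iff indicator_def)
  finally show "(\<lambda>x. u (\<phi> x)) absolutely_integrable_on K" by (simp add: set_integrable_def)
qed

lemma nn_integral_comp_mult_le:
  fixes f :: "'a \<Rightarrow> 'b::euclidean_space" and k :: "'a \<Rightarrow> real"
  assumes f: "locally_summable_on f D'" and K: "compact K" "K \<subseteq> D"
    and k: "\<And>x. x \<notin> K \<Longrightarrow> k x = 0" "\<And>x. \<bar>k x\<bar> \<le> B" and e: "0 \<le> e" "0 \<le> B"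
    and le: "(\<integral>\<^sup>+y. ennreal (norm (f y)) \<partial>lebesgue_on (\<phi> ` K)) \<le> ennreal e"
  shows "(\<integral>\<^sup>+x. ennreal (norm (k x *\<^sub>R f (\<phi> x))) \<partial>lebesgue_on D) \<le> ennreal (B * L ^ DIM('a) * e)"
proof -
  have L0: "0 < L" using L by (simp add: lipschitz_on_convex_def)
  have [measurable]: "f \<in> borel_measurable (lebesgue_on D')" by (rule locally_summable_measurable[OF f D(2)])
  have [measurable]: "K \<in> sets (lebesgue_on D)"
    using K D by (simp add: sets_restrict_space_iff compact_imp_closed)
  note measurable_comp_bilipschitz[measurable]
  have "(\<integral>\<^sup>+x. ennreal (norm (k x *\<^sub>R f (\<phi> x))) \<partial>lebesgue_on D) \<le> (\<integral>\<^sup>+x. ennreal B * (ennreal (norm (f (\<phi> x))) * indicator K x) \<partial>lebesgue_on D)"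
  proof (rule nn_integral_mono)
    fix x
    show "ennreal (norm (k x *\<^sub>R f (\<phi> x))) \<le> ennreal B * (ennreal (norm (f (\<phi> x))) * indicator K x)"
      using k[of x] e by (cases "x \<in> K") (auto simp: ennreal_mult[symmetric] intro!: ennreal_leI mult_right_mono)
  qed
  also have "\<dots> = ennreal B * (\<integral>\<^sup>+x. ennreal (norm (f (\<phi> x))) * indicator K x \<partial>lebesgue_on D)"
    by (intro nn_integral_cmult) measurable
  also have "\<dots> \<le> ennreal B * (ennreal (L ^ DIM('a)) * ennreal e)"
    by (intro mult_left_mono order_trans[OF nn_integral_comp_compact_le[OF _ K]] le) auto
  also have "\<dots> = ennreal (B * L ^ DIM('a) * e)"
    using e L0 by (simp add: ennreal_mult[symmetric] mult.assoc)
  finally show ?thesis .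
qed

text \<open>Both sides depend continuously on the function and its gradient in
  \<open>L\<^sub>1\<close> on the image of the support of \<open>\<eta>\<close>, so the estimate for
  smooth functions passes to the limit.\<close>

lemma weak_gradient_chain_bound:
  fixes u :: "'a \<Rightarrow> real"
  assumes wg: "has_weak_gradient_on u G D'" and \<eta>: "\<eta> \<in> C1_compact D" and b: "b \<in> Basis"
  shows "\<bar>LINT x|lebesgue_on D. u (\<phi> x) * frechet_derivative \<eta> (at x) b\<bar> \<le>
    (LINT x|lebesgue_on D. (L * norm (G (\<phi> x))) * \<bar>\<eta> x\<bar>)"
proof -
  have L0: "0 < L" using L by (simp add: lipschitz_on_convex_def)
  obtain K B where K: "compact K" "K \<subseteq> D" "\<And>x. x \<notin> K \<Longrightarrow> \<eta> x = 0"
    "\<And>x b. x \<notin> K \<Longrightarrow> frechet_derivative \<eta> (at x) b = 0"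
    and B: "0 < B" "\<And>x. \<bar>\<eta> x\<bar> \<le> B" "\<And>x b. b \<in> Basis \<Longrightarrow> \<bar>frechet_derivative \<eta> (at x) b\<bar> \<le> B"
    using C1_compactD[OF \<eta>] by metis
  let ?d = "\<lambda>x. frechet_derivative \<eta> (at x) b"
  have sub: "\<phi> ` K \<subseteq> D'" by (rule image_compact(1)[OF K(1,2)])
  have cK: "compact (\<phi> ` K)"
    by (rule image_compact(2)[OF K(1,2)])
  have lu: "locally_summable_on u D'" and lG: "locally_summable_on G D'"
    using wg by (auto simp: has_weak_gradient_on_def)
  note int1 = integrable_C1_compact_derivative(1)[OF locally_summable_comp D(1) \<eta> b]
  note int2 = integrable_C1_compact_derivative(2)[OF locally_summable_comp D(1) \<eta> b]
  \<comment> \<open>The product of the bound on \<open>\<eta>\<close> and its partial derivatives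
    with the cost of the change of variables. An approximation error \<open>e\<close> thus costs
    \<open>c * e\<close> on the left and \<open>L * (c * e)\<close> on the right.\<close>
  define c where "c = B * L ^ DIM('a)"
  have c0: "0 < c" using B L0 by (simp add: c_def)
  let ?R = "LINT x|lebesgue_on D. norm (\<eta> x *\<^sub>R G (\<phi> x))"
  have est: "\<bar>LINT x|lebesgue_on D. ?d x * u (\<phi> x)\<bar> \<le> L * ?R + (c * e + L * (c * e))" if e: "0 < e" for e :: real
  proof -
    obtain v V U where U: "open U" "\<phi> ` K \<subseteq> U" "U \<subseteq> D'" and V: "continuous_on UNIV V" "continuous_on UNIV v"
      and v: "\<And>x. x \<in> U \<Longrightarrow> (v has_derivative (\<lambda>h. V x \<bullet> h)) (at x)"
      and ve: "(\<integral>\<^sup>+x. ennreal \<bar>v x - u x\<bar> \<partial>lebesgue_on (\<phi> ` K)) \<le> ennreal e"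
      and Ve: "(\<integral>\<^sup>+x. ennreal (norm (V x - G x)) \<partial>lebesgue_on (\<phi> ` K)) \<le> ennreal e"
      by (rule weak_gradient_C1_approx[OF wg D(2) cK sub e]) (rule that)
    have lv: "locally_summable_on v D'" "locally_summable_on V D'"
      using V by (auto intro: continuous_locally_summable)
    have iu: "integrable (lebesgue_on D) (\<lambda>x. ?d x * u (\<phi> x))" and iv: "integrable (lebesgue_on D) (\<lambda>x. ?d x * v (\<phi> x))"
      and ivu: "integrable (lebesgue_on D) (\<lambda>x. ?d x * (v (\<phi> x) - u (\<phi> x)))"
      using int1[OF lu] int1[OF lv(1)] int1[OF locally_summable_diff[OF lv(1) lu]] by simp_all
    have iG: "integrable (lebesgue_on D) (\<lambda>x. \<eta> x *\<^sub>R G (\<phi> x))" and iV: "integrable (lebesgue_on D) (\<lambda>x. \<eta> x *\<^sub>R V (\<phi> x))"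
      and iVG: "integrable (lebesgue_on D) (\<lambda>x. \<eta> x *\<^sub>R (V (\<phi> x) - G (\<phi> x)))"
      by (rule int2[OF lG] int2[OF lv(2)] int2[OF locally_summable_diff[OF lv(2) lG]])+
    have 1: "\<bar>LINT x|lebesgue_on D. ?d x * (v (\<phi> x) - u (\<phi> x))\<bar> \<le> c * e"
    proof -
      have "ennreal (norm (LINT x|lebesgue_on D. ?d x * (v (\<phi> x) - u (\<phi> x)))) \<le> (\<integral>\<^sup>+x. ennreal (norm (?d x * (v (\<phi> x) - u (\<phi> x)))) \<partial>lebesgue_on D)"
        by (rule integral_norm_bound_ennreal[OF ivu])
      also have "\<dots> \<le> ennreal (c * e)"
        using nn_integral_comp_mult_le[OF locally_summable_diff[OF lv(1) lu] K(1,2), of ?d B e] K(4) B b e ve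
        by (simp add: c_def)
      finally show ?thesis using c0 e by simp
    qed
    have 2: "(LINT x|lebesgue_on D. norm (\<eta> x *\<^sub>R (V (\<phi> x) - G (\<phi> x)))) \<le> c * e"
    proof -
      have "ennreal (LINT x|lebesgue_on D. norm (\<eta> x *\<^sub>R (V (\<phi> x) - G (\<phi> x)))) = (\<integral>\<^sup>+x. ennreal (norm (\<eta> x *\<^sub>R (V (\<phi> x) - G (\<phi> x)))) \<partial>lebesgue_on D)"
        by (rule nn_integral_eq_integral[symmetric, OF integrable_norm[OF iVG]]) simp
      also have "\<dots> \<le> ennreal (c * e)"
        using nn_integral_comp_mult_le[OF locally_summable_diff[OF lv(2) lG] K(1,2), of \<eta> B e] K(3) B e Ve
        by (simp add: c_def)
      finally show ?thesis using c0 e by simp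
    qed
    have "\<bar>LINT x|lebesgue_on D. v (\<phi> x) * ?d x\<bar> \<le> L * (LINT x|lebesgue_on D. norm (V (\<phi> x)) * \<bar>\<eta> x\<bar>)"
      by (rule C1_chain_bound[OF L(1) D(1) \<eta> K U(1,2) V v b])
    then have 3: "\<bar>LINT x|lebesgue_on D. ?d x * v (\<phi> x)\<bar> \<le> L * (LINT x|lebesgue_on D. norm (\<eta> x *\<^sub>R V (\<phi> x)))"
      by (simp add: mult.commute)
    have "(LINT x|lebesgue_on D. norm (\<eta> x *\<^sub>R V (\<phi> x))) \<le> (LINT x|lebesgue_on D. norm (\<eta> x *\<^sub>R G (\<phi> x)) + norm (\<eta> x *\<^sub>R (V (\<phi> x) - G (\<phi> x))))"
    proof (intro integral_mono Bochner_Integration.integrable_add integrable_norm iV iG iVG)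
      show "norm (\<eta> x *\<^sub>R V (\<phi> x)) \<le> norm (\<eta> x *\<^sub>R G (\<phi> x)) + norm (\<eta> x *\<^sub>R (V (\<phi> x) - G (\<phi> x)))" for x
        using norm_triangle_ineq[of "\<eta> x *\<^sub>R G (\<phi> x)" "\<eta> x *\<^sub>R (V (\<phi> x) - G (\<phi> x))"]
        by (simp add: scaleR_right_diff_distrib)
    qed
    also have "\<dots> = ?R + (LINT x|lebesgue_on D. norm (\<eta> x *\<^sub>R (V (\<phi> x) - G (\<phi> x))))"
      by (intro Bochner_Integration.integral_add integrable_norm iG iVG)
    finally have 4: "L * (LINT x|lebesgue_on D. norm (\<eta> x *\<^sub>R V (\<phi> x))) \<le> L * (?R + c * e)"
      using 2 L0 by (intro mult_left_mono) auto
    have "(LINT x|lebesgue_on D. ?d x * u (\<phi> x)) = (LINT x|lebesgue_on D. ?d x * v (\<phi> x)) - (LINT x|lebesgue_on D. ?d x * (v (\<phi> x) - u (\<phi> x)))"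
      using iu iv by (simp add: right_diff_distrib)
    then show ?thesis using 1 3 4 by (simp add: distrib_left)
  qed
  have "\<bar>LINT x|lebesgue_on D. ?d x * u (\<phi> x)\<bar> \<le> L * ?R"
  proof (rule field_le_epsilon)
    fix e :: real assume e: "0 < e"
    have p: "0 < e / (c * (1 + L))" using e c0 L0 by simp
    have "c * t + L * (c * t) = (1 + L) * (c * t)" for t by (simp add: algebra_simps)
    then have "c * (e / (c * (1 + L))) + L * (c * (e / (c * (1 + L)))) = (1 + L) * (c * (e / (c * (1 + L))))" .
    also have "\<dots> = e" using c0 L0 by simp
    finally show "\<bar>LINT x|lebesgue_on D. ?d x * u (\<phi> x)\<bar> \<le> L * ?R + e"
      using est[OF p] by simp
  qed
  also have "L * ?R = (LINT x|lebesgue_on D. (L * norm (G (\<phi> x))) * \<bar>\<eta> x\<bar>)"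
    by (simp add: mult_ac flip: integral_mult_right_zero)
  finally show ?thesis by (simp add: mult.commute)
qed

text \<open>Integrability of \<open>G\<close> on all of \<open>D'\<close> makes the dominating
  measure with density \<open>L * norm (G (\<phi> x))\<close> finite, as the representation of the
  functional requires.\<close>

lemma weak_gradient_comp:
  fixes u :: "'a \<Rightarrow> real"
  assumes wg: "has_weak_gradient_on u G D'" and G: "integrable (lebesgue_on D') G"
  obtains g where "has_weak_gradient_on (\<lambda>x. u (\<phi> x)) g D" "\<And>x. norm (g x) \<le> 2 * DIM('a) * (L * norm (G (\<phi> x)))"
proof (rule weak_gradient_from_bound[OF D(1), of "\<lambda>x. u (\<phi> x)" "\<lambda>x. L * norm (G (\<phi> x))"])
  have L0: "0 < L" using L by (simp add: lipschitz_on_convex_def)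
  show "locally_summable_on (\<lambda>x. u (\<phi> x)) D"
    using wg by (intro locally_summable_comp) (simp add: has_weak_gradient_on_def)
  have Gm: "G \<in> borel_measurable (lebesgue_on D')" using G by simp
  have "(\<integral>\<^sup>+x. ennreal (norm (G (\<phi> x))) \<partial>lebesgue_on D) \<le> ennreal (L ^ DIM('a)) * (\<integral>\<^sup>+y. ennreal (norm (G y)) \<partial>lebesgue_on D')"
    using Gm by (intro nn_integral_comp_le) measurable
  also have "\<dots> < \<infinity>" using G by (simp add: integrable_iff_bounded ennreal_mult_less_top)
  finally have "integrable (lebesgue_on D) (\<lambda>x. G (\<phi> x))"
    using measurable_comp_bilipschitz[OF Gm] by (simp add: integrable_iff_bounded)
  then show "integrable (lebesgue_on D) (\<lambda>x. L * norm (G (\<phi> x)))" by simp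
  show "0 \<le> L * norm (G (\<phi> x))" for x using L0 by simp
  show "\<bar>LINT x|lebesgue_on D. u (\<phi> x) * frechet_derivative \<eta> (at x) b\<bar> \<le> (LINT x|lebesgue_on D. L * norm (G (\<phi> x)) * \<bar>\<eta> x\<bar>)"
    if "\<eta> \<in> C1_compact D" "b \<in> Basis" for \<eta> b
    by (rule weak_gradient_chain_bound[OF wg that])
qed (rule that)

end

section \<open>Poincare inequality and Rellich compactness\<close>

lemma C1_segment_bound:
  fixes V :: "'a::euclidean_space \<Rightarrow> 'a"
  assumes V: "continuous_on UNIV V" and v: "\<And>s. s \<in> {0..1} \<Longrightarrow> (v has_derivative (\<lambda>h. V (x + s *\<^sub>R h0) \<bullet> h)) (at (x + s *\<^sub>R h0))"
  shows "ennreal \<bar>v (x + h0) - v x\<bar> \<le> (\<integral>\<^sup>+s. indicator {0..1::real} s * ennreal (norm (V (x + s *\<^sub>R h0)) * norm h0) \<partial>lborel)"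
proof -
  have cont: "continuous_on {0..1} (\<lambda>s. V (x + s *\<^sub>R h0) \<bullet> h0)"
    by (intro continuous_intros continuous_on_compose2[OF V]) auto
  have d: "((\<lambda>s. v (x + s *\<^sub>R h0)) has_vector_derivative (V (x + s *\<^sub>R h0) \<bullet> h0)) (at s within {0..1})"
    if "0 \<le> s" "s \<le> 1" for s
  proof -
    have "((\<lambda>s. x + s *\<^sub>R h0) has_derivative (\<lambda>t. t *\<^sub>R h0)) (at s within {0..1})"
      by (auto intro!: derivative_eq_intros)
    from has_derivative_compose[OF this v[of s]] that
    show ?thesis by (simp add: has_vector_derivative_def)
  qed
  have "(\<integral>s. indicator {0..1} s *\<^sub>R (V (x + s *\<^sub>R h0) \<bullet> h0) \<partial>lborel) = v (x + h0) - v x"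
    using integral_FTC_Icc[OF _ d cont] by simp
  moreover have "ennreal (norm (\<integral>s. indicator {0..1} s *\<^sub>R (V (x + s *\<^sub>R h0) \<bullet> h0) \<partial>lborel)) \<le>
      (\<integral>\<^sup>+s. ennreal (norm (indicator {0..1::real} s *\<^sub>R (V (x + s *\<^sub>R h0) \<bullet> h0))) \<partial>lborel)"
    by (intro integral_norm_bound_ennreal borel_integrable_compact cont) auto
  moreover have "\<dots> \<le> (\<integral>\<^sup>+s. indicator {0..1::real} s * ennreal (norm (V (x + s *\<^sub>R h0)) * norm h0) \<partial>lborel)"
    by (intro nn_integral_mono) (auto simp: indicator_def intro!: ennreal_leI Cauchy_Schwarz_ineq2)
  ultimately show ?thesis by simp
qed

lemma nn_integral_lborel_translate:
  fixes W :: "'a::euclidean_space \<Rightarrow> ennreal"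
  assumes "W \<in> borel_measurable borel"
  shows "(\<integral>\<^sup>+x. W (x + h) \<partial>lborel) = (\<integral>\<^sup>+x. W x \<partial>lborel)"
proof -
  have "(\<integral>\<^sup>+x. W x \<partial>distr lborel borel (\<lambda>y. y + h)) = (\<integral>\<^sup>+x. W (x + h) \<partial>lborel)"
    using assms by (intro nn_integral_distr) auto
  then show ?thesis by (simp add: lborel_distr_plus_right)
qed

text \<open>Substitute \<open>y = x + h\<close> and integrate the gradient along the segment, which
  convexity keeps inside \<open>H\<close>. For fixed \<open>h\<close> and \<open>s\<close>,
  translation invariance frees the integral over \<open>x\<close> from both, so only the volume of
  the differences \<open>h\<close> and their length remain.\<close>

lemma nn_integral_difference_convex:
  fixes v :: "'a::euclidean_space \<Rightarrow> real" and V :: "'a \<Rightarrow> 'a"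
  assumes V: "continuous_on UNIV V" "continuous_on UNIV v" and v: "\<And>x. x \<in> H \<Longrightarrow> (v has_derivative (\<lambda>h. V x \<bullet> h)) (at x)"
    and H: "convex H" "H \<in> sets borel" and B: "\<And>x y. x \<in> H \<Longrightarrow> y \<in> H \<Longrightarrow> y - x \<in> B" "B \<in> sets borel"
    and R: "\<And>h. h \<in> B \<Longrightarrow> norm h \<le> R" "0 \<le> R"
  shows "(\<integral>\<^sup>+x. \<integral>\<^sup>+y. indicator H x * (indicator H y * ennreal \<bar>v y - v x\<bar>) \<partial>lborel \<partial>lborel) \<le>
    (ennreal R * emeasure lborel B) * (\<integral>\<^sup>+x. indicator H x * ennreal (norm (V x)) \<partial>lborel)"
proof -
  note H(2)[measurable] B(2)[measurable]
  have [measurable]: "V \<in> borel_measurable borel" "v \<in> borel_measurable borel"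
    using V by (auto intro: borel_measurable_continuous_onI)
  define W where "W = (\<lambda>x. indicator H x * ennreal (norm (V x)))"
  have [measurable]: "W \<in> borel_measurable borel" unfolding W_def by measurable
  \<comment> \<open>The restrictions on \<open>h\<close> and \<open>s\<close> are moved into
    \<open>g\<close>, so that the remaining factor is a translate of \<open>W\<close> on the whole
    space.\<close>
  define g :: "'a \<Rightarrow> real \<Rightarrow> ennreal" where "g = (\<lambda>h s. indicator B h * ennreal R * indicator {0..1} s)"
  have gm [measurable]: "(\<lambda>(h, s). g h s) \<in> borel_measurable (borel \<Otimes>\<^sub>M borel)" unfolding g_def by measurable
  have "(\<integral>\<^sup>+y. indicator H x * (indicator H y * ennreal \<bar>v y - v x\<bar>) \<partial>lborel) \<le> (\<integral>\<^sup>+h. \<integral>\<^sup>+s. g h s * W (x + s *\<^sub>R h) \<partial>lborel \<partial>lborel)" for x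
  proof -
    have "(\<integral>\<^sup>+y. indicator H x * (indicator H y * ennreal \<bar>v y - v x\<bar>) \<partial>lborel) =
        (\<integral>\<^sup>+h. indicator H x * (indicator H (h + x) * ennreal \<bar>v (h + x) - v x\<bar>) \<partial>lborel)"
      by (rule nn_integral_lborel_translate[symmetric]) measurable
    also have "\<dots> \<le> (\<integral>\<^sup>+h. \<integral>\<^sup>+s. g h s * W (x + s *\<^sub>R h) \<partial>lborel \<partial>lborel)"
    proof (rule nn_integral_mono)
      fix h
      show "indicator H x * (indicator H (h + x) * ennreal \<bar>v (h + x) - v x\<bar>) \<le> (\<integral>\<^sup>+s. g h s * W (x + s *\<^sub>R h) \<partial>lborel)"
      proof (cases "x \<in> H \<and> h + x \<in> H")
        case True
        then have hB: "h \<in> B" using B(1)[of x "h + x"] by simp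
        have seg: "x + s *\<^sub>R h \<in> H" if "s \<in> {0..1}" for s
          using convexD_alt[OF H(1), of x "h + x" s] True that by (simp add: algebra_simps)
        have "ennreal \<bar>v (x + h) - v x\<bar> \<le> (\<integral>\<^sup>+s. indicator {0..1::real} s * ennreal (norm (V (x + s *\<^sub>R h)) * norm h) \<partial>lborel)"
          by (rule C1_segment_bound[OF V(1) v[OF seg]])
        also have "\<dots> \<le> (\<integral>\<^sup>+s. g h s * W (x + s *\<^sub>R h) \<partial>lborel)"
        proof (rule nn_integral_mono)
          fix s :: real
          show "indicator {0..1} s * ennreal (norm (V (x + s *\<^sub>R h)) * norm h) \<le> g h s * W (x + s *\<^sub>R h)"
          proof (cases "s \<in> {0..1}")
            case s: True
            have "ennreal (norm (V (x + s *\<^sub>R h)) * norm h) \<le> ennreal (R * norm (V (x + s *\<^sub>R h)))"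
              using R(1)[OF hB] by (intro ennreal_leI) (simp add: mult.commute mult_right_mono)
            then show ?thesis using s hB seg[OF s] R(2) by (simp add: g_def W_def ennreal_mult)
          qed simp
        qed
        finally show ?thesis using True by (simp add: add.commute)
      qed auto
    qed
    finally show ?thesis .
  qed
  then have "(\<integral>\<^sup>+x. \<integral>\<^sup>+y. indicator H x * (indicator H y * ennreal \<bar>v y - v x\<bar>) \<partial>lborel \<partial>lborel) \<le>
      (\<integral>\<^sup>+x. \<integral>\<^sup>+h. \<integral>\<^sup>+s. g h s * W (x + s *\<^sub>R h) \<partial>lborel \<partial>lborel \<partial>lborel)"
    by (rule nn_integral_mono)
  also have "\<dots> = (\<integral>\<^sup>+h. \<integral>\<^sup>+x. \<integral>\<^sup>+s. g h s * W (x + s *\<^sub>R h) \<partial>lborel \<partial>lborel \<partial>lborel)"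
    by (rule lborel_pair.Fubini') measurable
  also have "\<dots> = (\<integral>\<^sup>+h. \<integral>\<^sup>+s. \<integral>\<^sup>+x. g h s * W (x + s *\<^sub>R h) \<partial>lborel \<partial>lborel \<partial>lborel)"
    by (intro nn_integral_cong lborel_pair.Fubini') measurable
  also have "\<dots> = (\<integral>\<^sup>+h. \<integral>\<^sup>+s. g h s * (\<integral>\<^sup>+x. W x \<partial>lborel) \<partial>lborel \<partial>lborel)"
  proof (intro nn_integral_cong)
    fix h :: 'a and s :: real
    have "(\<integral>\<^sup>+x. g h s * W (x + s *\<^sub>R h) \<partial>lborel) = g h s * (\<integral>\<^sup>+x. W (x + s *\<^sub>R h) \<partial>lborel)"
      by (rule nn_integral_cmult) measurable
    then show "(\<integral>\<^sup>+x. g h s * W (x + s *\<^sub>R h) \<partial>lborel) = g h s * (\<integral>\<^sup>+x. W x \<partial>lborel)"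
      by (simp add: nn_integral_lborel_translate)
  qed
  also have "\<dots> = (\<integral>\<^sup>+h. (indicator B h * ennreal R) * (\<integral>\<^sup>+x. W x \<partial>lborel) \<partial>lborel)"
  proof (intro nn_integral_cong)
    fix h :: 'a
    have "(\<integral>\<^sup>+s. g h s * (\<integral>\<^sup>+x. W x \<partial>lborel) \<partial>lborel) = (\<integral>\<^sup>+s. ((indicator B h * ennreal R) * (\<integral>\<^sup>+x. W x \<partial>lborel)) * indicator {0..1::real} s \<partial>lborel)"
      by (intro nn_integral_cong) (simp add: g_def mult_ac)
    also have "\<dots> = ((indicator B h * ennreal R) * (\<integral>\<^sup>+x. W x \<partial>lborel)) * emeasure lborel {0..1::real}"
      by (rule nn_integral_cmult_indicator) simp
    finally show "(\<integral>\<^sup>+s. g h s * (\<integral>\<^sup>+x. W x \<partial>lborel) \<partial>lborel) = (indicator B h * ennreal R) * (\<integral>\<^sup>+x. W x \<partial>lborel)"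
      by simp
  qed
  also have "\<dots> = (\<integral>\<^sup>+h. (ennreal R * (\<integral>\<^sup>+x. W x \<partial>lborel)) * indicator B h \<partial>lborel)"
    by (intro nn_integral_cong) (simp add: mult_ac)
  also have "\<dots> = (ennreal R * (\<integral>\<^sup>+x. W x \<partial>lborel)) * emeasure lborel B"
    by (rule nn_integral_cmult_indicator) simp
  finally show ?thesis by (simp add: W_def mult_ac)
qed

lemma nn_integral_lebesgue_on_lborel:
  assumes "H \<in> sets borel"
  shows "(\<integral>\<^sup>+x. f x \<partial>lebesgue_on H) = (\<integral>\<^sup>+x. indicator H x * f x \<partial>lborel)"
proof -
  have "(\<integral>\<^sup>+x. f x \<partial>lebesgue_on H) = (\<integral>\<^sup>+x. f x * indicator H x \<partial>lebesgue)"
    using assms by (intro nn_integral_restrict_space) auto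
  then show ?thesis by (simp add: nn_integral_completion mult.commute)
qed

text \<open>The deviation of \<open>v x\<close> from the mean is at most the average of
  \<open>\<bar>v y - v x\<bar>\<close> over \<open>y\<close>; integrating over \<open>x\<close>
  leads to the double integral of \<open>nn_integral_difference_convex\<close>.\<close>

lemma poincare_convex_C1:
  fixes v :: "'a::euclidean_space \<Rightarrow> real" and V :: "'a \<Rightarrow> 'a"
  assumes V: "continuous_on UNIV V" "continuous_on UNIV v" and v: "\<And>x. x \<in> H \<Longrightarrow> (v has_derivative (\<lambda>h. V x \<bullet> h)) (at x)"
    and H: "convex H" "H \<in> sets borel" "H \<subseteq> C" "compact C" and B: "\<And>x y. x \<in> H \<Longrightarrow> y \<in> H \<Longrightarrow> y - x \<in> B" "B \<in> sets borel"
    and R: "\<And>h. h \<in> B \<Longrightarrow> norm h \<le> R" "0 \<le> R" and \<mu>: "emeasure lborel H = ennreal \<mu>" "0 < \<mu>"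
  shows "(\<integral>\<^sup>+x. ennreal \<bar>v x - (LINT y|lebesgue_on H. v y) / \<mu>\<bar> \<partial>lebesgue_on H) \<le>
     (ennreal R * emeasure lborel B / ennreal \<mu>) * (\<integral>\<^sup>+x. ennreal (norm (V x)) \<partial>lebesgue_on H)"
proof -
  note H(2)[measurable]
  have [measurable]: "v \<in> borel_measurable borel" using V by (auto intro: borel_measurable_continuous_onI)
  define a where "a = (LINT y|lebesgue_on H. v y) / \<mu>"
  have iC: "integrable lborel (\<lambda>y. indicator C y *\<^sub>R v y)"
    using H V by (intro borel_integrable_compact continuous_on_subset[OF V(2)]) auto
  have iv: "integrable lborel (\<lambda>y. indicator H y * v y)"
    by (rule Bochner_Integration.integrable_bound[OF iC]) (use H(3) in \<open>auto simp: indicator_def\<close>)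
  have i1: "integrable lborel (indicator H :: 'a \<Rightarrow> real)" using \<mu> by (simp add: integrable_indicator_iff)
  have mH: "measure lborel H = \<mu>" using \<mu> by (simp add: measure_def)
  have "(LINT y|lebesgue_on H. v y) = (LINT y|lebesgue. indicator H y *\<^sub>R v y)"
    by (intro integral_restrict_space) simp
  also have "\<dots> = (\<integral>y. indicator H y * v y \<partial>lborel)" by (subst integral_completion) auto
  finally have a: "\<mu> * a = (\<integral>y. indicator H y * v y \<partial>lborel)" using \<mu>(2) by (simp add: a_def)
  have pt: "ennreal \<mu> * (indicator H x * ennreal \<bar>v x - a\<bar>) \<le> (\<integral>\<^sup>+y. indicator H x * (indicator H y * ennreal \<bar>v y - v x\<bar>) \<partial>lborel)" for x
  proof (cases "x \<in> H")
    case True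
    have i2: "integrable lborel (\<lambda>y. indicator H y * v y - indicator H y * v x)"
      using iv i1 by (intro Bochner_Integration.integrable_diff integrable_mult_left) auto
    have "\<mu> * a - \<mu> * v x = (\<integral>y. indicator H y * v y - indicator H y * v x \<partial>lborel)"
      using iv i1 mH by (subst Bochner_Integration.integral_diff) (auto simp: a)
    then have "ennreal (norm (\<mu> * a - \<mu> * v x)) \<le> (\<integral>\<^sup>+y. norm (indicator H y * v y - indicator H y * v x) \<partial>lborel)"
      using integral_norm_bound_ennreal[OF i2] by simp
    also have "(\<integral>\<^sup>+y. norm (indicator H y * v y - indicator H y * v x) \<partial>lborel) = (\<integral>\<^sup>+y. indicator H x * (indicator H y * ennreal \<bar>v y - v x\<bar>) \<partial>lborel)"
      using True by (intro nn_integral_cong) (auto simp: indicator_def)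
    also have "norm (\<mu> * a - \<mu> * v x) = \<mu> * \<bar>v x - a\<bar>"
      using \<mu>(2) by (simp add: right_diff_distrib[symmetric] abs_mult abs_minus_commute)
    finally show ?thesis using True \<mu>(2) by (simp add: ennreal_mult)
  qed simp
  have "ennreal \<mu> * (\<integral>\<^sup>+x. ennreal \<bar>v x - a\<bar> \<partial>lebesgue_on H) = (\<integral>\<^sup>+x. ennreal \<mu> * (indicator H x * ennreal \<bar>v x - a\<bar>) \<partial>lborel)"
    unfolding nn_integral_lebesgue_on_lborel[OF H(2)] by (rule nn_integral_cmult[symmetric]) measurable
  also have "\<dots> \<le> (\<integral>\<^sup>+x. \<integral>\<^sup>+y. indicator H x * (indicator H y * ennreal \<bar>v y - v x\<bar>) \<partial>lborel \<partial>lborel)"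
    by (rule nn_integral_mono) (rule pt)
  also have "\<dots> \<le> (ennreal R * emeasure lborel B) * (\<integral>\<^sup>+x. ennreal (norm (V x)) \<partial>lebesgue_on H)"
    unfolding nn_integral_lebesgue_on_lborel[OF H(2)]
    by (rule nn_integral_difference_convex[OF V v H(1,2) B R])
  finally have "ennreal \<mu> * (\<integral>\<^sup>+x. ennreal \<bar>v x - a\<bar> \<partial>lebesgue_on H) / ennreal \<mu> \<le> (ennreal R * emeasure lborel B) * (\<integral>\<^sup>+x. ennreal (norm (V x)) \<partial>lebesgue_on H) / ennreal \<mu>"
    by (rule divide_right_mono_ennreal)
  then show ?thesis
    using \<mu>(2) unfolding a_def[symmetric]
    by (simp add: ennreal_times_divide ennreal_divide_times mult_divide_eq_ennreal mult.commute[of "ennreal \<mu>"])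
qed

lemma poincare_convex:
  fixes u :: "'a::euclidean_space \<Rightarrow> real"
  assumes wg: "has_weak_gradient_on u G D" and D: "open D"
    and H: "convex H" "H \<in> sets borel" "H \<subseteq> C" "compact C" "C \<subseteq> D" and B: "\<And>x y. x \<in> H \<Longrightarrow> y \<in> H \<Longrightarrow> y - x \<in> B" "B \<in> sets borel"
    and R: "\<And>h. h \<in> B \<Longrightarrow> norm h \<le> R" "0 \<le> R" and \<mu>: "emeasure lborel H = ennreal \<mu>" "0 < \<mu>"
    and c: "ennreal R * emeasure lborel B / ennreal \<mu> = ennreal c" "0 \<le> c"
  shows "(\<integral>\<^sup>+x. ennreal \<bar>u x - (LINT y|lebesgue_on H. u y) / \<mu>\<bar> \<partial>lebesgue_on H) \<le>
     ennreal c * (\<integral>\<^sup>+x. ennreal (norm (G x)) \<partial>lebesgue_on H)"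
proof (rule ennreal_le_epsilon)
  fix e :: real assume e: "0 < e"
  \<comment> \<open>Replacing \<open>u\<close> by \<open>v\<close> costs \<open>d\<close>, replacing
    the gradient \<open>c * d\<close>, and replacing the mean another \<open>d\<close>.\<close>
  define d where "d = e / (2 + c)"
  have "d + c * d + d = (2 + c) * d" by (simp add: algebra_simps)
  then have d: "0 < d" "d + c * d + d = e" using e c(2) by (auto simp: d_def)
  obtain v V U where U: "open U" "C \<subseteq> U" "U \<subseteq> D" and V: "continuous_on UNIV V" "continuous_on UNIV v"
    and v: "\<And>x. x \<in> U \<Longrightarrow> (v has_derivative (\<lambda>h. V x \<bullet> h)) (at x)"
    and ve: "(\<integral>\<^sup>+x. ennreal \<bar>v x - u x\<bar> \<partial>lebesgue_on C) \<le> ennreal d"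
    and Ve: "(\<integral>\<^sup>+x. ennreal (norm (V x - G x)) \<partial>lebesgue_on C) \<le> ennreal d"
    by (rule weak_gradient_C1_approx[OF wg D H(4,5) d(1)]) (rule that)
  have Cb: "C \<in> sets borel" using H(4) by (simp add: compact_imp_closed)
  have sub: "(\<integral>\<^sup>+x. f x \<partial>lebesgue_on H) \<le> (\<integral>\<^sup>+x. f x \<partial>lebesgue_on C)" for f
    unfolding nn_integral_lebesgue_on_lborel[OF H(2)] nn_integral_lebesgue_on_lborel[OF Cb]
    using H(3) by (intro nn_integral_mono) (auto simp: indicator_def)
  have um: "integrable (lebesgue_on H) u" "G \<in> borel_measurable (lebesgue_on H)"
  proof -
    have "set_integrable lebesgue C u" "set_integrable lebesgue C G"
      using wg H by (auto simp: has_weak_gradient_on_def locally_summable_on_def)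
    then have "set_integrable lebesgue H u" "set_integrable lebesgue H G"
      using H(2,3) by (auto intro: set_integrable_subset)
    then have "integrable (lebesgue_on H) u" "integrable (lebesgue_on H) G"
      using H(2) by (auto simp: integrable_restrict_space set_integrable_def)
    then show "integrable (lebesgue_on H) u" "G \<in> borel_measurable (lebesgue_on H)" by auto
  qed
  have vm: "integrable (lebesgue_on H) v"
  proof -
    have "set_integrable lebesgue C v"
      using continuous_locally_summable[OF V(2)] H(4) by (auto simp: locally_summable_on_def)
    then have "set_integrable lebesgue H v"
      using H(2,3) by (auto intro: set_integrable_subset)
    then show ?thesis using H(2) by (auto simp: integrable_restrict_space set_integrable_def)
  qed
  have [measurable]: "u \<in> borel_measurable (lebesgue_on H)" "v \<in> borel_measurable (lebesgue_on H)"
    "V \<in> borel_measurable (lebesgue_on H)" "G \<in> borel_measurable (lebesgue_on H)"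
    using um vm V by (auto intro: borel_measurable_lebesgue_on borel_measurable_continuous_onI)
  let ?a = "(LINT y|lebesgue_on H. u y) / \<mu>" and ?b = "(LINT y|lebesgue_on H. v y) / \<mu>"
  have uv: "(\<integral>\<^sup>+x. ennreal \<bar>v x - u x\<bar> \<partial>lebesgue_on H) \<le> ennreal d" using sub ve by (rule order_trans)
  have ab: "\<mu> * \<bar>?b - ?a\<bar> \<le> d"
  proof -
    have "ennreal (norm (LINT x|lebesgue_on H. v x - u x)) \<le> (\<integral>\<^sup>+x. ennreal (norm (v x - u x)) \<partial>lebesgue_on H)"
      using um vm by (intro integral_norm_bound_ennreal) auto
    also have "\<dots> \<le> ennreal d" using uv by simp
    finally have "\<bar>LINT x|lebesgue_on H. v x - u x\<bar> \<le> d" using d by simp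
    moreover have "\<mu> * \<bar>?b - ?a\<bar> = \<bar>LINT x|lebesgue_on H. v x - u x\<bar>"
      using um vm \<mu>(2) by (simp add: diff_divide_distrib[symmetric])
    ultimately show ?thesis by simp
  qed
  have "(\<integral>\<^sup>+x. ennreal \<bar>u x - ?a\<bar> \<partial>lebesgue_on H) \<le> (\<integral>\<^sup>+x. ennreal \<bar>v x - u x\<bar> + ennreal \<bar>v x - ?b\<bar> + ennreal \<bar>?b - ?a\<bar> \<partial>lebesgue_on H)"
    by (intro nn_integral_mono) (simp flip: ennreal_plus)
  also have "\<dots> = (\<integral>\<^sup>+x. ennreal \<bar>v x - u x\<bar> \<partial>lebesgue_on H) + (\<integral>\<^sup>+x. ennreal \<bar>v x - ?b\<bar> \<partial>lebesgue_on H) + (\<integral>\<^sup>+x. ennreal \<bar>?b - ?a\<bar> \<partial>lebesgue_on H)"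
    by (subst nn_integral_add; (subst nn_integral_add)?) measurable
  also have "\<dots> \<le> ennreal d + ennreal c * ((\<integral>\<^sup>+x. ennreal (norm (G x)) \<partial>lebesgue_on H) + ennreal d) + ennreal d"
  proof (intro add_mono uv)
    have "(\<integral>\<^sup>+x. ennreal \<bar>v x - ?b\<bar> \<partial>lebesgue_on H) \<le> (ennreal R * emeasure lborel B / ennreal \<mu>) * (\<integral>\<^sup>+x. ennreal (norm (V x)) \<partial>lebesgue_on H)"
      by (rule poincare_convex_C1[OF V v H(1,2,3,4) B R \<mu>]) (use H U in auto)
    also have "\<dots> \<le> ennreal c * ((\<integral>\<^sup>+x. ennreal (norm (G x)) \<partial>lebesgue_on H) + ennreal d)"
      unfolding c(1)
    proof (rule mult_left_mono)
      have "(\<integral>\<^sup>+x. ennreal (norm (V x)) \<partial>lebesgue_on H) \<le> (\<integral>\<^sup>+x. ennreal (norm (G x)) + ennreal (norm (V x - G x)) \<partial>lebesgue_on H)"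
        by (intro nn_integral_mono) (simp add: norm_triangle_sub flip: ennreal_plus)
      also have "\<dots> = (\<integral>\<^sup>+x. ennreal (norm (G x)) \<partial>lebesgue_on H) + (\<integral>\<^sup>+x. ennreal (norm (V x - G x)) \<partial>lebesgue_on H)"
        by (rule nn_integral_add) measurable
      also have "\<dots> \<le> (\<integral>\<^sup>+x. ennreal (norm (G x)) \<partial>lebesgue_on H) + ennreal d"
        using order_trans[OF sub Ve] by (rule add_left_mono)
      finally show "(\<integral>\<^sup>+x. ennreal (norm (V x)) \<partial>lebesgue_on H) \<le> (\<integral>\<^sup>+x. ennreal (norm (G x)) \<partial>lebesgue_on H) + ennreal d" .
    qed simp
    finally show "(\<integral>\<^sup>+x. ennreal \<bar>v x - ?b\<bar> \<partial>lebesgue_on H) \<le> ennreal c * ((\<integral>\<^sup>+x. ennreal (norm (G x)) \<partial>lebesgue_on H) + ennreal d)" .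
    have "emeasure (lebesgue_on H) H = ennreal \<mu>"
      using H(2) \<mu>(1) by (simp add: emeasure_restrict_space)
    then have "(\<integral>\<^sup>+x. ennreal \<bar>?b - ?a\<bar> \<partial>lebesgue_on H) = ennreal (\<mu> * \<bar>?b - ?a\<bar>)"
      using \<mu>(2) by (simp add: ennreal_mult mult.commute)
    also have "\<dots> \<le> ennreal d" using ab by (rule ennreal_leI)
    finally show "(\<integral>\<^sup>+x. ennreal \<bar>?b - ?a\<bar> \<partial>lebesgue_on H) \<le> ennreal d" .
  qed
  also have "\<dots> = ennreal c * (\<integral>\<^sup>+x. ennreal (norm (G x)) \<partial>lebesgue_on H) + (ennreal d + ennreal c * ennreal d + ennreal d)"
    by (simp add: distrib_left add_ac)
  also have "ennreal d + ennreal c * ennreal d + ennreal d = ennreal e"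
    using d c(2) by (simp add: ennreal_mult[symmetric] flip: ennreal_plus)
  finally show "(\<integral>\<^sup>+x. ennreal \<bar>u x - ?a\<bar> \<partial>lebesgue_on H) \<le> ennreal c * (\<integral>\<^sup>+x. ennreal (norm (G x)) \<partial>lebesgue_on H) + ennreal e" .
qed

section \<open>Lattice cells\<close>

text \<open>Half-open cubes of side \<open>1 / N\<close>: taking floors makes them disjoint and
  exhaustive. Only the values of the index on \<open>Basis\<close> matter, so families of cells are
  later indexed by extensional functions.\<close>

definition cell :: "nat \<Rightarrow> ('a::euclidean_space \<Rightarrow> int) \<Rightarrow> 'a set" where
  "cell N f = {x. \<forall>b\<in>Basis. \<lfloor>real N * (x \<bullet> b)\<rfloor> = f b}"

definition cell_corner :: "nat \<Rightarrow> ('a::euclidean_space \<Rightarrow> int) \<Rightarrow> 'a" where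
  "cell_corner N f = (\<Sum>b\<in>Basis. (real_of_int (f b) / real N) *\<^sub>R b)"

definition cell_cbox :: "nat \<Rightarrow> ('a::euclidean_space \<Rightarrow> int) \<Rightarrow> 'a set" where
  "cell_cbox N f = cbox (cell_corner N f) (cell_corner N f + (1 / real N) *\<^sub>R One)"

lemma cell_corner_inner: "b \<in> Basis \<Longrightarrow> cell_corner N f \<bullet> b = real_of_int (f b) / real N"
  by (simp add: cell_corner_def inner_sum_left_Basis)

lemma cell_INT:
  "cell N f = (\<Inter>b\<in>Basis. {x. real_of_int (f b) \<le> (real N *\<^sub>R b) \<bullet> x} \<inter> {x. (real N *\<^sub>R b) \<bullet> x < real_of_int (f b) + 1})"
  by (auto simp: cell_def floor_eq_iff inner_commute)

lemma convex_cell: "convex (cell N f)"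
  unfolding cell_INT by (intro convex_INT convex_Int convex_halfspace_ge convex_halfspace_lt)

lemma borel_cell [measurable]: "cell N f \<in> sets borel"
  unfolding cell_INT
  by (intro sets.finite_INT sets.Int borel_closed borel_open closed_halfspace_ge open_halfspace_lt) auto

lemma cell_subset_cbox: "0 < N \<Longrightarrow> cell N f \<subseteq> cell_cbox N f"
  by (auto simp: cell_def cell_cbox_def mem_box cell_corner_inner inner_add_left floor_eq_iff field_simps less_imp_le)

lemma box_subset_cell: "0 < N \<Longrightarrow> box (cell_corner N f) (cell_corner N f + (1 / real N) *\<^sub>R One) \<subseteq> cell N f"
  by (auto simp: cell_def mem_box cell_corner_inner inner_add_left floor_eq_iff field_simps less_imp_le)

lemma emeasure_cell:
  assumes "0 < N"
  shows "emeasure lborel (cell N (f :: 'a::euclidean_space \<Rightarrow> int)) = ennreal ((1 / real N) ^ DIM('a))"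
proof (rule antisym)
  let ?p = "cell_corner N f" and ?q = "cell_corner N f + (1 / real N) *\<^sub>R (One :: 'a)"
  have pq: "?p \<bullet> b \<le> ?q \<bullet> b" if "b \<in> Basis" for b using that by (simp add: inner_add_left)
  have "(\<Prod>b\<in>Basis. (?q - ?p) \<bullet> b) = (1 / real N) ^ DIM('a)" by simp
  then have e: "emeasure lborel (cbox ?p ?q) = ennreal ((1 / real N) ^ DIM('a))" "emeasure lborel (box ?p ?q) = ennreal ((1 / real N) ^ DIM('a))"
    using pq by (simp_all add: emeasure_lborel_cbox_eq emeasure_lborel_box_eq)
  show "emeasure lborel (cell N f) \<le> ennreal ((1 / real N) ^ DIM('a))"
    unfolding e(1)[symmetric] using cell_subset_cbox[OF assms, of f] by (intro emeasure_mono) (auto simp: cell_cbox_def)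
  show "ennreal ((1 / real N) ^ DIM('a)) \<le> emeasure lborel (cell N f)"
    unfolding e(2)[symmetric] using box_subset_cell[OF assms, of f] by (intro emeasure_mono) auto
qed

text \<open>Differences of points of a cell fill a cube of \<open>2 ^ DIM('a)\<close> times its
  volume and have norm at most \<open>DIM('a) / N\<close>. The resulting constant tends to 0 as
  \<open>N\<close> grows.\<close>

lemma poincare_cell:
  fixes u :: "'a::euclidean_space \<Rightarrow> real"
  assumes wg: "has_weak_gradient_on u G D" and D: "open D" and N: "0 < N" and f: "cell_cbox N f \<subseteq> D"
  shows "(\<integral>\<^sup>+x. ennreal \<bar>u x - (LINT y|lebesgue_on (cell N f). u y) / (1 / real N) ^ DIM('a)\<bar> \<partial>lebesgue_on (cell N f)) \<le>
     ennreal (real DIM('a) * 2 ^ DIM('a) / real N) * (\<integral>\<^sup>+x. ennreal (norm (G x)) \<partial>lebesgue_on (cell N f))"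
proof (rule poincare_convex[OF wg D convex_cell borel_cell cell_subset_cbox[OF N] _ f])
  let ?B = "cbox (- (1 / real N) *\<^sub>R One) ((1 / real N) *\<^sub>R One :: 'a)"
  show "compact (cell_cbox N f)" by (simp add: cell_cbox_def)
  show "y - x \<in> ?B" if "x \<in> cell N f" "y \<in> cell N f" for x y
    unfolding mem_box
  proof
    fix b :: 'a assume b: "b \<in> Basis"
    have "real_of_int (f b) \<le> real N * (x \<bullet> b)" "real N * (x \<bullet> b) < real_of_int (f b) + 1"
      "real_of_int (f b) \<le> real N * (y \<bullet> b)" "real N * (y \<bullet> b) < real_of_int (f b) + 1"
      using that b by (auto simp: cell_def floor_eq_iff)
    then have "- 1 \<le> real N * ((y - x) \<bullet> b)" "real N * ((y - x) \<bullet> b) \<le> 1"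
      by (auto simp: inner_diff_left right_diff_distrib)
    then show "(- (1 / real N) *\<^sub>R One) \<bullet> b \<le> (y - x) \<bullet> b \<and> (y - x) \<bullet> b \<le> ((1 / real N) *\<^sub>R One) \<bullet> b"
      using N b by (simp add: field_simps)
  qed
  show "?B \<in> sets borel" by simp
  show "norm h \<le> real DIM('a) / real N" if "h \<in> ?B" for h
  proof -
    have "norm h \<le> (\<Sum>b\<in>Basis. \<bar>h \<bullet> b\<bar>)" by (rule norm_le_l1)
    also have "\<dots> \<le> (\<Sum>b\<in>(Basis :: 'a set). 1 / real N)"
      using that by (intro sum_mono) (auto simp: mem_box abs_le_iff)
    finally show ?thesis by simp
  qed
  show "emeasure lborel (cell N f) = ennreal ((1 / real N) ^ DIM('a))" by (rule emeasure_cell[OF N])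
  have "emeasure lborel ?B = ennreal ((2 / real N) ^ DIM('a))"
  proof -
    have "(\<Prod>b\<in>(Basis :: 'a set). ((1 / real N) *\<^sub>R One - (- (1 / real N) *\<^sub>R One)) \<bullet> b) = (\<Prod>b\<in>(Basis :: 'a set). 2 / real N)"
      by (intro prod.cong) (auto simp: inner_diff_left inner_add_left)
    moreover have "emeasure lborel ?B = (\<Prod>b\<in>(Basis :: 'a set). ((1 / real N) *\<^sub>R One - (- (1 / real N) *\<^sub>R One)) \<bullet> b)"
      by (rule emeasure_lborel_cbox) simp
    ultimately show ?thesis by (simp only: prod_constant)
  qed
  moreover have "real DIM('a) / real N * (2 / real N) ^ DIM('a) / (1 / real N) ^ DIM('a) = real DIM('a) * 2 ^ DIM('a) / real N"
    using N by (simp add: power_divide)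
  ultimately show "ennreal (real DIM('a) / real N) * emeasure lborel ?B / ennreal ((1 / real N) ^ DIM('a)) = ennreal (real DIM('a) * 2 ^ DIM('a) / real N)"
    using N by (simp add: ennreal_mult[symmetric] divide_ennreal)
qed (use N in auto)

lemma nn_integral_lebesgue_on_subset:
  assumes "H \<in> sets lebesgue" "D \<in> sets lebesgue" "H \<subseteq> D"
  shows "(\<integral>\<^sup>+x. g x \<partial>lebesgue_on H) = (\<integral>\<^sup>+x. g x * indicator H x \<partial>lebesgue_on D)"
  using assms by (simp add: nn_integral_restrict_space mult.assoc indicator_inter_arith[symmetric] Int_absorb2)

lemma finite_measure_compact_approx:
  fixes D :: "'a::euclidean_space set"
  assumes D: "open D" "emeasure lebesgue D < \<infinity>" and d: "0 < (d::real)"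
  obtains K where "compact K" "K \<subseteq> D" "emeasure lebesgue (D - K) < ennreal d"
proof -
  obtain C where C: "\<And>n::nat. compact (C n)" "\<And>n. C n \<subseteq> D" "\<And>n. C n \<subseteq> interior (C (Suc n))" "(\<Union>n. C n) = D"
    using open_Union_compact_subsets[OF D(1)] by metis
  have "(\<lambda>n. emeasure lebesgue (D - C n)) \<longlonglongrightarrow> emeasure lebesgue (\<Inter>n. D - C n)"
  proof (rule Lim_emeasure_decseq)
    show "range (\<lambda>n. D - C n) \<subseteq> sets lebesgue" using C(1) D(1) by (auto simp: compact_imp_closed)
    show "decseq (\<lambda>n. D - C n)"
      using C(3) interior_subset by (intro decseq_SucI) blast
    show "emeasure lebesgue (D - C n) \<noteq> \<infinity>" for n
    proof -
      have "emeasure lebesgue (D - C n) \<le> emeasure lebesgue D" using D(1) by (intro emeasure_mono) auto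
      then show ?thesis using D(2) by (auto simp: top_unique)
    qed
  qed
  moreover have "(\<Inter>n. D - C n) = {}" using C(4) by auto
  ultimately have "(\<lambda>n. emeasure lebesgue (D - C n)) \<longlonglongrightarrow> 0" by (simp only: emeasure_empty)
  then have "\<forall>\<^sub>F n in sequentially. emeasure lebesgue (D - C n) < ennreal d"
    using d by (intro order_tendstoD) auto
  then obtain n where "emeasure lebesgue (D - C n) < ennreal d"
    by (auto simp: eventually_sequentially)
  then show ?thesis using that C by blast
qed

text \<open>Two points of a closed cell are at distance at most \<open>DIM('a) / N\<close>, so a
  cell that meets \<open>K\<close> stays inside the margin \<open>\<delta>\<close>. Boundedness of
  \<open>K\<close> leaves finitely many indices.\<close>

lemma cells_meeting_compact:
  fixes K :: "'a::euclidean_space set"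
  assumes K: "compact K" and N: "0 < N" and \<delta>: "real DIM('a) / real N \<le> \<delta>" and D: "\<And>x. x \<in> K \<Longrightarrow> cball x \<delta> \<subseteq> D"
  obtains F where "finite F" "F \<subseteq> Basis \<rightarrow>\<^sub>E UNIV" "\<And>f. f \<in> F \<Longrightarrow> cell_cbox N f \<subseteq> D" "K \<subseteq> (\<Union>f\<in>F. cell N f)"
proof -
  define F :: "('a \<Rightarrow> int) set" where "F = {f \<in> Basis \<rightarrow>\<^sub>E UNIV. cell N f \<inter> K \<noteq> {}}"
  obtain M where M: "\<And>x. x \<in> K \<Longrightarrow> norm x \<le> M" using compact_imp_bounded[OF K] by (auto simp: bounded_iff)
  have "F \<subseteq> Basis \<rightarrow>\<^sub>E {\<lfloor>real N * (- M)\<rfloor>..\<lfloor>real N * M\<rfloor>}"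
  proof
    fix f assume "f \<in> F"
    then obtain x where f: "f \<in> Basis \<rightarrow>\<^sub>E UNIV" and x: "x \<in> K" "x \<in> cell N f" by (auto simp: F_def)
    have "f b \<in> {\<lfloor>real N * (- M)\<rfloor>..\<lfloor>real N * M\<rfloor>}" if b: "b \<in> Basis" for b
    proof -
      have "\<bar>x \<bullet> b\<bar> \<le> M" using Basis_le_norm[OF b, of x] M[OF x(1)] by simp
      then have "- M \<le> x \<bullet> b" "x \<bullet> b \<le> M" by auto
      then have "real N * (- M) \<le> real N * (x \<bullet> b)" "real N * (x \<bullet> b) \<le> real N * M"
        using mult_left_mono[of "- M" "x \<bullet> b" "real N"] mult_left_mono[of "x \<bullet> b" M "real N"] by auto
      moreover have "f b = \<lfloor>real N * (x \<bullet> b)\<rfloor>" using x(2) b by (simp add: cell_def)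
      ultimately show ?thesis by (simp add: floor_mono)
    qed
    with f show "f \<in> Basis \<rightarrow>\<^sub>E {\<lfloor>real N * (- M)\<rfloor>..\<lfloor>real N * M\<rfloor>}" by (auto simp: PiE_iff)
  qed
  then have 1: "finite F" by (rule finite_subset) (intro finite_PiE, auto)
  have 3: "cell_cbox N f \<subseteq> D" if fF: "f \<in> F" for f
  proof
    fix y assume y: "y \<in> cell_cbox N f"
    obtain x where x: "x \<in> K" "x \<in> cell_cbox N f" using fF cell_subset_cbox[OF N, of f] by (auto simp: F_def)
    have "norm (y - x) \<le> (\<Sum>b\<in>Basis. \<bar>(y - x) \<bullet> b\<bar>)" by (rule norm_le_l1)
    also have "\<dots> \<le> (\<Sum>b\<in>(Basis :: 'a set). 1 / real N)"
    proof (rule sum_mono)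
      fix b :: 'a assume "b \<in> Basis"
      then show "\<bar>(y - x) \<bullet> b\<bar> \<le> 1 / real N"
        using x(2) y by (auto simp: cell_cbox_def mem_box inner_add_left inner_diff_left abs_le_iff cell_corner_inner dest!: bspec)
    qed
    finally have "y \<in> cball x \<delta>" using \<delta> by (simp add: dist_norm norm_minus_commute)
    then show "y \<in> D" using D[OF x(1)] by blast
  qed
  have 4: "K \<subseteq> (\<Union>f\<in>F. cell N f)"
  proof
    fix x assume x: "x \<in> K"
    define f where "f = restrict (\<lambda>b. \<lfloor>real N * (x \<bullet> b)\<rfloor>) Basis"
    have "x \<in> cell N f" by (simp add: cell_def f_def)
    moreover have "f \<in> F" using x calculation by (auto simp: F_def f_def)
    ultimately show "x \<in> (\<Union>f\<in>F. cell N f)" by blast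
  qed
  have "F \<subseteq> Basis \<rightarrow>\<^sub>E UNIV" by (auto simp: F_def)
  with 1 3 4 show ?thesis using that by blast
qed

lemma sum_indicator_cells:
  assumes "finite F" "F \<subseteq> Basis \<rightarrow>\<^sub>E UNIV"
  shows "(\<Sum>f\<in>F. indicator (cell N f) x :: ennreal) = indicator (\<Union>f\<in>F. cell N f) x"
proof -
  have "disjoint_family_on (cell N) F"
    unfolding disjoint_family_on_def
  proof (intro ballI impI)
    fix f g assume fg: "f \<in> F" "g \<in> F" "f \<noteq> g"
    show "cell N f \<inter> cell N g = {}"
    proof (rule ccontr)
      assume "cell N f \<inter> cell N g \<noteq> {}"
      then have "\<forall>b\<in>Basis. f b = g b" by (auto simp: cell_def)
      then show False using fg assms(2) by (metis PiE_ext subsetD)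
    qed
  qed
  then show ?thesis using assms(1) by (simp add: indicator_UN_disjoint)
qed

lemma diagonal_convergent:
  fixes \<alpha> :: "nat \<Rightarrow> nat \<Rightarrow> real"
  assumes "\<And>n k. \<bar>\<alpha> n k\<bar> \<le> A"
  obtains \<sigma> where "strict_mono \<sigma>" "\<And>n. convergent (\<lambda>k. \<alpha> n (\<sigma> k))"
proof -
  define P where "P n s \<longleftrightarrow> convergent (\<lambda>k. \<alpha> n (s k))" for n and s :: "nat \<Rightarrow> nat"
  interpret subseqs P
  proof
    fix n and s :: "nat \<Rightarrow> nat"
    have "bounded (range (\<lambda>k. \<alpha> n (s k)))" using assms by (auto simp: bounded_iff)
    then obtain l r where "strict_mono r" "((\<lambda>k. \<alpha> n (s k)) \<circ> r) \<longlonglongrightarrow> l"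
      using bounded_imp_convergent_subsequence by blast
    then show "\<exists>r'. strict_mono r' \<and> P n (s \<circ> r')" by (auto simp: P_def comp_def convergent_def)
  qed
  \<comment> \<open>Only the tail of the diagonal sequence beyond \<open>n\<close> is a subsequence
    of the \<open>n\<close>-th one, which suffices for convergence.\<close>
  have "P n (diagseq \<circ> (+) (Suc n))" for n
  proof (rule diagseq_holds)
    fix r s :: "nat \<Rightarrow> nat" and n assume "strict_mono r" "P n s"
    then show "P n (s \<circ> r)"
      unfolding P_def convergent_def using LIMSEQ_subseq_LIMSEQ[of "\<lambda>k. \<alpha> n (s k)" _ r] by (auto simp: comp_def)
  qed
  then have "convergent (\<lambda>k. \<alpha> n (diagseq (k + Suc n)))" for n
    unfolding P_def comp_def add.commute[of _ "Suc n"] .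
  then have "convergent (\<lambda>k. \<alpha> n (diagseq k))" for n
    by (rule convergent_ignore_initial_segment[THEN iffD1])
  with subseq_diagseq show ?thesis by (rule that)
qed

text \<open>Along a diagonal subsequence the means over all lattice cells inside \<open>D\<close> converge; by the
  Poincare inequality these means determine the functions up to a small error in \<open>L\<^sub>1\<close>.\<close>

lemma rellich_L1:
  fixes v :: "nat \<Rightarrow> 'a::euclidean_space \<Rightarrow> real"
  assumes D: "open D" "emeasure lebesgue D < \<infinity>" and wg: "\<And>k. has_weak_gradient_on (v k) (\<Gamma> k) D" and A0: "0 \<le> A"
    and A: "\<And>k. (\<integral>\<^sup>+x. ennreal \<bar>v k x\<bar> \<partial>lebesgue_on D) \<le> ennreal A" "\<And>k. (\<integral>\<^sup>+x. ennreal (norm (\<Gamma> k x)) \<partial>lebesgue_on D) \<le> ennreal A"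
    and ui: "\<And>e::real. 0 < e \<Longrightarrow> \<exists>d>0. \<forall>k. \<forall>S\<in>sets lebesgue. S \<subseteq> D \<and> emeasure lebesgue S < ennreal d \<longrightarrow>
       (\<integral>\<^sup>+x. ennreal \<bar>v k x\<bar> * indicator S x \<partial>lebesgue_on D) \<le> ennreal e"
  obtains \<sigma> :: "nat \<Rightarrow> nat" where "strict_mono \<sigma>"
    "\<And>e::real. 0 < e \<Longrightarrow> \<exists>K. \<forall>m\<ge>K. \<forall>n\<ge>K. (\<integral>\<^sup>+x. ennreal \<bar>v (\<sigma> m) x - v (\<sigma> n) x\<bar> \<partial>lebesgue_on D) \<le> ennreal e"
proof -
  have Ds [simp]: "D \<in> sets lebesgue" using D by simp
  have vm [measurable]: "v k \<in> borel_measurable (lebesgue_on D)" and Gm [measurable]: "\<Gamma> k \<in> borel_measurable (lebesgue_on D)" for k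
    using wg[of k] D(1) by (auto simp: has_weak_gradient_on_def intro: locally_summable_measurable)
  have cs: "cell N f \<in> sets lebesgue" for N and f :: "'a \<Rightarrow> int"
    using borel_cell[of N f] by simp
  define a where "a i k = (LINT y|lebesgue_on (cell (fst i) (snd i)). v k y)" for i k
  define I :: "(nat \<times> ('a \<Rightarrow> int)) set" where "I = {(N, f). 0 < N \<and> f \<in> Basis \<rightarrow>\<^sub>E UNIV \<and> cell_cbox N f \<subseteq> D}"
  have "countable I"
  proof (rule countable_subset)
    show "I \<subseteq> UNIV \<times> (Basis \<rightarrow>\<^sub>E UNIV)" by (auto simp: I_def)
    show "countable ((UNIV :: nat set) \<times> ((Basis :: 'a set) \<rightarrow>\<^sub>E (UNIV :: int set)))"
      by (intro countable_SIGMA countable_PiE) auto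
  qed
  have cD: "cell N f \<subseteq> D" if "(N, f) \<in> I" for N f
    using that cell_subset_cbox[of N f] by (auto simp: I_def)
  have on_cell: "(\<integral>\<^sup>+x. g x \<partial>lebesgue_on (cell N f)) = (\<integral>\<^sup>+x. g x * indicator (cell N f) x \<partial>lebesgue_on D)" if "(N, f) \<in> I" for g N f
    by (rule nn_integral_lebesgue_on_subset[OF cs Ds cD[OF that]])
  have vint: "integrable (lebesgue_on (cell N f)) (v k)" if "(N, f) \<in> I" for N f k
    unfolding integrable_iff_bounded
  proof
    show "v k \<in> borel_measurable (lebesgue_on (cell N f))"
      using vm[of k] cD[OF that] measurable_restrict_mono by blast
    have "(\<integral>\<^sup>+x. ennreal (norm (v k x)) \<partial>lebesgue_on (cell N f)) \<le> (\<integral>\<^sup>+x. ennreal \<bar>v k x\<bar> \<partial>lebesgue_on D)"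
      unfolding on_cell[OF that] by (intro nn_integral_mono) (auto simp: indicator_def)
    then show "(\<integral>\<^sup>+x. ennreal (norm (v k x)) \<partial>lebesgue_on (cell N f)) < \<infinity>"
      using order_trans[OF _ A(1)[of k]] by (auto intro: le_less_trans[OF _ ennreal_less_top])
  qed
  have a_bound: "\<bar>a i k\<bar> \<le> A" if i: "i \<in> I" for i k
  proof -
    obtain N f where Nf: "i = (N, f)" "(N, f) \<in> I" using i by (cases i) auto
    have "ennreal (norm (a i k)) \<le> (\<integral>\<^sup>+x. ennreal (norm (v k x)) \<partial>lebesgue_on (cell N f))"
      unfolding a_def Nf(1) fst_conv snd_conv by (rule integral_norm_bound_ennreal[OF vint[OF Nf(2)]])
    also have "\<dots> \<le> (\<integral>\<^sup>+x. ennreal \<bar>v k x\<bar> \<partial>lebesgue_on D)"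
      unfolding on_cell[OF Nf(2)] by (intro nn_integral_mono) (auto simp: indicator_def)
    also have "\<dots> \<le> ennreal A" by (rule A)
    finally show ?thesis using A0 by simp
  qed
  \<comment> \<open>The default 0 is for an empty \<open>I\<close>, where
    \<open>from_nat_into\<close> yields no cell inside \<open>D\<close>.\<close>
  define \<alpha> where "\<alpha> n k = (if from_nat_into I n \<in> I then a (from_nat_into I n) k else 0)" for n k
  have \<alpha>_bound: "\<bar>\<alpha> n k\<bar> \<le> A" for n k using a_bound A0 by (simp add: \<alpha>_def)
  obtain \<sigma> where \<sigma>: "strict_mono \<sigma>" "\<And>n. convergent (\<lambda>k. \<alpha> n (\<sigma> k))"
    by (rule diagonal_convergent[of \<alpha> A, OF \<alpha>_bound]) (rule that)
  have conv: "convergent (\<lambda>k. a i (\<sigma> k))" if "i \<in> I" for i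
    using \<sigma>(2)[of "to_nat_on I i"] that \<open>countable I\<close> by (simp add: \<alpha>_def)
  have cauchy: "\<exists>K. \<forall>m\<ge>K. \<forall>n\<ge>K. (\<integral>\<^sup>+x. ennreal \<bar>v (\<sigma> m) x - v (\<sigma> n) x\<bar> \<partial>lebesgue_on D) \<le> ennreal e" if e: "0 < e" for e :: real
  proof -
    \<comment> \<open>Five errors of size \<open>e / 8\<close> will be added: the two functions
      outside \<open>C\<close>, their two oscillations on the cells, and the difference of the
      means.\<close>
    obtain d where d: "0 < d" "\<And>k S. S \<in> sets lebesgue \<Longrightarrow> S \<subseteq> D \<Longrightarrow> emeasure lebesgue S < ennreal d \<Longrightarrow>
       (\<integral>\<^sup>+x. ennreal \<bar>v k x\<bar> * indicator S x \<partial>lebesgue_on D) \<le> ennreal (e / 8)"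
      using ui[of "e / 8"] e by auto
    obtain C where C: "compact C" "C \<subseteq> D" "emeasure lebesgue (D - C) < ennreal d"
      using finite_measure_compact_approx[OF D d(1)] by metis
    obtain \<delta> where \<delta>: "0 < \<delta>" "(\<Union>x\<in>C. cball x \<delta>) \<subseteq> D"
      using compact_subset_open_imp_cball_epsilon_subset[OF C(1) D(1) C(2)] by metis
    let ?n = "real DIM('a)"
    \<comment> \<open>Beyond the first bound the cells meeting \<open>C\<close> lie in
      \<open>D\<close>; beyond the second the Poincare constant times \<open>A\<close> is at most
      \<open>e / 8\<close>.\<close>
    define c0 where "c0 = max (?n / \<delta>) (?n * 2 ^ DIM('a) * A / (e / 8))"
    obtain N :: nat where N: "c0 < real N" using reals_Archimedean2 by blast
    have "0 < ?n / \<delta>" using \<delta> by simp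
    then have N0: "0 < N" using N by (simp add: c0_def)
    have N1: "?n / real N \<le> \<delta>" using N N0 \<delta> by (simp add: c0_def field_simps)
    have N2: "?n * 2 ^ DIM('a) / real N * A \<le> e / 8" using N N0 e by (simp add: c0_def field_simps)
    obtain F where F: "finite F" "F \<subseteq> Basis \<rightarrow>\<^sub>E UNIV" "\<And>f. f \<in> F \<Longrightarrow> cell_cbox N f \<subseteq> D" "C \<subseteq> (\<Union>f\<in>F. cell N f)"
      using cells_meeting_compact[OF C(1) N0 N1, of D] \<delta>(2) by (metis UN_subset_iff)
    have FI: "(N, f) \<in> I" if "f \<in> F" for f using F that N0 by (auto simp: I_def)
    define \<epsilon> where "\<epsilon> = e / (8 * (real (card F) + 1))"
    have \<epsilon>: "0 < \<epsilon>" "real (card F) * \<epsilon> \<le> e / 8" using e by (auto simp: \<epsilon>_def field_simps)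
    have "\<forall>f\<in>F. \<exists>K. \<forall>m\<ge>K. \<forall>n\<ge>K. \<bar>a (N, f) (\<sigma> m) - a (N, f) (\<sigma> n)\<bar> < \<epsilon>"
    proof
      fix f assume "f \<in> F"
      from convergent_Cauchy[OF conv[OF FI[OF this]]] \<epsilon>(1)
      show "\<exists>K. \<forall>m\<ge>K. \<forall>n\<ge>K. \<bar>a (N, f) (\<sigma> m) - a (N, f) (\<sigma> n)\<bar> < \<epsilon>"
        by (auto simp: Cauchy_def dist_real_def)
    qed
    from bchoice[OF this] obtain Kf where Kf: "\<And>f m n. f \<in> F \<Longrightarrow> Kf f \<le> m \<Longrightarrow> Kf f \<le> n \<Longrightarrow> \<bar>a (N, f) (\<sigma> m) - a (N, f) (\<sigma> n)\<bar> < \<epsilon>"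
      by blast
    define K where "K = (\<Sum>f\<in>F. Kf f)"
    have KK: "Kf f \<le> K" if "f \<in> F" for f unfolding K_def using F(1) that by (intro member_le_sum) auto
    define \<mu> where "\<mu> = (1 / real N) ^ DIM('a)"
    have \<mu>: "0 < \<mu>" "emeasure (lebesgue_on (cell N f)) (cell N f) = ennreal \<mu>" for f :: "'a \<Rightarrow> int"
      using N0 emeasure_cell[OF N0, of f] cs[of N f] by (auto simp: \<mu>_def emeasure_restrict_space)
    \<comment> \<open>The Poincare inequality is applied to each cell with one common constant; by
      disjointness the gradient integrals add up to at most the integral over
      \<open>D\<close>.\<close>
    have osc: "(\<Sum>f\<in>F. \<integral>\<^sup>+x. ennreal \<bar>v k x - a (N, f) k / \<mu>\<bar> \<partial>lebesgue_on (cell N f)) \<le> ennreal (e / 8)" for k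
    proof -
      let ?c = "ennreal (?n * 2 ^ DIM('a) / real N)"
      have "(\<Sum>f\<in>F. \<integral>\<^sup>+x. ennreal \<bar>v k x - a (N, f) k / \<mu>\<bar> \<partial>lebesgue_on (cell N f)) \<le>
          (\<Sum>f\<in>F. ?c * (\<integral>\<^sup>+x. ennreal (norm (\<Gamma> k x)) \<partial>lebesgue_on (cell N f)))"
        unfolding a_def \<mu>_def fst_conv snd_conv by (intro sum_mono poincare_cell[OF wg D(1) N0] F(3))
      also have "\<dots> = ?c * (\<Sum>f\<in>F. \<integral>\<^sup>+x. ennreal (norm (\<Gamma> k x)) \<partial>lebesgue_on (cell N f))"
        by (simp add: sum_distrib_left)
      also have "(\<Sum>f\<in>F. \<integral>\<^sup>+x. ennreal (norm (\<Gamma> k x)) \<partial>lebesgue_on (cell N f)) = (\<Sum>f\<in>F. \<integral>\<^sup>+x. ennreal (norm (\<Gamma> k x)) * indicator (cell N f) x \<partial>lebesgue_on D)"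
        by (intro sum.cong on_cell FI) auto
      also have "\<dots> = (\<integral>\<^sup>+x. (\<Sum>f\<in>F. ennreal (norm (\<Gamma> k x)) * indicator (cell N f) x) \<partial>lebesgue_on D)"
        using borel_measurable_lebesgue_on[OF borel_measurable_indicator[OF borel_cell]]
        by (intro nn_integral_sum[symmetric] borel_measurable_times_ennreal) auto
      also have "\<dots> \<le> (\<integral>\<^sup>+x. ennreal (norm (\<Gamma> k x)) \<partial>lebesgue_on D)"
        unfolding sum_distrib_left[symmetric] sum_indicator_cells[OF F(1,2)]
        by (intro nn_integral_mono) (auto simp: indicator_def)
      also have "\<dots> \<le> ennreal A" by (rule A)
      finally have "(\<Sum>f\<in>F. \<integral>\<^sup>+x. ennreal \<bar>v k x - a (N, f) k / \<mu>\<bar> \<partial>lebesgue_on (cell N f)) \<le> ?c * ennreal A"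
        by (simp add: mult_left_mono)
      also have "\<dots> \<le> ennreal (e / 8)" using N2 A0 by (simp add: ennreal_mult[symmetric] ennreal_leI)
      finally show ?thesis .
    qed
    have "(\<integral>\<^sup>+x. ennreal \<bar>v (\<sigma> m) x - v (\<sigma> n) x\<bar> \<partial>lebesgue_on D) \<le> ennreal e" if mn: "K \<le> m" "K \<le> n" for m n
    proof -
      let ?g = "\<lambda>x. ennreal \<bar>v (\<sigma> m) x - v (\<sigma> n) x\<bar>"
      have icell [measurable]: "(\<lambda>x. indicator (cell N f) x :: ennreal) \<in> borel_measurable (lebesgue_on D)" for f :: "'a \<Rightarrow> int"
        by (rule borel_measurable_lebesgue_on[OF borel_measurable_indicator[OF borel_cell]])
      have [measurable]: "D - C \<in> sets (lebesgue_on D)" using C D by (simp add: sets_restrict_space_iff compact_imp_closed)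
      have sDC: "D - C \<in> sets lebesgue" using C D by (simp add: compact_imp_closed)
      have "(\<integral>\<^sup>+x. ?g x \<partial>lebesgue_on D) \<le> (\<integral>\<^sup>+x. ((ennreal \<bar>v (\<sigma> m) x\<bar> * indicator (D - C) x) + (ennreal \<bar>v (\<sigma> n) x\<bar> * indicator (D - C) x))
          + (\<Sum>f\<in>F. ?g x * indicator (cell N f) x) \<partial>lebesgue_on D)"
      proof (rule nn_integral_mono)
        fix x assume "x \<in> space (lebesgue_on D)"
        show "?g x \<le> ((ennreal \<bar>v (\<sigma> m) x\<bar> * indicator (D - C) x) + (ennreal \<bar>v (\<sigma> n) x\<bar> * indicator (D - C) x))
          + (\<Sum>f\<in>F. ?g x * indicator (cell N f) x)"
        proof (cases "x \<in> C")
          case True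
          then have "(\<Sum>f\<in>F. ?g x * indicator (cell N f) x) = ?g x"
            unfolding sum_distrib_left[symmetric] sum_indicator_cells[OF F(1,2)] using F(4) by (auto simp: indicator_def)
          then show ?thesis by simp
        next
          case False
          have "?g x \<le> ennreal \<bar>v (\<sigma> m) x\<bar> + ennreal \<bar>v (\<sigma> n) x\<bar>" by (simp flip: ennreal_plus)
          also have "\<dots> = (ennreal \<bar>v (\<sigma> m) x\<bar> * indicator (D - C) x) + (ennreal \<bar>v (\<sigma> n) x\<bar> * indicator (D - C) x)"
            using False \<open>x \<in> space (lebesgue_on D)\<close> by simp
          finally show ?thesis by (rule add_increasing2[rotated]) simp
        qed
      qed
      also have "\<dots> = (\<integral>\<^sup>+x. ennreal \<bar>v (\<sigma> m) x\<bar> * indicator (D - C) x \<partial>lebesgue_on D) + (\<integral>\<^sup>+x. ennreal \<bar>v (\<sigma> n) x\<bar> * indicator (D - C) x \<partial>lebesgue_on D)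
          + (\<integral>\<^sup>+x. (\<Sum>f\<in>F. ?g x * indicator (cell N f) x) \<partial>lebesgue_on D)"
        by (subst nn_integral_add; (subst nn_integral_add)?) measurable
      also have "(\<integral>\<^sup>+x. (\<Sum>f\<in>F. ?g x * indicator (cell N f) x) \<partial>lebesgue_on D) = (\<Sum>f\<in>F. \<integral>\<^sup>+x. ?g x * indicator (cell N f) x \<partial>lebesgue_on D)"
        by (rule nn_integral_sum) measurable
      also have "(\<Sum>f\<in>F. \<integral>\<^sup>+x. ?g x * indicator (cell N f) x \<partial>lebesgue_on D) = (\<Sum>f\<in>F. \<integral>\<^sup>+x. ?g x \<partial>lebesgue_on (cell N f))"
        by (intro sum.cong on_cell[symmetric] FI) auto
      finally have split: "(\<integral>\<^sup>+x. ?g x \<partial>lebesgue_on D) \<le> (\<integral>\<^sup>+x. ennreal \<bar>v (\<sigma> m) x\<bar> * indicator (D - C) x \<partial>lebesgue_on D)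
         + (\<integral>\<^sup>+x. ennreal \<bar>v (\<sigma> n) x\<bar> * indicator (D - C) x \<partial>lebesgue_on D) + (\<Sum>f\<in>F. \<integral>\<^sup>+x. ?g x \<partial>lebesgue_on (cell N f))" .
      have "(\<Sum>f\<in>F. \<integral>\<^sup>+x. ?g x \<partial>lebesgue_on (cell N f)) \<le>
        (\<Sum>f\<in>F. (\<integral>\<^sup>+x. ennreal \<bar>v (\<sigma> m) x - a (N, f) (\<sigma> m) / \<mu>\<bar> \<partial>lebesgue_on (cell N f)) +
               (\<integral>\<^sup>+x. ennreal \<bar>v (\<sigma> n) x - a (N, f) (\<sigma> n) / \<mu>\<bar> \<partial>lebesgue_on (cell N f)) + ennreal \<epsilon>)"
      proof (rule sum_mono)
        fix f assume f: "f \<in> F"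
        let ?am = "a (N, f) (\<sigma> m) / \<mu>" and ?an = "a (N, f) (\<sigma> n) / \<mu>"
        have [measurable]: "v k \<in> borel_measurable (lebesgue_on (cell N f))" for k using vint[OF FI[OF f]] by simp
        have "(\<integral>\<^sup>+x. ?g x \<partial>lebesgue_on (cell N f)) \<le> (\<integral>\<^sup>+x. ennreal \<bar>v (\<sigma> m) x - ?am\<bar> + ennreal \<bar>v (\<sigma> n) x - ?an\<bar> + ennreal \<bar>?am - ?an\<bar> \<partial>lebesgue_on (cell N f))"
          by (intro nn_integral_mono) (simp flip: ennreal_plus)
        also have "\<dots> = (\<integral>\<^sup>+x. ennreal \<bar>v (\<sigma> m) x - ?am\<bar> \<partial>lebesgue_on (cell N f)) + (\<integral>\<^sup>+x. ennreal \<bar>v (\<sigma> n) x - ?an\<bar> \<partial>lebesgue_on (cell N f))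
           + (\<integral>\<^sup>+x. ennreal \<bar>?am - ?an\<bar> \<partial>lebesgue_on (cell N f))"
          by (subst nn_integral_add; (subst nn_integral_add)?) measurable
        also have "(\<integral>\<^sup>+x. ennreal \<bar>?am - ?an\<bar> \<partial>lebesgue_on (cell N f)) = ennreal (\<bar>?am - ?an\<bar> * \<mu>)"
          using \<mu>(1) \<mu>(2)[of f] by (simp add: ennreal_mult)
        also have "\<bar>?am - ?an\<bar> * \<mu> = \<bar>a (N, f) (\<sigma> m) - a (N, f) (\<sigma> n)\<bar>"
          using \<mu>(1) by (simp add: diff_divide_distrib[symmetric])
        also have "ennreal \<bar>a (N, f) (\<sigma> m) - a (N, f) (\<sigma> n)\<bar> \<le> ennreal \<epsilon>"
          using Kf[OF f] KK[OF f] mn by (intro ennreal_leI less_imp_le) auto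
        finally show "(\<integral>\<^sup>+x. ?g x \<partial>lebesgue_on (cell N f)) \<le> (\<integral>\<^sup>+x. ennreal \<bar>v (\<sigma> m) x - ?am\<bar> \<partial>lebesgue_on (cell N f)) +
            (\<integral>\<^sup>+x. ennreal \<bar>v (\<sigma> n) x - ?an\<bar> \<partial>lebesgue_on (cell N f)) + ennreal \<epsilon>"
          by (simp add: add_left_mono)
      qed
      also have "\<dots> \<le> ennreal (e / 8) + ennreal (e / 8) + ennreal (e / 8)"
        unfolding sum.distrib
      proof (intro add_mono osc)
        have "(\<Sum>f\<in>F. ennreal \<epsilon>) = ennreal (real (card F) * \<epsilon>)"
          using \<epsilon>(1) by (simp add: ennreal_mult ennreal_of_nat_eq_real_of_nat)
        then show "(\<Sum>f\<in>F. ennreal \<epsilon>) \<le> ennreal (e / 8)" using \<epsilon>(2) by (simp add: ennreal_leI)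
      qed
      finally have "(\<integral>\<^sup>+x. ?g x \<partial>lebesgue_on D) \<le> ennreal (e / 8) + ennreal (e / 8) + (ennreal (e / 8) + ennreal (e / 8) + ennreal (e / 8))"
        by (intro order_trans[OF split] add_mono d(2)[OF sDC _ C(3)]) auto
      also have "\<dots> \<le> ennreal e" using e by (simp flip: ennreal_plus)
      finally show ?thesis .
    qed
    then show ?thesis by blast
  qed
  show ?thesis by (rule that[OF \<sigma>(1)]) (rule cauchy)
qed

section \<open>Weighted norms\<close>

lemma le_powr_plus_one: "0 \<le> t \<Longrightarrow> 1 \<le> a \<Longrightarrow> t \<le> t powr a + (1::real)"
proof (cases "1 \<le> t")
  case True
  then show "1 \<le> a \<Longrightarrow> t \<le> t powr a + 1" using powr_mono[of 1 a t] by simp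
next
  case False
  then show "0 \<le> t \<Longrightarrow> t \<le> t powr a + 1" using powr_ge_zero[of t a] by linarith
qed

lemma powr_le_powr_plus_one:
  fixes t a b :: real assumes "0 \<le> t" "0 < a" "a \<le> b" shows "t powr a \<le> t powr b + 1"
proof (cases "1 \<le> t")
  case True
  then show ?thesis using powr_mono[of a b t] assms by simp
next
  case False
  then have "t powr a \<le> 1" using powr_mono2[of a t 1] assms by simp
  then show ?thesis using powr_ge_zero[of t b] by linarith
qed

text \<open>The threshold \<open>T\<close> solves \<open>e * T powr (b - a) = 1\<close>. Above it
  the higher power absorbs the lower one, below it the lower one is at most linear or constant. The
  first form interpolates between \<open>L\<^sub>1\<close> and the critical space, the second gives
  uniform integrability.\<close>

lemma powr_absorb:
  fixes a b e :: real assumes "1 \<le> a" "a < b" "0 < e"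
  obtains K where "0 \<le> K" "\<And>t. 0 \<le> t \<Longrightarrow> t powr a \<le> e * t powr b + K * t" "\<And>t. 0 \<le> t \<Longrightarrow> t powr a \<le> e * t powr b + K"
proof -
  define T where "T = e powr (- 1 / (b - a))"
  have T: "0 < T" using assms by (simp add: T_def)
  have big: "t powr a \<le> e * t powr b" if "T \<le> t" for t
  proof -
    have "T powr (b - a) = e powr (- 1 / (b - a) * (b - a))" by (simp only: T_def powr_powr)
    then have "1 / e = T powr (b - a)" using assms by (simp add: powr_minus_divide)
    also have "\<dots> \<le> t powr (b - a)" using T that assms by (intro powr_mono2) auto
    finally have "1 \<le> e * t powr (b - a)" using assms(3) by (simp add: field_simps)
    then have "1 * t powr a \<le> e * t powr (b - a) * t powr a" by (intro mult_right_mono) auto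
    also have "\<dots> = e * t powr b" by (simp add: mult.assoc powr_add[symmetric])
    finally show ?thesis by simp
  qed
  have small: "t powr a \<le> T powr (a - 1) * t" "t powr a \<le> T powr a" if "0 \<le> t" "t < T" for t
  proof -
    show "t powr a \<le> T powr a" using that assms by (intro powr_mono2) auto
    have "t powr (a - 1) \<le> T powr (a - 1)" using that assms by (intro powr_mono2) auto
    then have "t powr (a - 1) * t \<le> T powr (a - 1) * t" using that by (intro mult_right_mono) auto
    moreover have "t powr (a - 1) * t = t powr a"
      using that by (cases "t = 0") (auto simp: powr_mult_base mult.commute)
    ultimately show "t powr a \<le> T powr (a - 1) * t" by simp
  qed
  let ?K = "T powr (a - 1) + T powr a"
  show ?thesis
  proof (rule that)
    show "0 \<le> ?K" by simp
    fix t :: real assume t: "0 \<le> t"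
    have p: "0 \<le> T powr (a - 1) * t" "0 \<le> T powr a * t" "0 \<le> e * t powr b" "0 \<le> T powr (a - 1)" "0 \<le> T powr a"
      using t assms by simp_all
    show "t powr a \<le> e * t powr b + ?K * t" "t powr a \<le> e * t powr b + ?K"
      using small[OF t] big[of t] p unfolding distrib_right by linarith+
  qed
qed

lemma powr_add_le:
  fixes x y a :: real assumes "0 \<le> x" "0 \<le> y" "0 < a"
  shows "(x + y) powr a \<le> 2 powr a * (x powr a + y powr a)"
proof -
  have "(x + y) powr a \<le> (2 * max x y) powr a" using assms by (intro powr_mono2) auto
  also have "\<dots> = 2 powr a * max x y powr a" using assms by (simp add: powr_mult)
  also have "max x y powr a \<le> x powr a + y powr a" by (auto simp: max_def)
  finally show ?thesis by simp
qed

text \<open>Either the first summand dominates already, or \<open>t\<close> is bounded by a power of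
  \<open>w\<close>; this replaces Young's inequality with its exact constants. The last term is
  \<open>w powr (- 1 / p)\<close> raised to \<open>p * q / (p - q)\<close>, the quantity controlled
  by \<open>Kconst\<close>.\<close>

lemma young_dual:
  fixes t p q w :: real assumes "0 \<le> t" "0 < q" "q < p" "0 < w"
  shows "t powr q \<le> t powr p * w + w powr (- q / (p - q))"
proof (cases "t powr q \<le> t powr p * w")
  case True then show ?thesis using powr_ge_zero[of w] by (simp add: add_increasing2)
next
  case False
  then have t: "0 < t" using assms by (cases "t = 0") auto
  have "t powr p * w < t powr q" using False by simp
  then have "t powr (p - q) < 1 / w"
    using t assms(4) by (simp add: powr_diff field_simps)
  then have "(t powr (p - q)) powr (q / (p - q)) \<le> (1 / w) powr (q / (p - q))"
    using assms by (intro powr_mono2) auto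
  then have "t powr q \<le> (1 / w) powr (q / (p - q))" using assms by (simp add: powr_powr)
  also have "\<dots> = w powr (- q / (p - q))"
    using assms by (simp add: powr_divide powr_minus_divide)
  finally show ?thesis using assms by (simp add: add_increasing)
qed

text \<open>The same dichotomy with a free parameter \<open>M\<close> that makes the weight term as
  small as desired. The power of \<open>w\<close> is \<open>w powr (1 / s)\<close> raised to
  \<open>r * s / (r - s)\<close>.\<close>

lemma young_weight:
  fixes t r s w M :: real assumes "0 \<le> t" "0 < s" "s < r" "0 \<le> w" "0 < M"
  shows "t powr s * w \<le> M * t powr r + M powr (- s / (r - s)) * w powr (r / (r - s))"
proof (cases "w \<le> M * t powr (r - s)")
  case True
  then have "t powr s * w \<le> t powr s * (M * t powr (r - s))" by (intro mult_left_mono) auto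
  also have "\<dots> = M * t powr r" by (simp add: mult.left_commute powr_add[symmetric])
  finally show ?thesis by (simp add: add_increasing2)
next
  case False
  then have w: "0 < w" using assms by (smt (verit) mult_nonneg_nonneg powr_ge_zero)
  have "t powr (r - s) < w / M" using False assms by (simp add: field_simps)
  then have "(t powr (r - s)) powr (s / (r - s)) \<le> (w / M) powr (s / (r - s))"
    using assms by (intro powr_mono2) auto
  then have "t powr s \<le> (w / M) powr (s / (r - s))" using assms by (simp add: powr_powr)
  then have "t powr s * w \<le> (w / M) powr (s / (r - s)) * w" using w by (intro mult_right_mono) auto
  also have "\<dots> = M powr (- s / (r - s)) * (w powr (s / (r - s)) * w)"
    using w assms by (simp add: powr_divide powr_minus_divide)
  also have "w powr (s / (r - s)) * w = w powr (s / (r - s) + 1)"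
    using w by (simp add: powr_add)
  also have "s / (r - s) + 1 = r / (r - s)" using assms by (simp add: field_simps)
  finally show ?thesis using assms by (simp add: add_increasing)
qed

section \<open>Extended powers and the two halves of \<open>Kconst\<close>\<close>

lemma epowr_measurable [measurable]:
  assumes [measurable]: "f \<in> borel_measurable M"
  shows "(\<lambda>x. epowr (f x) a) \<in> borel_measurable M"
  by (cases "a = 0"; cases "0 < a") (simp_all add: epowr_def[abs_def])

lemma epowr_ennreal: "0 < a \<Longrightarrow> 0 \<le> t \<Longrightarrow> epowr (ennreal t) a = ennreal (t powr a)"
  by (simp add: epowr_def)

lemma epowr_less_top_iff: "0 < a \<Longrightarrow> epowr x a < top \<longleftrightarrow> x < top"
  by (auto simp: epowr_def less_top)

lemma epowr_mono:
  assumes "x \<le> y" "0 < a" shows "epowr x a \<le> epowr y a"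
proof (cases y)
  case (real b)
  then obtain c where "x = ennreal c" "0 \<le> c" "c \<le> b"
    using assms(1) by (cases x) (auto simp: top_unique)
  then show ?thesis using real assms(2) by (simp add: epowr_ennreal ennreal_leI powr_mono2)
qed (use assms in \<open>simp add: epowr_def\<close>)

lemma epowr_inverse_le_iff:
  assumes "0 < s" "0 \<le> l"
  shows "epowr I (1 / s) \<le> ennreal l \<longleftrightarrow> I \<le> ennreal (l powr s)"
proof
  assume "I \<le> ennreal (l powr s)"
  then have "epowr I (1 / s) \<le> epowr (ennreal (l powr s)) (1 / s)" using assms by (intro epowr_mono) auto
  then show "epowr I (1 / s) \<le> ennreal l" using assms by (simp add: epowr_ennreal powr_powr)
next
  assume *: "epowr I (1 / s) \<le> ennreal l"
  then have "epowr I (1 / s) < \<infinity>" using le_less_trans[OF _ ennreal_less_top] by simp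
  then have "I < \<infinity>" using assms by (simp add: epowr_less_top_iff)
  then obtain i where i: "I = ennreal i" "0 \<le> i" by (cases I) auto
  then have "i powr (1 / s) \<le> l" using * assms by (simp add: epowr_ennreal)
  then have "(i powr (1 / s)) powr s \<le> l powr s" using assms by (intro powr_mono2) auto
  then show "I \<le> ennreal (l powr s)" using i assms by (simp add: powr_powr ennreal_leI)
qed

lemma wLnorm_le_iff:
  "0 < s \<Longrightarrow> 0 \<le> l \<Longrightarrow> wLnorm s S w f \<le> ennreal l \<longleftrightarrow> (\<integral>\<^sup>+x. ennreal (norm (f x) powr s * w x) \<partial>lebesgue_on S) \<le> ennreal (l powr s)"
  unfolding wLnorm_def by (rule epowr_inverse_le_iff)

lemma nn_integral_powr_scale:
  fixes f :: "'a::euclidean_space \<Rightarrow> 'b::euclidean_space"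
  assumes [measurable]: "f \<in> borel_measurable M" "w \<in> borel_measurable M" and "0 \<le> c" "\<And>x. 0 \<le> w x"
  shows "(\<integral>\<^sup>+x. ennreal (norm (c *\<^sub>R f x) powr s * w x) \<partial>M) = ennreal (c powr s) * (\<integral>\<^sup>+x. ennreal (norm (f x) powr s * w x) \<partial>M)"
proof -
  have "(\<integral>\<^sup>+x. ennreal (norm (c *\<^sub>R f x) powr s * w x) \<partial>M) = (\<integral>\<^sup>+x. ennreal (c powr s) * ennreal (norm (f x) powr s * w x) \<partial>M)"
    using assms(3,4) by (intro nn_integral_cong) (simp add: powr_mult ennreal_mult[symmetric] mult.assoc)
  also have "\<dots> = ennreal (c powr s) * (\<integral>\<^sup>+x. ennreal (norm (f x) powr s * w x) \<partial>M)"
    by (rule nn_integral_cmult) measurable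
  finally show ?thesis .
qed

lemma has_weak_gradient_scale:
  assumes wg: "has_weak_gradient_on f g D"
  shows "has_weak_gradient_on (\<lambda>x. c * f x) (\<lambda>x. c *\<^sub>R g x) D"
  unfolding has_weak_gradient_on_def
proof (intro conjI allI impI ballI)
  show "locally_summable_on (\<lambda>x. c * f x) D" "locally_summable_on (\<lambda>x. c *\<^sub>R g x) D"
    using wg by (auto simp: has_weak_gradient_on_def locally_summable_on_def intro: set_integrable_mult_right set_integrable_scaleR_right)
  fix \<eta> and b :: 'a assume "test_function_on D \<eta>" "b \<in> Basis"
  then have "(LINT x|lebesgue_on D. f x * frechet_derivative \<eta> (at x) b) = - (LINT x|lebesgue_on D. (g x \<bullet> b) * \<eta> x)"
    using wg by (simp add: has_weak_gradient_on_def)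
  then show "(LINT x|lebesgue_on D. c * f x * frechet_derivative \<eta> (at x) b) = - (LINT x|lebesgue_on D. (c *\<^sub>R g x) \<bullet> b * \<eta> x)"
    by (simp add: mult.assoc)
qed

lemma weak_gradient_works:
  assumes "weakly_differentiable_on f D" shows "has_weak_gradient_on f (weak_gradient D f) D"
  using assms unfolding weakly_differentiable_on_def weak_gradient_def by (rule someI_ex)

lemma weight_measurable: "weight w \<Longrightarrow> w \<in> borel_measurable (lebesgue_on S)"
  using locally_summable_measurable[of w UNIV] by (auto simp: weight_def lebesgue_on_UNIV_eq intro: measurable_restrict_space1)

lemma weight_nonneg: "weight w \<Longrightarrow> 0 \<le> w x"
  by (simp add: weight_def)

text \<open>For \<open>q = p\<close> the norm is an essential supremum. Points with \<open>w x = 0\<close> are harmless since there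
  \<open>epowr (w x) (- 1 / p) = \<infinity>\<close>.\<close>

lemma Lnorm_dual_weight_bound:
  fixes w :: "'a::euclidean_space \<Rightarrow> real"
  assumes w: "weight w" and pq: "1 \<le> q" "q \<le> p"
    and fin: "Lnorm (ennreal (p * q) / ennreal (p - q)) D (\<lambda>x. epowr (ennreal (w x)) (- 1 / p)) < \<infinity>"
  obtains C h where "0 \<le> C" "h \<in> borel_measurable (lebesgue_on D)" "(\<integral>\<^sup>+x. h x \<partial>lebesgue_on D) < \<infinity>"
    "AE x in lebesgue_on D. \<forall>t\<ge>0. ennreal (t powr q) \<le> ennreal C * ennreal (t powr p * w x) + h x"
proof (cases "q = p")
  case True
  have "ennreal (p * q) / ennreal (p - q) = \<infinity>"
    using True pq by (simp add: ennreal_divide_eq_top_iff)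
  then have E: "esssup (lebesgue_on D) (\<lambda>x. epowr (ennreal (w x)) (- 1 / p)) < \<infinity>" (is "?E < _")
    using fin by (simp add: Lnorm_def)
  obtain E where E: "?E = ennreal E" "0 \<le> E" using E by (cases ?E) auto
  have "AE x in lebesgue_on D. \<forall>t\<ge>0. ennreal (t powr q) \<le> ennreal (E powr p) * ennreal (t powr p * w x) + 0"
    using esssup_AE[where M="lebesgue_on D" and f="\<lambda>x. epowr (ennreal (w x)) (- 1 / p)"]
  proof eventually_elim
    case (elim x)
    have w0: "0 \<le> w x" by (rule weight_nonneg[OF w])
    have wp: "0 < w x" using elim pq w0 unfolding E(1) by (cases "w x = 0") (auto simp: epowr_def top_unique)
    then have "w x powr (- 1 / p) \<le> E" using elim pq E by (auto simp: epowr_def)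
    then have "(w x powr (- 1 / p)) powr p \<le> E powr p" using pq by (intro powr_mono2) auto
    then have "w x powr (- 1 / p * p) \<le> E powr p" by (simp only: powr_powr)
    then have "1 / w x \<le> E powr p" using wp pq by (simp add: powr_minus_divide)
    then have 1: "1 \<le> E powr p * w x" using wp by (simp add: field_simps)
    show ?case
    proof (intro allI impI)
      fix t :: real
      have "t powr p * 1 \<le> t powr p * (E powr p * w x)" using 1 by (intro mult_left_mono) auto
      then show "ennreal (t powr q) \<le> ennreal (E powr p) * ennreal (t powr p * w x) + 0"
        using True w0 by (simp add: ennreal_mult[symmetric] ennreal_leI mult_ac)
    qed
  qed
  then show ?thesis by (intro that[of "E powr p" "\<lambda>x. 0"]) auto
next
  case False
  define k where "k = p * q / (p - q)"
  have k: "0 < k" "ennreal (p * q) / ennreal (p - q) = ennreal k"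
    using False pq by (auto simp: k_def divide_ennreal)
  define h where "h x = epowr (epowr (ennreal (w x)) (- 1 / p)) k" for x
  have [measurable]: "w \<in> borel_measurable (lebesgue_on D)" by (rule weight_measurable[OF w])
  have hm: "h \<in> borel_measurable (lebesgue_on D)" unfolding h_def by measurable
  have "epowr (\<integral>\<^sup>+x. h x \<partial>lebesgue_on D) (1 / k) < \<infinity>" using fin k by (simp add: Lnorm_def h_def)
  then have hf: "(\<integral>\<^sup>+x. h x \<partial>lebesgue_on D) < \<infinity>" using k by (simp add: epowr_less_top_iff)
  have "ennreal (t powr q) \<le> ennreal 1 * ennreal (t powr p * w x) + h x" if "0 \<le> t" for t x
  proof (cases "w x = 0")
    case True
    then show ?thesis using pq k by (simp add: h_def epowr_def)
  next
    case w0: False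
    then have wp: "0 < w x" using weight_nonneg[OF w, of x] by simp
    have "h x = ennreal ((w x powr (- 1 / p)) powr k)" using wp pq k by (simp add: h_def epowr_def)
    also have "(w x powr (- 1 / p)) powr k = w x powr (- q / (p - q))"
      using pq by (simp add: powr_powr k_def)
    finally show ?thesis
      using young_dual[OF that, of q p "w x"] wp pq False by (simp add: ennreal_leI flip: ennreal_plus)
  qed
  then show ?thesis using hm hf by (intro that[of 1 h]) auto
qed

text \<open>The factor \<open>e\<close> is for compactness: the term \<open>h\<close> does not
  shrink along the sequence, so its coefficient must be arbitrarily small, at the price of
  \<open>M\<close>. For \<open>s = r\<close> the weight is essentially bounded and \<open>h\<close>
  is 0.\<close>

lemma Lnorm_weight_bound:
  fixes w :: "'a::euclidean_space \<Rightarrow> real"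
  assumes w: "weight w" and rs: "1 \<le> s" "s \<le> r"
    and fin: "Lnorm (ennreal (r * s) / ennreal (r - s)) D (\<lambda>x. epowr (ennreal (w x)) (1 / s)) < \<infinity>"
  obtains h where "h \<in> borel_measurable (lebesgue_on D)" "(\<integral>\<^sup>+x. h x \<partial>lebesgue_on D) < \<infinity>"
    "\<And>e::real. 0 < e \<Longrightarrow> \<exists>M\<ge>0. AE x in lebesgue_on D. \<forall>t\<ge>0. ennreal (t powr s * w x) \<le> ennreal M * ennreal (t powr r) + ennreal e * h x"
proof (cases "s = r")
  case True
  have "ennreal (r * s) / ennreal (r - s) = \<infinity>"
    using True rs by (simp add: ennreal_divide_eq_top_iff)
  then have E: "esssup (lebesgue_on D) (\<lambda>x. epowr (ennreal (w x)) (1 / s)) < \<infinity>" (is "?E < _")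
    using fin by (simp add: Lnorm_def)
  obtain E where E: "?E = ennreal E" "0 \<le> E" using E by (cases ?E) auto
  have "AE x in lebesgue_on D. \<forall>t\<ge>0. ennreal (t powr s * w x) \<le> ennreal (E powr s) * ennreal (t powr r) + ennreal e * 0" for e :: real
    using esssup_AE[where M="lebesgue_on D" and f="\<lambda>x. epowr (ennreal (w x)) (1 / s)"]
  proof eventually_elim
    case (elim x)
    have w0: "0 \<le> w x" by (rule weight_nonneg[OF w])
    then have "w x powr (1 / s) \<le> E" using elim rs E by (simp add: epowr_ennreal)
    then have "(w x powr (1 / s)) powr s \<le> E powr s" using rs by (intro powr_mono2) auto
    then have "w x \<le> E powr s" using w0 rs by (simp add: powr_powr)
    then have "t powr s * w x \<le> t powr s * E powr s" for t by (intro mult_left_mono) auto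
    then show ?case using True by (simp add: ennreal_mult[symmetric] ennreal_leI mult.commute)
  qed
  then show ?thesis by (intro that[of "\<lambda>x. 0"]) (auto intro!: exI[of _ "E powr s"])
next
  case False
  define k where "k = r * s / (r - s)"
  have k: "0 < k" "ennreal (r * s) / ennreal (r - s) = ennreal k"
    using False rs by (auto simp: k_def divide_ennreal)
  define h where "h x = epowr (epowr (ennreal (w x)) (1 / s)) k" for x
  have [measurable]: "w \<in> borel_measurable (lebesgue_on D)" by (rule weight_measurable[OF w])
  have hm: "h \<in> borel_measurable (lebesgue_on D)" unfolding h_def by measurable
  have "epowr (\<integral>\<^sup>+x. h x \<partial>lebesgue_on D) (1 / k) < \<infinity>" using fin k by (simp add: Lnorm_def h_def)
  then have hf: "(\<integral>\<^sup>+x. h x \<partial>lebesgue_on D) < \<infinity>" using k by (simp add: epowr_less_top_iff)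
  have hx: "h x = ennreal (w x powr (r / (r - s)))" for x
    using weight_nonneg[OF w, of x] rs k by (simp add: h_def epowr_ennreal powr_powr k_def)
  have "\<exists>M\<ge>0. AE x in lebesgue_on D. \<forall>t\<ge>0. ennreal (t powr s * w x) \<le> ennreal M * ennreal (t powr r) + ennreal e * h x" if e: "0 < e" for e :: real
  proof -
    \<comment> \<open>Chosen so that the coefficient \<open>M powr (- s / (r - s))\<close> in
      \<open>young_weight\<close> equals \<open>e\<close>.\<close>
    define M where "M = e powr (- (r - s) / s)"
    have "M powr (- s / (r - s)) = e powr (- (r - s) / s * (- s / (r - s)))" by (simp only: M_def powr_powr)
    moreover have "- (r - s) / s * (- s / (r - s)) = 1" using rs False by (simp add: field_simps)
    ultimately have M: "0 < M" "M powr (- s / (r - s)) = e" using e by (simp_all add: M_def)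
    have "ennreal (t powr s * w x) \<le> ennreal M * ennreal (t powr r) + ennreal e * h x" if "0 \<le> t" for t x
    proof -
      have "t powr s * w x \<le> M * t powr r + e * w x powr (r / (r - s))"
        using young_weight[OF that, of s r "w x" M] rs False weight_nonneg[OF w, of x] M by simp
      then show ?thesis using M(1) e unfolding hx by (simp add: ennreal_mult[symmetric] ennreal_leI flip: ennreal_plus)
    qed
    then show ?thesis using M(1) by (intro exI[of _ M]) auto
  qed
  then show ?thesis using hm hf by (intro that[of h]) auto
qed

section \<open>The embedding operator\<close>

text \<open>The embedding property only bounds the distance of \<open>g\<close> to the constants.
  The nearly optimal constant is itself bounded because \<open>g\<close> is bounded in
  \<open>L\<^sub>1\<close> and \<open>D\<close> has positive measure.\<close>

lemma embedding_domain_bound: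
  fixes D :: "'a::euclidean_space set"
  assumes E: "embedding_domain D" and q: "1 \<le> q" "q < real DIM('a)" and qs: "qs = real DIM('a) * q / (real DIM('a) - q)" and A: "0 \<le> A"
  obtains C where "0 \<le> C" "\<And>g \<gamma>. has_weak_gradient_on g \<gamma> D \<Longrightarrow> (\<integral>\<^sup>+x. ennreal \<bar>g x\<bar> \<partial>lebesgue_on D) \<le> ennreal A \<Longrightarrow>
     (\<integral>\<^sup>+x. ennreal (norm (\<gamma> x) powr q) \<partial>lebesgue_on D) \<le> ennreal A \<Longrightarrow> (\<integral>\<^sup>+x. ennreal (\<bar>g x\<bar> powr qs) \<partial>lebesgue_on D) \<le> ennreal C"
proof -
  have D: "open D" "bounded D" "D \<noteq> {}" using E by (auto simp: embedding_domain_def region_def)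
  have "1 * (real DIM('a) - q) \<le> real DIM('a) * 1" using q by simp
  also have "\<dots> \<le> real DIM('a) * q" using q by (intro mult_left_mono) auto
  finally have "1 * (real DIM('a) - q) \<le> real DIM('a) * q" .
  then have qs1: "1 \<le> qs" using q by (simp add: qs pos_le_divide_eq)
  obtain M where M: "\<And>f. f \<in> L1space q D \<Longrightarrow> (INF c. Lnorm (ennreal qs) D (\<lambda>x. ennreal \<bar>f x - c\<bar>)) \<le> ennreal M * L1seminorm q D f"
    using E q qs1 unfolding embedding_domain_def qs by blast
  \<comment> \<open>The summand 1 puts \<open>l\<close> strictly above the infimum, so some constant
    \<open>c\<close> attains a value below \<open>l\<close>. A negative \<open>M\<close> acts as 0
    in \<open>ennreal\<close>, hence the maximum.\<close>
  define l where "l = max 0 M * A powr (1 / q) + 1"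
  have l: "0 < l" by (simp add: l_def add_nonneg_pos)
  define d where "d = measure lebesgue D"
  have "D \<in> lmeasurable" using D by (simp add: lmeasurable_open)
  then have ed: "emeasure lebesgue D = ennreal d" by (simp add: d_def emeasure_eq_measure2)
  have "\<not> negligible D" using D open_not_negligible by blast
  then have d: "0 < d" using \<open>D \<in> lmeasurable\<close> negligible_iff_measure[of D] by (auto simp: d_def zero_less_measure_iff)
  \<comment> \<open>Integrating \<open>\<bar>c\<bar> \<le> \<bar>g x - c\<bar> powr qs + 1 + \<bar>g
    x\<bar>\<close> over \<open>D\<close> bounds \<open>\<bar>c\<bar> * d\<close> by this
    numerator.\<close>
  define c0 where "c0 = (l powr qs + d + A) / d"
  define C where "C = 2 powr qs * (l powr qs + c0 powr qs * d)"
  have "(\<integral>\<^sup>+x. ennreal (\<bar>g x\<bar> powr qs) \<partial>lebesgue_on D) \<le> ennreal C"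
    if wg: "has_weak_gradient_on g \<gamma> D" and g1: "(\<integral>\<^sup>+x. ennreal \<bar>g x\<bar> \<partial>lebesgue_on D) \<le> ennreal A"
      and \<gamma>1: "(\<integral>\<^sup>+x. ennreal (norm (\<gamma> x) powr q) \<partial>lebesgue_on D) \<le> ennreal A" for g \<gamma>
  proof -
    have [measurable]: "g \<in> borel_measurable (lebesgue_on D)"
      using wg D by (intro locally_summable_measurable) (auto simp: has_weak_gradient_on_def)
    have wd: "weakly_differentiable_on g D" using wg by (auto simp: weakly_differentiable_on_def)
    have ae: "AE x in lebesgue_on D. weak_gradient D g x = \<gamma> x"
      by (rule weak_gradient_AE_unique[OF weak_gradient_works[OF wd] wg D(1)])
    have "L1seminorm q D g = epowr (\<integral>\<^sup>+x. ennreal (norm (weak_gradient D g x) powr q) \<partial>lebesgue_on D) (1 / q)"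
      using q by (simp add: L1seminorm_def Lnorm_def epowr_ennreal)
    also have "(\<integral>\<^sup>+x. ennreal (norm (weak_gradient D g x) powr q) \<partial>lebesgue_on D) = (\<integral>\<^sup>+x. ennreal (norm (\<gamma> x) powr q) \<partial>lebesgue_on D)"
      by (rule nn_integral_cong_AE) (use ae in eventually_elim, simp)
    also have "epowr \<dots> (1 / q) \<le> epowr (ennreal A) (1 / q)" using \<gamma>1 q by (intro epowr_mono) auto
    also have "\<dots> = ennreal (A powr (1 / q))" using q A by (simp add: epowr_ennreal)
    finally have sn: "L1seminorm q D g \<le> ennreal (A powr (1 / q))" .
    then have "g \<in> L1space q D"
      using wg wd le_less_trans[OF sn ennreal_less_top] by (auto simp: L1space_def has_weak_gradient_on_def)
    then have "(INF c. Lnorm (ennreal qs) D (\<lambda>x. ennreal \<bar>g x - c\<bar>)) \<le> ennreal M * ennreal (A powr (1 / q))"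
      using M sn by (meson mult_left_mono order_trans zero_le)
    also have "ennreal M = ennreal (max 0 M)" by (simp add: max_def ennreal_neg)
    also have "ennreal (max 0 M) * ennreal (A powr (1 / q)) = ennreal (max 0 M * A powr (1 / q))" by (simp add: ennreal_mult)
    also have "\<dots> < ennreal l" by (simp add: l_def ennreal_less_iff)
    finally obtain c where c: "Lnorm (ennreal qs) D (\<lambda>x. ennreal \<bar>g x - c\<bar>) < ennreal l"
      by (auto simp: INF_less_iff)
    have "epowr (\<integral>\<^sup>+x. ennreal (\<bar>g x - c\<bar> powr qs) \<partial>lebesgue_on D) (1 / qs) \<le> ennreal l"
      using c qs1 by (simp add: Lnorm_def epowr_ennreal less_imp_le)
    then have gc: "(\<integral>\<^sup>+x. ennreal (\<bar>g x - c\<bar> powr qs) \<partial>lebesgue_on D) \<le> ennreal (l powr qs)"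
      using qs1 l by (subst (asm) epowr_inverse_le_iff) auto
    have eD: "emeasure (lebesgue_on D) D = ennreal d" using D ed by (simp add: emeasure_restrict_space)
    have "ennreal (\<bar>c\<bar> * d) = (\<integral>\<^sup>+x. ennreal \<bar>c\<bar> \<partial>lebesgue_on D)"
      using eD d by (simp add: ennreal_mult)
    also have "\<dots> \<le> (\<integral>\<^sup>+x. ennreal (\<bar>g x - c\<bar> powr qs) + 1 + ennreal \<bar>g x\<bar> \<partial>lebesgue_on D)"
    proof (rule nn_integral_mono)
      fix x
      have "\<bar>c\<bar> \<le> \<bar>g x - c\<bar> powr qs + 1 + \<bar>g x\<bar>"
        using le_powr_plus_one[of "\<bar>g x - c\<bar>" qs] qs1 by simp
      then have "ennreal \<bar>c\<bar> \<le> ennreal (\<bar>g x - c\<bar> powr qs + 1 + \<bar>g x\<bar>)" by (rule ennreal_leI)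
      then show "ennreal \<bar>c\<bar> \<le> ennreal (\<bar>g x - c\<bar> powr qs) + 1 + ennreal \<bar>g x\<bar>" by simp
    qed
    also have "\<dots> = (\<integral>\<^sup>+x. ennreal (\<bar>g x - c\<bar> powr qs) \<partial>lebesgue_on D) + ennreal d + (\<integral>\<^sup>+x. ennreal \<bar>g x\<bar> \<partial>lebesgue_on D)"
      using eD by (subst nn_integral_add; (subst nn_integral_add)?) auto
    also have "\<dots> \<le> ennreal (l powr qs) + ennreal d + ennreal A" by (intro add_mono gc g1 order_refl)
    also have "\<dots> = ennreal (l powr qs + d + A)" using d A by simp
    finally have "\<bar>c\<bar> * d \<le> l powr qs + d + A"
      using d A by (subst (asm) ennreal_le_iff) (auto intro!: add_nonneg_nonneg)
    then have c0: "\<bar>c\<bar> \<le> c0" using d by (simp add: c0_def pos_le_divide_eq)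
    have "(\<integral>\<^sup>+x. ennreal (\<bar>g x\<bar> powr qs) \<partial>lebesgue_on D) \<le> (\<integral>\<^sup>+x. ennreal (2 powr qs) * (ennreal (\<bar>g x - c\<bar> powr qs) + ennreal (c0 powr qs)) \<partial>lebesgue_on D)"
    proof (rule nn_integral_mono)
      fix x
      have "\<bar>g x\<bar> powr qs \<le> (\<bar>g x - c\<bar> + c0) powr qs" using c0 qs1 by (intro powr_mono2) auto
      also have "\<dots> \<le> 2 powr qs * (\<bar>g x - c\<bar> powr qs + c0 powr qs)" using c0 qs1 by (intro powr_add_le) auto
      finally have "ennreal (\<bar>g x\<bar> powr qs) \<le> ennreal (2 powr qs * (\<bar>g x - c\<bar> powr qs + c0 powr qs))" by (rule ennreal_leI)
      then show "ennreal (\<bar>g x\<bar> powr qs) \<le> ennreal (2 powr qs) * (ennreal (\<bar>g x - c\<bar> powr qs) + ennreal (c0 powr qs))"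
        by (simp add: ennreal_mult)
    qed
    also have "\<dots> = ennreal (2 powr qs) * ((\<integral>\<^sup>+x. ennreal (\<bar>g x - c\<bar> powr qs) \<partial>lebesgue_on D) + ennreal (c0 powr qs) * ennreal d)"
      using eD by (subst nn_integral_cmult, measurable, subst nn_integral_add) auto
    also have "\<dots> \<le> ennreal (2 powr qs) * (ennreal (l powr qs) + ennreal (c0 powr qs) * ennreal d)"
      by (intro mult_left_mono add_mono gc order_refl) auto
    also have "\<dots> = ennreal C" using d by (simp add: C_def ennreal_mult)
    finally show ?thesis .
  qed
  moreover have "0 \<le> C" using d by (simp add: C_def)
  ultimately show ?thesis using that by blast
qed

section \<open>Uniform bounds on the weighted unit ball\<close>

context
  fixes D D' :: "'a::euclidean_space set" and \<phi> :: "'a \<Rightarrow> 'a" and w :: "'a \<Rightarrow> real" and Q p q s r qs :: real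
  assumes E: "embedding_domain D" and Q: "0 < Q" and qi: "quasiisometrical Q D D' \<phi>"
    and p: "1 < p" and q: "1 \<le> q" "q \<le> p" "q < real DIM('a)" and s: "1 \<le> s" and r: "s \<le> r" "r \<le> qs"
    and qs: "qs = real DIM('a) * q / (real DIM('a) - q)"
    and w: "weight w" and K: "Kconst p q r s D' w < \<infinity>"
begin

text \<open>Normalised functions are carried together with an explicit gradient, because \<open>weak_gradient\<close>
  is a choice that need not commute with scaling.\<close>

abbreviation (input) weighted_unit :: "('a \<Rightarrow> real) \<Rightarrow> ('a \<Rightarrow> 'a) \<Rightarrow> bool" where
  "weighted_unit v \<Gamma> \<equiv> has_weak_gradient_on v \<Gamma> D' \<and> (\<integral>\<^sup>+x. ennreal (norm (v x) powr p * w x) \<partial>lebesgue_on D') \<le> 1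
     \<and> (\<integral>\<^sup>+x. ennreal (norm (\<Gamma> x) powr p * w x) \<partial>lebesgue_on D') \<le> 1"

lemma qs_gt_one: "1 < qs"
proof -
  have "1 * (real DIM('a) - q) < real DIM('a) * 1" using q by simp
  also have "\<dots> \<le> real DIM('a) * q" using q by (intro mult_left_mono) auto
  finally have "1 * (real DIM('a) - q) < real DIM('a) * q" .
  then show ?thesis using q by (simp add: qs pos_less_divide_eq)
qed

lemma bilipschitz_setting:
  obtains \<psi> L where "homeomorphism D D' \<phi> \<psi>" "open D" "open D'" "lipschitz_on_convex L D \<phi>" "lipschitz_on_convex L D' \<psi>" "0 < L"
proof -
  obtain \<psi> where hom: "homeomorphism D D' \<phi> \<psi>" using qi by (auto simp: quasiisometrical_def)
  moreover have "open D" "open D'" using qi by (auto simp: quasiisometrical_def region_def)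
  ultimately show ?thesis
    using that quasiisometrical_lipschitz[OF qi Q hom] Q by (meson mult_pos_pos zero_less_numeral)
qed

lemma open_D': "open D'"
  using qi by (simp add: quasiisometrical_def region_def)

lemma finite_measure_D': "emeasure lebesgue D' < \<infinity>"
proof -
  obtain \<psi> L where hom: "homeomorphism D D' \<phi> \<psi>" and D: "open D" "open D'" and L: "lipschitz_on_convex L D \<phi>" "lipschitz_on_convex L D' \<psi>"
    by (rule bilipschitz_setting)
  have "emeasure lebesgue (\<phi> ` D) \<le> ennreal (L ^ DIM('a)) * emeasure lebesgue D"
    by (rule emeasure_lipschitz_image(2)[OF L(1) D(1)]) (use D in auto)
  moreover have "emeasure lebesgue D < \<infinity>"
    using E D(1) by (auto simp: embedding_domain_def dest!: lmeasurable_open fmeasurableD2 simp: less_top)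
  moreover have "\<phi> ` D = D'" by (rule homeomorphism_image1[OF hom])
  ultimately show ?thesis by (simp add: ennreal_mult_less_top order_le_less_trans)
qed

lemma weighted_unit_bounds:
  "\<exists>C\<ge>0. \<forall>v \<Gamma>. weighted_unit v \<Gamma> \<longrightarrow> (\<integral>\<^sup>+x. ennreal (\<bar>v x\<bar> powr qs) \<partial>lebesgue_on D') \<le> ennreal C \<and>
     (\<integral>\<^sup>+x. ennreal \<bar>v x\<bar> \<partial>lebesgue_on D') \<le> ennreal C \<and> (\<integral>\<^sup>+x. ennreal (norm (\<Gamma> x)) \<partial>lebesgue_on D') \<le> ennreal C"
proof -
  obtain \<psi> L where hom: "homeomorphism D D' \<phi> \<psi>" and D: "open D" "open D'" and L: "lipschitz_on_convex L D \<phi>" "lipschitz_on_convex L D' \<psi>"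
    and L0: "0 < L"
    by (rule bilipschitz_setting)
  note comp = nn_integral_comp_le[OF hom D L] and mcomp = measurable_comp_bilipschitz[OF hom D L]
  have K1: "Lnorm (ennreal (p * q) / ennreal (p - q)) D' (\<lambda>x. epowr (ennreal (w x)) (- 1 / p)) < \<infinity>"
    using K by (simp add: Kconst_def)
  obtain C0 h where C0: "0 \<le> C0" and [measurable]: "h \<in> borel_measurable (lebesgue_on D')" and hf: "(\<integral>\<^sup>+x. h x \<partial>lebesgue_on D') < \<infinity>"
    and h: "AE x in lebesgue_on D'. \<forall>t\<ge>0. ennreal (t powr q) \<le> ennreal C0 * ennreal (t powr p * w x) + h x"
    by (rule Lnorm_dual_weight_bound[OF w q(1,2) K1]) (rule that)
  obtain h0 where h0: "(\<integral>\<^sup>+x. h x \<partial>lebesgue_on D') = ennreal h0" "0 \<le> h0"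
    using hf by (cases "\<integral>\<^sup>+x. h x \<partial>lebesgue_on D'") auto
  obtain m where m: "emeasure lebesgue D' = ennreal m" "0 \<le> m"
    using finite_measure_D' by (cases "emeasure lebesgue D'") auto
  have eD: "emeasure (lebesgue_on D') D' = ennreal m" using D m by (simp add: emeasure_restrict_space)
  \<comment> \<open>The summand \<open>m\<close> comes from \<open>t \<le> t powr q + 1\<close>,
    which passes from \<open>L\<^sub>q\<close> to \<open>L\<^sub>1\<close> on a set of finite
    measure.\<close>
  define A1 where "A1 = C0 + h0 + m"
  have A1: "0 \<le> A1" using C0 h0 m by (simp add: A1_def)
  have [measurable]: "w \<in> borel_measurable (lebesgue_on D')" by (rule weight_measurable[OF w])
  have Lq: "(\<integral>\<^sup>+x. ennreal (norm (f x) powr q) \<partial>lebesgue_on D') \<le> ennreal (C0 + h0)"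
    "(\<integral>\<^sup>+x. ennreal (norm (f x)) \<partial>lebesgue_on D') \<le> ennreal A1"
    if [measurable]: "f \<in> borel_measurable (lebesgue_on D')" and f1: "(\<integral>\<^sup>+x. ennreal (norm (f x) powr p * w x) \<partial>lebesgue_on D') \<le> 1"
    for f :: "'a \<Rightarrow> 'b::euclidean_space"
  proof -
    have "(\<integral>\<^sup>+x. ennreal (norm (f x) powr q) \<partial>lebesgue_on D') \<le> (\<integral>\<^sup>+x. ennreal C0 * ennreal (norm (f x) powr p * w x) + h x \<partial>lebesgue_on D')"
      by (rule nn_integral_mono_AE) (use h in eventually_elim, simp)
    also have "\<dots> = ennreal C0 * (\<integral>\<^sup>+x. ennreal (norm (f x) powr p * w x) \<partial>lebesgue_on D') + ennreal h0"
      by (subst nn_integral_add, measurable, subst nn_integral_cmult) (auto simp: h0)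
    also have "\<dots> \<le> ennreal C0 * 1 + ennreal h0" by (intro add_mono mult_left_mono f1) auto
    finally show 1: "(\<integral>\<^sup>+x. ennreal (norm (f x) powr q) \<partial>lebesgue_on D') \<le> ennreal (C0 + h0)" using C0 h0 by simp
    have "(\<integral>\<^sup>+x. ennreal (norm (f x)) \<partial>lebesgue_on D') \<le> (\<integral>\<^sup>+x. ennreal (norm (f x) powr q) + 1 \<partial>lebesgue_on D')"
    proof (rule nn_integral_mono)
      fix x
      have "ennreal (norm (f x)) \<le> ennreal (norm (f x) powr q + 1)" using q by (intro ennreal_leI le_powr_plus_one) auto
      then show "ennreal (norm (f x)) \<le> ennreal (norm (f x) powr q) + 1" by simp
    qed
    also have "\<dots> = (\<integral>\<^sup>+x. ennreal (norm (f x) powr q) \<partial>lebesgue_on D') + ennreal m"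
      using eD by (subst nn_integral_add) auto
    also have "\<dots> \<le> ennreal (C0 + h0) + ennreal m" by (intro add_right_mono 1)
    finally show "(\<integral>\<^sup>+x. ennreal (norm (f x)) \<partial>lebesgue_on D') \<le> ennreal A1" using C0 h0 m by (simp add: A1_def)
  qed
  define c where "c = 2 * DIM('a) * L"
  have c: "0 < c" using L0 by (simp add: c_def)
  \<comment> \<open>The sum of the bounds for the composed function and its gradient, since
    \<open>embedding_domain_bound\<close> takes a single constant for both.\<close>
  define A2 where "A2 = L ^ DIM('a) * A1 + c powr q * (L ^ DIM('a) * A1)"
  have A2: "0 \<le> L ^ DIM('a) * A1" "0 \<le> A2" using L0 A1 by (simp_all add: A2_def)
  obtain C2 where C2: "0 \<le> C2" and C2b: "\<And>g \<gamma>. has_weak_gradient_on g \<gamma> D \<Longrightarrow> (\<integral>\<^sup>+x. ennreal \<bar>g x\<bar> \<partial>lebesgue_on D) \<le> ennreal A2 \<Longrightarrow>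
     (\<integral>\<^sup>+x. ennreal (norm (\<gamma> x) powr q) \<partial>lebesgue_on D) \<le> ennreal A2 \<Longrightarrow> (\<integral>\<^sup>+x. ennreal (\<bar>g x\<bar> powr qs) \<partial>lebesgue_on D) \<le> ennreal C2"
    by (rule embedding_domain_bound[OF E q(1,3) qs A2(2)]) (rule that)
  define C where "C = L ^ DIM('a) * C2 + A1"
  have C: "0 \<le> L ^ DIM('a) * C2" "L ^ DIM('a) * C2 \<le> C" "A1 \<le> C" "0 \<le> C" using L0 C2 A1 by (simp_all add: C_def)
  have "(\<integral>\<^sup>+x. ennreal (\<bar>v x\<bar> powr qs) \<partial>lebesgue_on D') \<le> ennreal C \<and>
     (\<integral>\<^sup>+x. ennreal \<bar>v x\<bar> \<partial>lebesgue_on D') \<le> ennreal C \<and> (\<integral>\<^sup>+x. ennreal (norm (\<Gamma> x)) \<partial>lebesgue_on D') \<le> ennreal C"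
    if u: "weighted_unit v \<Gamma>" for v \<Gamma>
  proof -
    have wg: "has_weak_gradient_on v \<Gamma> D'" using u by simp
    have [measurable]: "v \<in> borel_measurable (lebesgue_on D')" "\<Gamma> \<in> borel_measurable (lebesgue_on D')"
      using wg D by (auto simp: has_weak_gradient_on_def intro: locally_summable_measurable)
    have vb: "(\<integral>\<^sup>+x. ennreal \<bar>v x\<bar> \<partial>lebesgue_on D') \<le> ennreal A1" using Lq(2)[of v] u by simp
    have \<Gamma>b: "(\<integral>\<^sup>+x. ennreal (norm (\<Gamma> x)) \<partial>lebesgue_on D') \<le> ennreal A1" using Lq(2)[of \<Gamma>] u by simp
    have \<Gamma>q: "(\<integral>\<^sup>+x. ennreal (norm (\<Gamma> x) powr q) \<partial>lebesgue_on D') \<le> ennreal A1"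
      by (rule order_trans[OF Lq(1) ennreal_leI]) (use u m in \<open>auto simp: A1_def\<close>)
    have i\<Gamma>: "integrable (lebesgue_on D') \<Gamma>"
      using le_less_trans[OF \<Gamma>b ennreal_less_top] by (simp add: integrable_iff_bounded)
    obtain \<gamma> where \<gamma>: "has_weak_gradient_on (\<lambda>x. v (\<phi> x)) \<gamma> D" "\<And>x. norm (\<gamma> x) \<le> 2 * DIM('a) * (L * norm (\<Gamma> (\<phi> x)))"
      by (rule weak_gradient_comp[OF hom D L wg i\<Gamma>]) (rule that)
    have [measurable]: "(\<lambda>x. norm (\<Gamma> (\<phi> x)) powr q) \<in> borel_measurable (lebesgue_on D)"
      using mcomp[of \<Gamma>] by measurable
    have Ln: "0 \<le> L ^ DIM('a)" "0 < L ^ DIM('a)" using L0 by simp_all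
    have 1: "(\<integral>\<^sup>+x. ennreal \<bar>v (\<phi> x)\<bar> \<partial>lebesgue_on D) \<le> ennreal A2"
    proof -
      have "(\<integral>\<^sup>+x. ennreal \<bar>v (\<phi> x)\<bar> \<partial>lebesgue_on D) \<le> ennreal (L ^ DIM('a)) * (\<integral>\<^sup>+x. ennreal \<bar>v x\<bar> \<partial>lebesgue_on D')"
        by (rule comp) measurable
      also have "\<dots> \<le> ennreal (L ^ DIM('a)) * ennreal A1" by (intro mult_left_mono vb) auto
      also have "\<dots> = ennreal (L ^ DIM('a) * A1)" using A1 Ln by (intro ennreal_mult[symmetric])
      also have "\<dots> \<le> ennreal A2" using A2(1) by (intro ennreal_leI) (simp add: A2_def)
      finally show ?thesis .
    qed
    have 2: "(\<integral>\<^sup>+x. ennreal (norm (\<gamma> x) powr q) \<partial>lebesgue_on D) \<le> ennreal A2"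
    proof -
      have "(\<integral>\<^sup>+x. ennreal (norm (\<gamma> x) powr q) \<partial>lebesgue_on D) \<le> (\<integral>\<^sup>+x. ennreal (c powr q) * ennreal (norm (\<Gamma> (\<phi> x)) powr q) \<partial>lebesgue_on D)"
      proof (rule nn_integral_mono)
        fix x
        have "norm (\<gamma> x) powr q \<le> (c * norm (\<Gamma> (\<phi> x))) powr q"
          using \<gamma>(2)[of x] q by (intro powr_mono2) (auto simp: c_def mult.assoc)
        also have "\<dots> = c powr q * norm (\<Gamma> (\<phi> x)) powr q" using c by (simp add: powr_mult)
        finally show "ennreal (norm (\<gamma> x) powr q) \<le> ennreal (c powr q) * ennreal (norm (\<Gamma> (\<phi> x)) powr q)"
          by (simp add: ennreal_leI ennreal_mult[symmetric])
      qed
      also have "\<dots> = ennreal (c powr q) * (\<integral>\<^sup>+x. ennreal (norm (\<Gamma> (\<phi> x)) powr q) \<partial>lebesgue_on D)"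
        by (rule nn_integral_cmult) measurable
      also have "\<dots> \<le> ennreal (c powr q) * (ennreal (L ^ DIM('a)) * (\<integral>\<^sup>+x. ennreal (norm (\<Gamma> x) powr q) \<partial>lebesgue_on D'))"
        by (intro mult_left_mono comp) auto
      also have "\<dots> \<le> ennreal (c powr q) * (ennreal (L ^ DIM('a)) * ennreal A1)" by (intro mult_left_mono \<Gamma>q) auto
      also have "\<dots> = ennreal (c powr q * (L ^ DIM('a) * A1))" using A1 Ln by (simp add: ennreal_mult)
      also have "\<dots> \<le> ennreal A2" using A2(1) by (intro ennreal_leI) (simp add: A2_def)
      finally show ?thesis .
    qed
    have "(\<integral>\<^sup>+x. ennreal (\<bar>v x\<bar> powr qs) \<partial>lebesgue_on D') \<le> ennreal (L ^ DIM('a)) * (\<integral>\<^sup>+x. ennreal (\<bar>v (\<phi> x)\<bar> powr qs) \<partial>lebesgue_on D)"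
      by (rule nn_integral_lipschitz_image[OF hom D L]) measurable
    also have "\<dots> \<le> ennreal (L ^ DIM('a)) * ennreal C2" by (intro mult_left_mono C2b[OF \<gamma>(1) 1 2]) auto
    also have "\<dots> = ennreal (L ^ DIM('a) * C2)" using C2 Ln by (intro ennreal_mult[symmetric])
    also have "\<dots> \<le> ennreal C" using C by (intro ennreal_leI)
    finally show ?thesis
      using order_trans[OF vb ennreal_leI[OF C(3)]] order_trans[OF \<Gamma>b ennreal_leI[OF C(3)]] by blast
  qed
  then show ?thesis using C(4) by blast
qed

lemma weight_bound:
  obtains h where "h \<in> borel_measurable (lebesgue_on D')" "(\<integral>\<^sup>+x. h x \<partial>lebesgue_on D') < \<infinity>"
    "\<And>e::real. 0 < e \<Longrightarrow> \<exists>M\<ge>0. AE x in lebesgue_on D'. \<forall>t\<ge>0. ennreal (t powr s * w x) \<le> ennreal M * ennreal (t powr r) + ennreal e * h x"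
proof -
  have "Lnorm (ennreal (r * s) / ennreal (r - s)) D' (\<lambda>x. epowr (ennreal (w x)) (1 / s)) < \<infinity>"
    using K by (simp add: Kconst_def)
  then show ?thesis by (rule Lnorm_weight_bound[OF w s r(1)]) (rule that)
qed

lemma weighted_unit_Ls:
  "\<exists>C\<ge>0. \<forall>v \<Gamma>. weighted_unit v \<Gamma> \<longrightarrow> (\<integral>\<^sup>+x. ennreal (norm (v x) powr s * w x) \<partial>lebesgue_on D') \<le> ennreal C"
proof -
  obtain C1 where C1: "0 \<le> C1" and b: "\<And>v \<Gamma>. weighted_unit v \<Gamma> \<Longrightarrow> (\<integral>\<^sup>+x. ennreal (\<bar>v x\<bar> powr qs) \<partial>lebesgue_on D') \<le> ennreal C1"
    using weighted_unit_bounds by blast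
  obtain h where [measurable]: "h \<in> borel_measurable (lebesgue_on D')" and hf: "(\<integral>\<^sup>+x. h x \<partial>lebesgue_on D') < \<infinity>"
    and h: "\<And>e::real. 0 < e \<Longrightarrow> \<exists>M\<ge>0. AE x in lebesgue_on D'. \<forall>t\<ge>0. ennreal (t powr s * w x) \<le> ennreal M * ennreal (t powr r) + ennreal e * h x"
    by (rule weight_bound) (rule that)
  \<comment> \<open>For boundedness any value of the small parameter will do; 1 is taken.\<close>
  obtain M where M: "0 \<le> M" "AE x in lebesgue_on D'. \<forall>t\<ge>0. ennreal (t powr s * w x) \<le> ennreal M * ennreal (t powr r) + ennreal 1 * h x"
    using h[of 1] by auto
  obtain h0 where h0: "(\<integral>\<^sup>+x. h x \<partial>lebesgue_on D') = ennreal h0" "0 \<le> h0"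
    using hf by (cases "\<integral>\<^sup>+x. h x \<partial>lebesgue_on D'") auto
  obtain m where m: "emeasure lebesgue D' = ennreal m" "0 \<le> m"
    using finite_measure_D' by (cases "emeasure lebesgue D'") auto
  have eD: "emeasure (lebesgue_on D') D' = ennreal m" using open_D' m by (simp add: emeasure_restrict_space)
  have "(\<integral>\<^sup>+x. ennreal (norm (v x) powr s * w x) \<partial>lebesgue_on D') \<le> ennreal (M * (C1 + m) + h0)" if u: "weighted_unit v \<Gamma>" for v \<Gamma>
  proof -
    have [measurable]: "v \<in> borel_measurable (lebesgue_on D')"
      using u open_D' by (auto simp: has_weak_gradient_on_def intro: locally_summable_measurable)
    have "(\<integral>\<^sup>+x. ennreal (norm (v x) powr s * w x) \<partial>lebesgue_on D') \<le> (\<integral>\<^sup>+x. ennreal M * (ennreal (\<bar>v x\<bar> powr qs) + 1) + h x \<partial>lebesgue_on D')"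
    proof (rule nn_integral_mono_AE)
      show "AE x in lebesgue_on D'. ennreal (norm (v x) powr s * w x) \<le> ennreal M * (ennreal (\<bar>v x\<bar> powr qs) + 1) + h x"
        using M(2)
      proof eventually_elim
        case (elim x)
        have "ennreal (\<bar>v x\<bar> powr r) \<le> ennreal (\<bar>v x\<bar> powr qs + 1)" using s r by (intro ennreal_leI powr_le_powr_plus_one) auto
        then have "ennreal M * ennreal (\<bar>v x\<bar> powr r) \<le> ennreal M * (ennreal (\<bar>v x\<bar> powr qs) + 1)" by (intro mult_left_mono) auto
        then have "ennreal M * ennreal (\<bar>v x\<bar> powr r) + h x \<le> ennreal M * (ennreal (\<bar>v x\<bar> powr qs) + 1) + h x" by (rule add_right_mono)
        moreover have "ennreal (norm (v x) powr s * w x) \<le> ennreal M * ennreal (\<bar>v x\<bar> powr r) + h x" using elim by simp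
        ultimately show ?case by (rule order_trans[rotated])
      qed
    qed
    also have "\<dots> = ennreal M * ((\<integral>\<^sup>+x. ennreal (\<bar>v x\<bar> powr qs) \<partial>lebesgue_on D') + ennreal m) + ennreal h0"
      using eD by (subst nn_integral_add, measurable, subst nn_integral_cmult, measurable, subst nn_integral_add) (auto simp: h0)
    also have "\<dots> \<le> ennreal M * (ennreal C1 + ennreal m) + ennreal h0"
      by (intro add_right_mono mult_left_mono b[OF u]) auto
    also have "\<dots> = ennreal (M * (C1 + m) + h0)" using M C1 m h0 by (simp add: ennreal_mult)
    finally show ?thesis .
  qed
  moreover have "0 \<le> M * (C1 + m) + h0" using M C1 m h0 by simp
  ultimately show ?thesis by blast
qed

lemma weighted_unit_scale:
  assumes f: "f \<in> W1space p D' w" "W1norm p D' w f \<le> ennreal l" and l: "0 < l"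
  shows "weighted_unit (\<lambda>x. (1 / l) * f x) (\<lambda>x. (1 / l) *\<^sub>R weak_gradient D' f x)"
proof -
  have wg: "has_weak_gradient_on f (weak_gradient D' f) D'"
    using f by (intro weak_gradient_works) (simp add: W1space_def)
  have m: "f \<in> borel_measurable (lebesgue_on D')" "weak_gradient D' f \<in> borel_measurable (lebesgue_on D')" "w \<in> borel_measurable (lebesgue_on D')"
    using wg open_D' w by (auto simp: has_weak_gradient_on_def intro: locally_summable_measurable weight_measurable)
  have n: "wLnorm p D' w f \<le> ennreal l" "wLnorm p D' w (weak_gradient D' f) \<le> ennreal l"
    using f(2) unfolding W1norm_def by (auto intro: order_trans[rotated] simp: add_increasing add_increasing2)
  have one: "(1 / l) powr p * l powr p = 1" using l by (simp add: powr_divide)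
  have sc: "(\<integral>\<^sup>+x. ennreal (norm ((1 / l) *\<^sub>R g x) powr p * w x) \<partial>lebesgue_on D') \<le> 1"
    if g: "g \<in> borel_measurable (lebesgue_on D')" "wLnorm p D' w g \<le> ennreal l" for g :: "'a \<Rightarrow> 'b::euclidean_space"
  proof -
    have "(\<integral>\<^sup>+x. ennreal (norm ((1 / l) *\<^sub>R g x) powr p * w x) \<partial>lebesgue_on D') = ennreal ((1 / l) powr p) * (\<integral>\<^sup>+x. ennreal (norm (g x) powr p * w x) \<partial>lebesgue_on D')"
      using l weight_nonneg[OF w] by (intro nn_integral_powr_scale g m) auto
    also have "\<dots> \<le> ennreal ((1 / l) powr p) * ennreal (l powr p)"
      using g(2) p l by (intro mult_left_mono) (auto simp: wLnorm_le_iff)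
    also have "\<dots> = 1" unfolding ennreal_mult[symmetric, OF powr_ge_zero powr_ge_zero] one by simp
    finally show ?thesis .
  qed
  show ?thesis using has_weak_gradient_scale[OF wg, of "1 / l"] sc[OF m(1) n(1)] sc[OF m(2) n(2)] by simp
qed

lemma wLnorm_scale_le:
  assumes f: "f \<in> borel_measurable (lebesgue_on D')" and l: "0 < l" and C: "0 \<le> C"
    and le: "(\<integral>\<^sup>+x. ennreal (norm ((1 / l) * f x) powr s * w x) \<partial>lebesgue_on D') \<le> ennreal C"
  shows "wLnorm s D' w f \<le> ennreal (C powr (1 / s) * l)"
proof -
  have m: "w \<in> borel_measurable (lebesgue_on D')" by (rule weight_measurable[OF w])
  have "(\<integral>\<^sup>+x. ennreal (norm (f x) powr s * w x) \<partial>lebesgue_on D') = (\<integral>\<^sup>+x. ennreal (norm (l *\<^sub>R ((1 / l) * f x)) powr s * w x) \<partial>lebesgue_on D')"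
    using l by simp
  also have "\<dots> = ennreal (l powr s) * (\<integral>\<^sup>+x. ennreal (norm ((1 / l) * f x) powr s * w x) \<partial>lebesgue_on D')"
    using l weight_nonneg[OF w] f by (intro nn_integral_powr_scale m) auto
  also have "\<dots> \<le> ennreal (l powr s) * ennreal C" by (intro mult_left_mono le) auto
  also have "\<dots> = ennreal ((C powr (1 / s) * l) powr s)"
    using C l s by (simp add: powr_mult powr_powr ennreal_mult[symmetric] mult.commute)
  finally show ?thesis using C l s by (subst wLnorm_le_iff) auto
qed

lemma bounded_embedding_weighted:
  "bounded_embedding (W1space p D' w) (W1norm p D' w) (wLspace s D' w) (wLnorm s D' w)"
proof -
  obtain C1 where C1: "0 \<le> C1" and b: "\<And>v \<Gamma>. weighted_unit v \<Gamma> \<Longrightarrow> (\<integral>\<^sup>+x. ennreal (norm (v x) powr s * w x) \<partial>lebesgue_on D') \<le> ennreal C1"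
    using weighted_unit_Ls by blast
  define C where "C = C1 powr (1 / s)"
  have C: "0 \<le> C" by (simp add: C_def)
  have meas: "f \<in> borel_measurable (lebesgue_on D')" if "f \<in> W1space p D' w" for f
    using that open_D' by (intro locally_summable_measurable) (auto simp: W1space_def)
  have le: "wLnorm s D' w f \<le> ennreal (C * l)" if "f \<in> W1space p D' w" "W1norm p D' w f \<le> ennreal l" "0 < l" for f l
    unfolding C_def by (rule wLnorm_scale_le[OF meas[OF that(1)] that(3) C1 b[OF weighted_unit_scale[OF that]]])
  have bd: "wLnorm s D' w f \<le> ennreal C * W1norm p D' w f" if f: "f \<in> W1space p D' w" for f
  proof -
    obtain N where N: "W1norm p D' w f = ennreal N" "0 \<le> N" using f by (cases "W1norm p D' w f") (auto simp: W1space_def)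
    \<comment> \<open>Scaling by the norm itself would fail for norm 0. It is enlarged by a positive
      amount whose contribution to the result stays below \<open>e\<close>.\<close>
    have small: "wLnorm s D' w f \<le> ennreal (C * N) + ennreal e" if e: "0 < e" for e :: real
    proof -
      have "wLnorm s D' w f \<le> ennreal (C * (N + e / (C + 1)))"
      proof (rule le[OF f])
        have "0 < e / (C + 1)" using e C by simp
        then show "W1norm p D' w f \<le> ennreal (N + e / (C + 1))" "0 < N + e / (C + 1)"
          using N by (simp_all add: ennreal_leI)
      qed
      also have "C * (N + e / (C + 1)) = C * N + e * (C / (C + 1))" by (simp add: distrib_left)
      also have "\<dots> \<le> C * N + e * 1" using C e by (intro add_left_mono mult_left_mono) (auto simp: divide_le_eq)
      finally show ?thesis using C N e by (simp add: ennreal_leI)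
    qed
    have "wLnorm s D' w f \<le> ennreal (C * N)" by (rule ennreal_le_epsilon) (rule small)
    then show ?thesis using N C by (simp add: ennreal_mult)
  qed
  have "f \<in> wLspace s D' w" if f: "f \<in> W1space p D' w" for f
  proof -
    have "ennreal C * W1norm p D' w f < \<infinity>" using f by (simp add: W1space_def ennreal_mult_less_top)
    then show ?thesis using bd[OF f] meas[OF f] by (auto simp: wLspace_def)
  qed
  then show ?thesis unfolding bounded_embedding_def using bd by blast
qed

section \<open>Compactness below the critical exponent\<close>

lemma compact_embedding_weighted:
  assumes rq: "r < qs"
  shows "compact_embedding (W1space p D' w) (W1norm p D' w) (wLspace s D' w) (wLnorm s D' w)"
  unfolding compact_embedding_def
proof (intro conjI bounded_embedding_weighted allI impI)
  fix u assume "(\<forall>k::nat. u k \<in> W1space p D' w) \<and> (\<exists>B::real. \<forall>k. W1norm p D' w (u k) \<le> ennreal B)"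
  then obtain B :: real where u: "\<And>k. u k \<in> W1space p D' w" and B: "\<And>k. W1norm p D' w (u k) \<le> ennreal B" by blast
  let ?M = "lebesgue_on D'"
  define l where "l = \<bar>B\<bar> + 1"
  have l: "0 < l" by (simp add: l_def)
  have ul: "W1norm p D' w (u k) \<le> ennreal l" for k
    by (rule order_trans[OF B ennreal_leI]) (simp add: l_def)
  define v where "v k x = (1 / l) * u k x" for k x
  define \<Gamma> where "\<Gamma> k x = (1 / l) *\<^sub>R weak_gradient D' (u k) x" for k x
  have unit: "weighted_unit (v k) (\<Gamma> k)" for k
    unfolding v_def \<Gamma>_def by (rule weighted_unit_scale[OF u ul l])
  have wg: "has_weak_gradient_on (v k) (\<Gamma> k) D'" for k using unit[of k] by simp
  have vm [measurable]: "v k \<in> borel_measurable ?M" for k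
    using wg[of k] open_D' by (auto simp: has_weak_gradient_on_def intro: locally_summable_measurable)
  have um: "u k \<in> borel_measurable ?M" for k
    using u[of k] open_D' by (auto simp: W1space_def intro: locally_summable_measurable)
  have wm [measurable]: "w \<in> borel_measurable ?M" by (rule weight_measurable[OF w])
  have w0: "0 \<le> w x" for x by (rule weight_nonneg[OF w])
  obtain C where C: "0 \<le> C" and Cb: "\<And>v \<Gamma>. weighted_unit v \<Gamma> \<Longrightarrow> (\<integral>\<^sup>+x. ennreal (\<bar>v x\<bar> powr qs) \<partial>?M) \<le> ennreal C \<and>
     (\<integral>\<^sup>+x. ennreal \<bar>v x\<bar> \<partial>?M) \<le> ennreal C \<and> (\<integral>\<^sup>+x. ennreal (norm (\<Gamma> x)) \<partial>?M) \<le> ennreal C"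
    using weighted_unit_bounds by blast
  have Cq: "(\<integral>\<^sup>+x. ennreal (\<bar>v k x\<bar> powr qs) \<partial>?M) \<le> ennreal C" and C1: "(\<integral>\<^sup>+x. ennreal \<bar>v k x\<bar> \<partial>?M) \<le> ennreal C"
    and CG: "(\<integral>\<^sup>+x. ennreal (norm (\<Gamma> k x)) \<partial>?M) \<le> ennreal C" for k
    using Cb[OF unit[of k]] by auto
  obtain Cs where Cs: "0 \<le> Cs" and Csb: "\<And>v \<Gamma>. weighted_unit v \<Gamma> \<Longrightarrow> (\<integral>\<^sup>+x. ennreal (norm (v x) powr s * w x) \<partial>?M) \<le> ennreal Cs"
    using weighted_unit_Ls by blast
  \<comment> \<open>Uniform integrability from the bound in a power above 1: \<open>e1\<close> makes
    the superlinear part at most \<open>e / 2\<close>, and \<open>d\<close> does the same for the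
    constant \<open>K1\<close> on a small set.\<close>
  have ui: "\<exists>d>0. \<forall>k. \<forall>S\<in>sets lebesgue. S \<subseteq> D' \<and> emeasure lebesgue S < ennreal d \<longrightarrow>
       (\<integral>\<^sup>+x. ennreal \<bar>v k x\<bar> * indicator S x \<partial>?M) \<le> ennreal e" if e: "0 < e" for e :: real
  proof -
    define e1 where "e1 = e / (2 * (C + 1))"
    have e1: "0 < e1" using e C by (simp add: e1_def)
    have "e1 * C = (e / 2) * (C / (C + 1))" by (simp add: e1_def)
    also have "\<dots> \<le> (e / 2) * 1" using e C by (intro mult_left_mono) (auto simp: divide_le_eq)
    finally have e1C: "e1 * C \<le> e / 2" by simp
    obtain K1 where K1: "0 \<le> K1" "\<And>t. 0 \<le> t \<Longrightarrow> t powr 1 \<le> e1 * t powr qs + K1"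
      by (rule powr_absorb[OF order_refl qs_gt_one e1]) (rule that)
    define d where "d = e / (2 * (K1 + 1))"
    have d: "0 < d" using e K1 by (simp add: d_def)
    have "K1 * d = (e / 2) * (K1 / (K1 + 1))" by (simp add: d_def)
    also have "\<dots> \<le> (e / 2) * 1" using e K1 by (intro mult_left_mono) (auto simp: divide_le_eq)
    finally have K1d: "K1 * d \<le> e / 2" by simp
    have "(\<integral>\<^sup>+x. ennreal \<bar>v k x\<bar> * indicator S x \<partial>?M) \<le> ennreal e"
      if S: "S \<in> sets lebesgue" "S \<subseteq> D'" "emeasure lebesgue S < ennreal d" for k S
    proof -
      have S' [measurable]: "S \<in> sets ?M" using S open_D' by (simp add: sets_restrict_space_iff)
      have "(\<integral>\<^sup>+x. ennreal \<bar>v k x\<bar> * indicator S x \<partial>?M) \<le> (\<integral>\<^sup>+x. ennreal e1 * ennreal (\<bar>v k x\<bar> powr qs) + ennreal K1 * indicator S x \<partial>?M)"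
      proof (rule nn_integral_mono)
        fix x
        have "ennreal \<bar>v k x\<bar> \<le> ennreal (e1 * \<bar>v k x\<bar> powr qs + K1)"
          using K1(2)[of "\<bar>v k x\<bar>"] by (intro ennreal_leI) simp
        then show "ennreal \<bar>v k x\<bar> * indicator S x \<le> ennreal e1 * ennreal (\<bar>v k x\<bar> powr qs) + ennreal K1 * indicator S x"
          using e1 K1 by (cases "x \<in> S") (auto simp: ennreal_mult)
      qed
      also have "\<dots> = ennreal e1 * (\<integral>\<^sup>+x. ennreal (\<bar>v k x\<bar> powr qs) \<partial>?M) + ennreal K1 * emeasure ?M S"
        using nn_integral_cmult_indicator[OF S', of "ennreal K1"]
        by (subst nn_integral_add, measurable, subst nn_integral_cmult) auto
      also have "emeasure ?M S = emeasure lebesgue S" using S open_D' by (simp add: emeasure_restrict_space)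
      also have "ennreal e1 * (\<integral>\<^sup>+x. ennreal (\<bar>v k x\<bar> powr qs) \<partial>?M) + ennreal K1 * emeasure lebesgue S \<le> ennreal e1 * ennreal C + ennreal K1 * ennreal d"
        by (intro add_mono mult_left_mono Cq less_imp_le[OF S(3)]) auto
      also have "\<dots> = ennreal (e1 * C + K1 * d)" using e1 C K1 d by (simp add: ennreal_mult)
      also have "\<dots> \<le> ennreal e" using e1C K1d by (intro ennreal_leI) linarith
      finally show ?thesis .
    qed
    then show ?thesis using d by blast
  qed
  obtain \<sigma> :: "nat \<Rightarrow> nat" where \<sigma>: "strict_mono \<sigma>"
    and \<sigma>c: "\<And>e::real. 0 < e \<Longrightarrow> \<exists>K. \<forall>m\<ge>K. \<forall>n\<ge>K. (\<integral>\<^sup>+x. ennreal \<bar>v (\<sigma> m) x - v (\<sigma> n) x\<bar> \<partial>?M) \<le> ennreal e"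
    by (rule rellich_L1[OF open_D' finite_measure_D' wg C C1 CG ui]) (assumption, rule that)
  \<comment> \<open>A second extraction turns the Cauchy property into almost everywhere
    convergence, which identifies the candidate limit.\<close>
  obtain \<tau> g where \<tau>: "strict_mono \<tau>" and gm [measurable]: "g \<in> borel_measurable ?M" and lim: "AE x in ?M. (\<lambda>k. v (\<sigma> (\<tau> k)) x) \<longlonglongrightarrow> g x"
    by (rule L1_Cauchy_AE_subseq[OF vm \<sigma>c]) (assumption, rule that)
  define \<rho> where "\<rho> = \<sigma> \<circ> \<tau>"
  have \<rho>: "strict_mono \<rho>" using \<sigma> \<tau> by (simp add: \<rho>_def strict_mono_o)
  have \<rho>c: "\<exists>K. \<forall>m\<ge>K. \<forall>n\<ge>K. (\<integral>\<^sup>+x. ennreal \<bar>v (\<rho> m) x - v (\<rho> n) x\<bar> \<partial>?M) \<le> ennreal e" if "0 < e" for e :: real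
  proof -
    obtain K where K: "\<And>m n. K \<le> m \<Longrightarrow> K \<le> n \<Longrightarrow> (\<integral>\<^sup>+x. ennreal \<bar>v (\<sigma> m) x - v (\<sigma> n) x\<bar> \<partial>?M) \<le> ennreal e"
      using \<sigma>c[OF \<open>0 < e\<close>] by blast
    have "K \<le> \<tau> m" if "K \<le> m" for m using order_trans[OF that seq_suble[OF \<tau>]] .
    then show ?thesis unfolding \<rho>_def comp_def using K by blast
  qed
  obtain h where [measurable]: "h \<in> borel_measurable ?M" and hf: "(\<integral>\<^sup>+x. h x \<partial>?M) < \<infinity>"
    and h: "\<And>e::real. 0 < e \<Longrightarrow> \<exists>M\<ge>0. AE x in ?M. \<forall>t\<ge>0. ennreal (t powr s * w x) \<le> ennreal M * ennreal (t powr r) + ennreal e * h x"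
    by (rule weight_bound) (rule that)
  obtain h0 where h0: "(\<integral>\<^sup>+x. h x \<partial>?M) = ennreal h0" "0 \<le> h0"
    using hf by (cases "\<integral>\<^sup>+x. h x \<partial>?M") auto
  define C' where "C' = 2 powr qs * (C + C)"
  have C': "0 \<le> C'" using C by (simp add: C'_def)
  have diffq: "(\<integral>\<^sup>+x. ennreal (\<bar>v m x - v n x\<bar> powr qs) \<partial>?M) \<le> ennreal C'" for m n
  proof -
    have "(\<integral>\<^sup>+x. ennreal (\<bar>v m x - v n x\<bar> powr qs) \<partial>?M) \<le> (\<integral>\<^sup>+x. ennreal (2 powr qs) * (ennreal (\<bar>v m x\<bar> powr qs) + ennreal (\<bar>v n x\<bar> powr qs)) \<partial>?M)"
    proof (rule nn_integral_mono)
      fix x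
      have "\<bar>v m x - v n x\<bar> powr qs \<le> (\<bar>v m x\<bar> + \<bar>v n x\<bar>) powr qs" using qs_gt_one by (intro powr_mono2) auto
      also have "\<dots> \<le> 2 powr qs * (\<bar>v m x\<bar> powr qs + \<bar>v n x\<bar> powr qs)" using qs_gt_one by (intro powr_add_le) auto
      finally show "ennreal (\<bar>v m x - v n x\<bar> powr qs) \<le> ennreal (2 powr qs) * (ennreal (\<bar>v m x\<bar> powr qs) + ennreal (\<bar>v n x\<bar> powr qs))"
        by (simp add: ennreal_leI ennreal_mult[symmetric] flip: ennreal_plus)
    qed
    also have "\<dots> = ennreal (2 powr qs) * ((\<integral>\<^sup>+x. ennreal (\<bar>v m x\<bar> powr qs) \<partial>?M) + (\<integral>\<^sup>+x. ennreal (\<bar>v n x\<bar> powr qs) \<partial>?M))"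
      by (subst nn_integral_cmult, measurable, subst nn_integral_add) auto
    also have "\<dots> \<le> ennreal (2 powr qs) * (ennreal C + ennreal C)" by (intro mult_left_mono add_mono Cq) auto
    also have "\<dots> = ennreal C'" by (simp only: C'_def ennreal_mult[OF powr_ge_zero add_nonneg_nonneg[OF C C]] ennreal_plus[OF C C])
    finally show ?thesis .
  qed
  \<comment> \<open>The small constants are chosen in order, each depending on the previous large
    one: \<open>eh\<close> fixes \<open>M0\<close>, then \<open>e2\<close> fixes \<open>K2\<close>,
    and finally \<open>e3\<close> is the required closeness in \<open>L\<^sub>1\<close>. Each of the
    three terms is at most \<open>e / 3\<close>.\<close>
  have cauchy_s: "\<exists>K. \<forall>m\<ge>K. \<forall>n\<ge>K. (\<integral>\<^sup>+x. ennreal (\<bar>v (\<rho> m) x - v (\<rho> n) x\<bar> powr s * w x) \<partial>?M) \<le> ennreal e" if e: "0 < e" for e :: real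
  proof -
    have frac: "(e / 3) * (a / (a + 1)) \<le> e / 3" if "0 \<le> a" for a
    proof -
      have "(e / 3) * (a / (a + 1)) \<le> (e / 3) * 1" using e that by (intro mult_left_mono) (auto simp: divide_le_eq)
      then show ?thesis by simp
    qed
    define eh where "eh = e / (3 * (h0 + 1))"
    have eh: "0 < eh" using e h0 by (simp add: eh_def)
    have ehb: "eh * h0 \<le> e / 3" using frac[OF h0(2)] by (simp add: eh_def)
    obtain M0 where M0: "0 \<le> M0" and M: "AE x in ?M. \<forall>t\<ge>0. ennreal (t powr s * w x) \<le> ennreal M0 * ennreal (t powr r) + ennreal eh * h x"
      using h[OF eh] by blast
    define e2 where "e2 = e / (3 * (M0 * C' + 1))"
    have MC: "0 \<le> M0 * C'" using M0 C' by simp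
    have e2: "0 < e2" using e MC by (simp add: e2_def)
    have e2b: "M0 * (e2 * C') \<le> e / 3" using frac[OF MC] by (simp add: e2_def mult_ac)
    obtain K2 where K2: "0 \<le> K2" "\<And>t. 0 \<le> t \<Longrightarrow> t powr r \<le> e2 * t powr qs + K2 * t"
      by (rule powr_absorb[OF order_trans[OF s r(1)] rq e2]) (rule that)
    define e3 where "e3 = e / (3 * (M0 * K2 + 1))"
    have MK: "0 \<le> M0 * K2" using M0 K2 by simp
    have e3: "0 < e3" using e MK by (simp add: e3_def)
    have e3b: "M0 * (K2 * e3) \<le> e / 3" using frac[OF MK] by (simp add: e3_def mult_ac)
    obtain K where K: "\<And>m n. K \<le> m \<Longrightarrow> K \<le> n \<Longrightarrow> (\<integral>\<^sup>+x. ennreal \<bar>v (\<rho> m) x - v (\<rho> n) x\<bar> \<partial>?M) \<le> ennreal e3"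
      using \<rho>c[OF e3] by blast
    have "(\<integral>\<^sup>+x. ennreal (\<bar>v (\<rho> m) x - v (\<rho> n) x\<bar> powr s * w x) \<partial>?M) \<le> ennreal e" if mn: "K \<le> m" "K \<le> n" for m n
    proof -
      let ?t = "\<lambda>x. \<bar>v (\<rho> m) x - v (\<rho> n) x\<bar>"
      have "(\<integral>\<^sup>+x. ennreal (?t x powr s * w x) \<partial>?M) \<le> (\<integral>\<^sup>+x. ennreal M0 * (ennreal e2 * ennreal (?t x powr qs) + ennreal K2 * ennreal (?t x)) + ennreal eh * h x \<partial>?M)"
      proof (rule nn_integral_mono_AE)
        show "AE x in ?M. ennreal (?t x powr s * w x) \<le> ennreal M0 * (ennreal e2 * ennreal (?t x powr qs) + ennreal K2 * ennreal (?t x)) + ennreal eh * h x"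
          using M
        proof eventually_elim
          case (elim x)
          have "ennreal (?t x powr r) \<le> ennreal (e2 * ?t x powr qs + K2 * ?t x)" by (intro ennreal_leI K2(2)) simp
          also have "\<dots> = ennreal e2 * ennreal (?t x powr qs) + ennreal K2 * ennreal (?t x)" using e2 K2(1) by (simp add: ennreal_mult)
          finally have "ennreal M0 * ennreal (?t x powr r) + ennreal eh * h x \<le> ennreal M0 * (ennreal e2 * ennreal (?t x powr qs) + ennreal K2 * ennreal (?t x)) + ennreal eh * h x"
            by (intro add_right_mono mult_left_mono) auto
          moreover have "ennreal (?t x powr s * w x) \<le> ennreal M0 * ennreal (?t x powr r) + ennreal eh * h x" using elim by simp
          ultimately show ?case by (rule order_trans[rotated])
        qed
      qed
      also have "\<dots> = ennreal M0 * (ennreal e2 * (\<integral>\<^sup>+x. ennreal (?t x powr qs) \<partial>?M) + ennreal K2 * (\<integral>\<^sup>+x. ennreal (?t x) \<partial>?M)) + ennreal eh * ennreal h0"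
        by (simp add: nn_integral_add nn_integral_cmult h0)
      also have "\<dots> \<le> ennreal M0 * (ennreal e2 * ennreal C' + ennreal K2 * ennreal e3) + ennreal eh * ennreal h0"
        by (intro add_mono mult_left_mono diffq K mn order_refl) auto
      also have "\<dots> = ennreal (M0 * (e2 * C') + M0 * (K2 * e3) + eh * h0)"
        using M0 e2 C' K2 e3 eh h0 by (simp add: ennreal_mult distrib_left)
      also have "\<dots> \<le> ennreal e" using e2b e3b ehb by (intro ennreal_leI) linarith
      finally show ?thesis .
    qed
    then show ?thesis by blast
  qed
  \<comment> \<open>Fatou's lemma in the second index turns the Cauchy estimate into convergence to
    the almost everywhere limit.\<close>
  have conv_s: "\<exists>K. \<forall>m\<ge>K. (\<integral>\<^sup>+x. ennreal (\<bar>v (\<rho> m) x - g x\<bar> powr s * w x) \<partial>?M) \<le> ennreal e" if e: "0 < e" for e :: real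
  proof -
    obtain K where K: "\<And>m n. K \<le> m \<Longrightarrow> K \<le> n \<Longrightarrow> (\<integral>\<^sup>+x. ennreal (\<bar>v (\<rho> m) x - v (\<rho> n) x\<bar> powr s * w x) \<partial>?M) \<le> ennreal e"
      using cauchy_s[OF e] by blast
    have "(\<integral>\<^sup>+x. ennreal (\<bar>v (\<rho> m) x - g x\<bar> powr s * w x) \<partial>?M) \<le> ennreal e" if m: "K \<le> m" for m
    proof -
      let ?f = "\<lambda>n x. ennreal (\<bar>v (\<rho> m) x - v (\<rho> n) x\<bar> powr s * w x)"
      have "(\<integral>\<^sup>+x. ennreal (\<bar>v (\<rho> m) x - g x\<bar> powr s * w x) \<partial>?M) = (\<integral>\<^sup>+x. liminf (\<lambda>n. ?f n x) \<partial>?M)"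
      proof (rule nn_integral_cong_AE)
        show "AE x in ?M. ennreal (\<bar>v (\<rho> m) x - g x\<bar> powr s * w x) = liminf (\<lambda>n. ?f n x)"
          using lim
        proof eventually_elim
          case (elim x)
          have "(\<lambda>n. \<bar>v (\<rho> m) x - v (\<rho> n) x\<bar>) \<longlonglongrightarrow> \<bar>v (\<rho> m) x - g x\<bar>"
            using elim unfolding \<rho>_def comp_def by (intro tendsto_intros)
          then have "(\<lambda>n. \<bar>v (\<rho> m) x - v (\<rho> n) x\<bar> powr s) \<longlonglongrightarrow> \<bar>v (\<rho> m) x - g x\<bar> powr s"
            using s by (intro tendsto_powr' tendsto_const) auto
          then have "(\<lambda>n. ?f n x) \<longlonglongrightarrow> ennreal (\<bar>v (\<rho> m) x - g x\<bar> powr s * w x)"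
            by (intro tendsto_ennrealI tendsto_mult_right)
          then show ?case by (intro lim_imp_Liminf[symmetric]) auto
        qed
      qed
      also have "\<dots> \<le> liminf (\<lambda>n. \<integral>\<^sup>+x. ?f n x \<partial>?M)" by (rule nn_integral_liminf) measurable
      also have "\<dots> \<le> liminf (\<lambda>n. ennreal e)"
        using K[OF m] by (intro Liminf_mono) (auto simp: eventually_sequentially)
      also have "\<dots> = ennreal e" by (simp add: Liminf_const)
      finally show ?thesis .
    qed
    then show ?thesis by blast
  qed
  show "\<exists>g\<in>wLspace s D' w. \<exists>\<sigma>. strict_mono \<sigma> \<and> (\<lambda>k. wLnorm s D' w (\<lambda>x. u (\<sigma> k) x - g x)) \<longlonglongrightarrow> 0"
  \<comment> \<open>The factor \<open>l\<close> undoes the normalisation of the sequence.\<close>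
  proof (intro bexI[of _ "\<lambda>x. l * g x"] exI[of _ \<rho>] conjI \<rho>)
    show "(\<lambda>k. wLnorm s D' w (\<lambda>x. u (\<rho> k) x - l * g x)) \<longlonglongrightarrow> 0"
    proof (rule order_tendstoI)
      fix a :: ennreal assume "0 < a"
      then obtain b where b: "0 < b" "b < a" using dense by blast
      then obtain b' where b': "b = ennreal b'" "0 \<le> b'" by (cases b) auto
      have b'0: "0 < b'" using b b' by (simp add: ennreal_less_zero_iff)
      define e where "e = (b' / l) powr s"
      have e: "0 < e" "e powr (1 / s) * l = b'" using b'0 l s by (auto simp: e_def powr_powr)
      obtain K where K: "\<And>m. K \<le> m \<Longrightarrow> (\<integral>\<^sup>+x. ennreal (\<bar>v (\<rho> m) x - g x\<bar> powr s * w x) \<partial>?M) \<le> ennreal e"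
        using conv_s[OF e(1)] by blast
      have "wLnorm s D' w (\<lambda>x. u (\<rho> m) x - l * g x) \<le> ennreal b'" if "K \<le> m" for m
        unfolding e(2)[symmetric]
      proof (rule wLnorm_scale_le)
        show "(\<lambda>x. u (\<rho> m) x - l * g x) \<in> borel_measurable ?M" using um[of "\<rho> m"] by measurable
        have "(1 / l) * (u (\<rho> m) x - l * g x) = v (\<rho> m) x - g x" for x using l by (simp add: v_def field_simps)
        then show "(\<integral>\<^sup>+x. ennreal (norm ((1 / l) * (u (\<rho> m) x - l * g x)) powr s * w x) \<partial>?M) \<le> ennreal e"
          using K[OF that] by simp
      qed (use l e in auto)
      then show "\<forall>\<^sub>F m in sequentially. wLnorm s D' w (\<lambda>x. u (\<rho> m) x - l * g x) < a"
        unfolding eventually_sequentially using b b' by (intro exI[of _ K]) (auto intro: le_less_trans)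
    qed simp
    \<comment> \<open>Membership of the limit in the weighted space: one element of the sequence at
      distance at most 1 suffices, since its own norm is bounded by \<open>Cs\<close>.\<close>
    obtain m where m: "(\<integral>\<^sup>+x. ennreal (\<bar>v (\<rho> m) x - g x\<bar> powr s * w x) \<partial>?M) \<le> ennreal 1"
      using conv_s[of 1] by auto
    have vs: "(\<integral>\<^sup>+x. ennreal (\<bar>v (\<rho> m) x\<bar> powr s * w x) \<partial>?M) \<le> ennreal Cs" using Csb[OF unit[of "\<rho> m"]] by simp
    have "(\<integral>\<^sup>+x. ennreal (\<bar>g x\<bar> powr s * w x) \<partial>?M) \<le>
       (\<integral>\<^sup>+x. ennreal (2 powr s) * (ennreal (\<bar>v (\<rho> m) x - g x\<bar> powr s * w x) + ennreal (\<bar>v (\<rho> m) x\<bar> powr s * w x)) \<partial>?M)"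
    proof (rule nn_integral_mono)
      fix x
      have "\<bar>g x\<bar> powr s \<le> (\<bar>v (\<rho> m) x - g x\<bar> + \<bar>v (\<rho> m) x\<bar>) powr s" using s by (intro powr_mono2) auto
      also have "\<dots> \<le> 2 powr s * (\<bar>v (\<rho> m) x - g x\<bar> powr s + \<bar>v (\<rho> m) x\<bar> powr s)" using s by (intro powr_add_le) auto
      finally have "\<bar>g x\<bar> powr s * w x \<le> 2 powr s * (\<bar>v (\<rho> m) x - g x\<bar> powr s + \<bar>v (\<rho> m) x\<bar> powr s) * w x"
        by (rule mult_right_mono) (rule w0)
      then have "ennreal (\<bar>g x\<bar> powr s * w x) \<le> ennreal (2 powr s * (\<bar>v (\<rho> m) x - g x\<bar> powr s * w x + \<bar>v (\<rho> m) x\<bar> powr s * w x))"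
        by (intro ennreal_leI) (simp add: distrib_left distrib_right mult.assoc)
      then show "ennreal (\<bar>g x\<bar> powr s * w x) \<le> ennreal (2 powr s) * (ennreal (\<bar>v (\<rho> m) x - g x\<bar> powr s * w x) + ennreal (\<bar>v (\<rho> m) x\<bar> powr s * w x))"
        using w0[of x] by (simp add: ennreal_mult)
    qed
    also have "\<dots> = ennreal (2 powr s) * ((\<integral>\<^sup>+x. ennreal (\<bar>v (\<rho> m) x - g x\<bar> powr s * w x) \<partial>?M) + (\<integral>\<^sup>+x. ennreal (\<bar>v (\<rho> m) x\<bar> powr s * w x) \<partial>?M))"
      by (simp add: nn_integral_add nn_integral_cmult)
    also have "\<dots> \<le> ennreal (2 powr s) * (ennreal 1 + ennreal Cs)" by (intro mult_left_mono add_mono m vs) auto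
    also have "\<dots> = ennreal (2 powr s * (1 + Cs))" using Cs by (simp add: ennreal_mult)
    finally have gb: "(\<integral>\<^sup>+x. ennreal (\<bar>g x\<bar> powr s * w x) \<partial>?M) \<le> ennreal (2 powr s * (1 + Cs))" .
    have "wLnorm s D' w (\<lambda>x. l * g x) \<le> ennreal ((2 powr s * (1 + Cs)) powr (1 / s) * l)"
    proof (rule wLnorm_scale_le)
      have "(1 / l) * (l * g x) = g x" for x using l by simp
      then show "(\<integral>\<^sup>+x. ennreal (norm ((1 / l) * (l * g x)) powr s * w x) \<partial>?M) \<le> ennreal (2 powr s * (1 + Cs))"
        using gb by simp
    qed (use l Cs gm in auto)
    then show "(\<lambda>x. l * g x) \<in> wLspace s D' w"
      using gm le_less_trans[OF _ ennreal_less_top] by (auto simp: wLspace_def)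
  qed
qed

end

theorem theorem3:
  fixes D D' :: "(real ^ 'n) set"
    and \<phi> :: "real ^ 'n \<Rightarrow> real ^ 'n"
    and w :: "real ^ 'n \<Rightarrow> real"
    and Q p q s r :: real
  assumes "CARD('n) \<ge> 2"
    and "embedding_domain D"
    and "0 < Q" and "quasiisometrical Q D D' \<phi>"
    and "1 < p" and "1 \<le> q" and "q \<le> p" and "q < real CARD('n)"
    and "1 \<le> s" and "s \<le> r"
    and "weight w" and "Ap_condition p w"
    and "Kconst p q r s D' w < \<infinity>"
  shows "(r < real CARD('n) * q / (real CARD('n) - q) \<longrightarrow>
            compact_embedding (W1space p D' w) (W1norm p D' w) (wLspace s D' w) (wLnorm s D' w)) \<and>
         (r = real CARD('n) * q / (real CARD('n) - q) \<longrightarrow>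
            bounded_embedding (W1space p D' w) (W1norm p D' w) (wLspace s D' w) (wLnorm s D' w))"
proof -
  have dim: "DIM(real ^ 'n) = CARD('n)" by simp
  define qs where "qs = real DIM(real ^ 'n) * q / (real DIM(real ^ 'n) - q)"
  have q: "q < real DIM(real ^ 'n)" using assms(8) unfolding dim .
  note hyps = assms(2-7) q assms(9,10)
  show ?thesis
    unfolding dim[symmetric] qs_def[symmetric]
    using compact_embedding_weighted[OF hyps _ qs_def assms(11,13)]
      bounded_embedding_weighted[OF hyps _ qs_def assms(11,13)]
    by auto
qed

end
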